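(* Let $(\mathcal G_1,e_1)$ and $(\mathcal G_2,e_2)$ be rooted graphs with spectral distributions $\mu$ and $\nu$. Then the free product admits the comb-orthogonal decomposition $$\mathcal G_1*\mathcal G_2\cong\mathcal G_1\vartriangleright\mathcal L_2,\qquad \mathcal L_2=\mathcal G_2\vdash(\mathcal G_1\vdash(\mathcal G_2\vdash\cdots))$$ (isomorphism of rooted graphs). If $\mathcal G_1$ and $\mathcal G_2$ are uniformly locally finite, the spectral distribution of $(\mathcal G_1*\mathcal G_2,e)$ is $\mu\boxplus\nu$ and $\mu\boxplus\nu=\text{w-}\lim_{m\to\infty}\mu\vartriangleright(\nu\vdash_m\mu)$.
   Context: Graphs: non-oriented, connected, locally finite, simple, nonempty edge set; uniformly locally finite = bounded degrees. Spectral distribution of $(\mathcal G,e)$: probability measure with moments $\langle A^k\delta(e),\delta(e)\rangle$, $A\delta(x)=\sum_{x'\sim x}\delta(x')$. Free product $\mathcal G_1*\mathcal G_2$: vertices the empty word $e$ and alternating words in letters from $V_1\setminus\{e_1\}$, $V_2\setminus\{e_2\}$ (roots identified with the empty word), edges $\{vu,v'u\}$, $\{v,v'\}\in E_1\cup E_2$, $u,vu,v'u$ vertices; root $e$. Comb product $\mathcal G\vartriangleright\mathcal H$: vertex set $V_{\mathcal G}\times V_{\mathcal H}$, root $(e_{\mathcal G},e_{\mathcal H})$, edges $\{(x,e_{\mathcal H}),(x',e_{\mathcal H})\}$ for $\{x,x'\}\in E_{\mathcal G}$ and $\{(x,y),(x,y')\}$ for $x\in V_{\mathcal G}$, $\{y,y'\}\in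 E_{\mathcal H}$ (a copy of $\mathcal H$ glued by its root to every vertex of $\mathcal G$). Orthogonal product $\mathcal G\vdash\mathcal H$: same but with vertex set $((V_{\mathcal G}\setminus\{e_{\mathcal G}\})\times V_{\mathcal H})\cup\{(e_{\mathcal G},e_{\mathcal H})\}$ and the second kind of edges only for $x\ne e_{\mathcal G}$. Set $\mathcal G_1\vdash_0\mathcal G_2=\mathcal G_1$, $\mathcal G_2\vdash_0\mathcal G_1=\mathcal G_2$, $\mathcal G_2\vdash_m\mathcal G_1=\mathcal G_2\vdash(\mathcal G_1\vdash_{m-1}\mathcal G_2)$ and symmetrically. Inclusions: $\mathcal H\hookrightarrow\mathcal H\vdash\mathcal K$ via $y\mapsto(y,e_{\mathcal K})$; a root-preserving embedding $j:\mathcal H\to\mathcal H'$ induces $\mathcal G\vdash\mathcal H\to\mathcal G\vdash\mathcal H'$, $(x,y)\mapsto(x,j(y))$; recursively this gives root-preserving embeddings $\mathcal G_2\vdash_m\mathcal G_1\to\mathcal G_2\vdash_{m+1}\mathcal G_1$, and $\mathcal L_2$ is the inductive limit (union) of this chain. Measures: for compactly supported $\rho$, $G_\rho(z)=\int\frac{d\rho(t)}{z-t}$, $F_\rho=1/G_\rho$, $K_\rho=z-F_\rho$; monotone convolution $\mu\vartriangleright\nu$: $F_{\mu\vartriangleright\nu}=F_\mu\circ F_\nu$; orthogonal convolution $\mu\vdash\nu$: $K_{\mu\vdash\nu}(z)=K_\mu(F_\nu(z))$; $\nu\vdash_1\mu=\nu\vdash\mu$, $\nu\vdash_m\mu=\nu\vdash(\mu\vdash_{m-1}\nu)$;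 $\boxplus$ is the free additive convolution. *)

theory Defs
  imports "HOL-Probability.Probability" "HOL-Computational_Algebra.Polynomial"
begin

section \<open>Rooted graphs\<close>

record 'a rgraph =
  verts :: "'a set"
  edges :: "'a set set"
  root :: 'a

definition neighbours :: "'a rgraph \<Rightarrow> 'a \<Rightarrow> 'a set" where
  "neighbours G x = {y. {x, y} \<in> edges G}"

definition rooted_graph :: "'a rgraph \<Rightarrow> bool" where
  "rooted_graph G \<longleftrightarrow>
     root G \<in> verts G \<and>
     edges G \<subseteq> {{x, y} | x y. x \<in> verts G \<and> y \<in> verts G \<and> x \<noteq> y} \<and>
     edges G \<noteq> {} \<and>
     (\<forall>x\<in>verts G. finite (neighbours G x)) \<and>
     (\<forall>x\<in>verts G. \<forall>y\<in>verts G. (x, y) \<in> {(u, v). {u, v} \<in> edges G}\<^sup>*)"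

text \<open>Meant for locally finite graphs, as the cardinality of an infinite set is \<open>0\<close>.\<close>

definition uniformly_locally_finite :: "'a rgraph \<Rightarrow> bool" where
  "uniformly_locally_finite G \<longleftrightarrow> (\<exists>d. \<forall>x\<in>verts G. card (neighbours G x) \<le> d)"

definition rgraph_iso :: "'a rgraph \<Rightarrow> 'b rgraph \<Rightarrow> bool" where
  "rgraph_iso G H \<longleftrightarrow>
     (\<exists>f. bij_betw f (verts G) (verts H) \<and> f (root G) = root H \<and>
        (\<forall>x\<in>verts G. \<forall>y\<in>verts G. {x, y} \<in> edges G \<longleftrightarrow> {f x, f y} \<in> edges H))"

definition relabel :: "('a \<Rightarrow> 'b) \<Rightarrow> 'a rgraph \<Rightarrow> 'b rgraph" where
  "relabel f G = \<lparr>verts = f ` verts G, edges = (\<lambda>e. f ` e) ` edges G, root = f (root G)\<rparr>"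


section \<open>Spectral distribution at the root\<close>

text \<open>The linear extension of \<open>A \<delta>(x) = \<Sum>x' \<sim> x. \<delta>(x')\<close>: by symmetry of adjacency,
  the value of \<open>A f\<close> at \<open>x\<close> is the sum of \<open>f\<close> over the neighbours of \<open>x\<close>.\<close>

definition adj_op :: "'a rgraph \<Rightarrow> ('a \<Rightarrow> real) \<Rightarrow> 'a \<Rightarrow> real" where
  "adj_op G f = (\<lambda>x. \<Sum>y\<in>neighbours G x. f y)"

definition delta :: "'a \<Rightarrow> 'a \<Rightarrow> real" where
  "delta x = (\<lambda>y. if y = x then 1 else 0)"

definition l2_inner :: "'a rgraph \<Rightarrow> ('a \<Rightarrow> real) \<Rightarrow> ('a \<Rightarrow> real) \<Rightarrow> real" where
  "l2_inner G f g = (\<Sum>\<^sub>\<infinity>x\<in>verts G. f x * g x)"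

definition spectral_distribution :: "'a rgraph \<Rightarrow> real measure \<Rightarrow> bool" where
  "spectral_distribution G \<mu> \<longleftrightarrow>
     real_distribution \<mu> \<and>
     (\<forall>k. integrable \<mu> (\<lambda>t. t ^ k) \<and>
          (LINT t|\<mu>. t ^ k) = l2_inner G ((adj_op G ^^ k) (delta (root G))) (delta (root G)))"


section \<open>Products of rooted graphs\<close>

definition fp_words :: "'a rgraph \<Rightarrow> 'b rgraph \<Rightarrow> ('a + 'b) list set" where
  "fp_words G H =
     {w. set w \<subseteq> Inl ` (verts G - {root G}) \<union> Inr ` (verts H - {root H}) \<and>
         successively (\<lambda>a b. isl a \<noteq> isl b) w}"

text \<open>A vertex of a factor as a word of length at most one; the root is the empty word.\<close>

definition fp_word1 :: "'a rgraph \<Rightarrow> 'a \<Rightarrow> ('a + 'b) list" where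
  "fp_word1 G v = (if v = root G then [] else [Inl v])"

definition fp_word2 :: "'b rgraph \<Rightarrow> 'b \<Rightarrow> ('a + 'b) list" where
  "fp_word2 H v = (if v = root H then [] else [Inr v])"

definition free_product :: "'a rgraph \<Rightarrow> 'b rgraph \<Rightarrow> ('a + 'b) list rgraph" where
  "free_product G H =
     \<lparr>verts = fp_words G H,
      edges =
        {{fp_word1 G v @ u, fp_word1 G v' @ u} | v v' u. {v, v'} \<in> edges G \<and>
           u \<in> fp_words G H \<and> fp_word1 G v @ u \<in> fp_words G H \<and> fp_word1 G v' @ u \<in> fp_words G H} \<union>
        {{fp_word2 H v @ u, fp_word2 H v' @ u} | v v' u. {v, v'} \<in> edges H \<and>
           u \<in> fp_words G H \<and> fp_word2 H v @ u \<in> fp_words G H \<and> fp_word2 H v' @ u \<in> fp_words G H},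
      root = []\<rparr>"

definition comb_product :: "'a rgraph \<Rightarrow> 'b rgraph \<Rightarrow> ('a \<times> 'b) rgraph" where
  "comb_product G H =
     \<lparr>verts = verts G \<times> verts H,
      edges =
        {{(x, root H), (x', root H)} | x x'. {x, x'} \<in> edges G} \<union>
        {{(x, y), (x, y')} | x y y'. x \<in> verts G \<and> {y, y'} \<in> edges H},
      root = (root G, root H)\<rparr>"

definition orth_product :: "'a rgraph \<Rightarrow> 'b rgraph \<Rightarrow> ('a \<times> 'b) rgraph" where
  "orth_product G H =
     \<lparr>verts = (verts G - {root G}) \<times> verts H \<union> {(root G, root H)},
      edges =
        {{(x, root H), (x', root H)} | x x'. {x, x'} \<in> edges G} \<union>
        {{(x, y), (x, y')} | x y y'. x \<in> verts G - {root G} \<and> {y, y'} \<in> edges H},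
      root = (root G, root H)\<rparr>"


section \<open>Iterated orthogonal products and their inductive limit\<close>

text \<open>The vertex type of an \<open>m\<close>-fold iterated product would depend on \<open>m\<close>. Nested pairs are
  therefore stored in one type, the pair \<open>(x, y)\<close> being encoded as \<open>Node x y\<close>.\<close>

datatype 'v nest = Leaf 'v | Node "'v nest" "'v nest"

primrec orth_iter :: "nat \<Rightarrow> 'v nest rgraph \<Rightarrow> 'v nest rgraph \<Rightarrow> 'v nest rgraph" where
  "orth_iter 0 G H = G"
| "orth_iter (Suc m) G H = relabel (\<lambda>(x, y). Node x y) (orth_product G (orth_iter m H G))"

text \<open>The embedding of \<open>orth_iter m G H\<close> into \<open>orth_iter (Suc m) G H\<close>. For \<open>m > 0\<close> all vertices
  of the domain are of the form \<open>Node x y\<close>.\<close>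

primrec orth_emb :: "nat \<Rightarrow> 'v nest rgraph \<Rightarrow> 'v nest rgraph \<Rightarrow> 'v nest \<Rightarrow> 'v nest" where
  "orth_emb 0 G H = (\<lambda>y. Node y (root H))"
| "orth_emb (Suc m) G H = (\<lambda>t. case t of Node x y \<Rightarrow> Node x (orth_emb m H G y) | Leaf v \<Rightarrow> Leaf v)"

text \<open>Inductive limit of a chain of graphs \<open>Gs n\<close> along root-preserving embeddings \<open>j n\<close> of
  \<open>Gs n\<close> into \<open>Gs (Suc n)\<close>: vertices of all stages, modulo being identified at some later stage.\<close>

primrec chain_map :: "(nat \<Rightarrow> 'a \<Rightarrow> 'a) \<Rightarrow> nat \<Rightarrow> nat \<Rightarrow> 'a \<Rightarrow> 'a" where
  "chain_map j n 0 = id"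
| "chain_map j n (Suc k) = j (n + k) \<circ> chain_map j n k"

definition limit_rel :: "(nat \<Rightarrow> 'a rgraph) \<Rightarrow> (nat \<Rightarrow> 'a \<Rightarrow> 'a) \<Rightarrow> ((nat \<times> 'a) \<times> (nat \<times> 'a)) set" where
  "limit_rel Gs j =
     {((n, x), (m, y)). x \<in> verts (Gs n) \<and> y \<in> verts (Gs m) \<and>
        (\<exists>k l. n + k = m + l \<and> chain_map j n k x = chain_map j m l y)}"

definition limit_class :: "(nat \<Rightarrow> 'a rgraph) \<Rightarrow> (nat \<Rightarrow> 'a \<Rightarrow> 'a) \<Rightarrow> nat \<Rightarrow> 'a \<Rightarrow> (nat \<times> 'a) set" where
  "limit_class Gs j n x = limit_rel Gs j `` {(n, x)}"

definition inductive_limit ::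
    "(nat \<Rightarrow> 'a rgraph) \<Rightarrow> (nat \<Rightarrow> 'a \<Rightarrow> 'a) \<Rightarrow> (nat \<times> 'a) set rgraph" where
  "inductive_limit Gs j =
     \<lparr>verts = {limit_class Gs j n x | n x. x \<in> verts (Gs n)},
      edges = {{limit_class Gs j n x, limit_class Gs j n y} | n x y. {x, y} \<in> edges (Gs n)},
      root = limit_class Gs j 0 (root (Gs 0))\<rparr>"

text \<open>\<open>orth_limit G H\<close> is the infinite orthogonal product of \<open>G, H, G, \<dots>\<close> with \<open>G\<close> outermost.\<close>

definition orth_limit :: "'a rgraph \<Rightarrow> 'b rgraph \<Rightarrow> (nat \<times> ('a + 'b) nest) set rgraph" where
  "orth_limit G H =
     (let G' = relabel (\<lambda>x. Leaf (Inl x)) G; H' = relabel (\<lambda>y. Leaf (Inr y)) H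
      in inductive_limit (\<lambda>m. orth_iter m G' H') (\<lambda>m. orth_emb m G' H'))"


section \<open>Convolutions\<close>

definition compactly_supported :: "real measure \<Rightarrow> bool" where
  "compactly_supported \<rho> \<longleftrightarrow> (\<exists>C. compact C \<and> (AE t in \<rho>. t \<in> C))"

definition G_transform :: "real measure \<Rightarrow> complex \<Rightarrow> complex" where
  "G_transform \<rho> z = (LINT t|\<rho>. 1 / (z - complex_of_real t))"

definition F_transform :: "real measure \<Rightarrow> complex \<Rightarrow> complex" where
  "F_transform \<rho> z = 1 / G_transform \<rho> z"

definition K_transform :: "real measure \<Rightarrow> complex \<Rightarrow> complex" where
  "K_transform \<rho> z = z - F_transform \<rho> z"

text \<open>The functional equations are imposed on the open upper half-plane, which \<open>F_transform\<close>
  maps into itself.\<close>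

definition monotone_conv :: "real measure \<Rightarrow> real measure \<Rightarrow> real measure" where
  "monotone_conv \<mu> \<nu> = (THE \<rho>. real_distribution \<rho> \<and> compactly_supported \<rho> \<and>
     (\<forall>z. Im z > 0 \<longrightarrow> F_transform \<rho> z = F_transform \<mu> (F_transform \<nu> z)))"

definition orth_conv :: "real measure \<Rightarrow> real measure \<Rightarrow> real measure" where
  "orth_conv \<mu> \<nu> = (THE \<rho>. real_distribution \<rho> \<and> compactly_supported \<rho> \<and>
     (\<forall>z. Im z > 0 \<longrightarrow> K_transform \<rho> z = K_transform \<mu> (F_transform \<nu> z)))"

primrec orth_conv_iter :: "nat \<Rightarrow> real measure \<Rightarrow> real measure \<Rightarrow> real measure" where
  "orth_conv_iter 0 \<nu> \<mu> = \<nu>"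
| "orth_conv_iter (Suc m) \<nu> \<mu> = orth_conv \<nu> (orth_conv_iter m \<mu> \<nu>)"

text \<open>A unital linear functional \<open>\<phi>\<close> on the noncommutative polynomials in two indeterminates
  \<open>X\<^bsub>True\<^esub>\<close> and \<open>X\<^bsub>False\<^esub>\<close> is given by its values on monomials, a monomial being the list of the
  indices of its factors. \<open>poly_word_value \<phi> w [(i\<^sub>1, p\<^sub>1), \<dots>, (i\<^sub>n, p\<^sub>n)]\<close> is the value of
  \<open>\<phi>\<close> on the product of the monomial \<open>w\<close> with \<open>p\<^sub>1(X\<^bsub>i\<^sub>1\<^esub>) \<cdots> p\<^sub>n(X\<^bsub>i\<^sub>n\<^esub>)\<close>. Real coefficients
  suffice because all moments in question are real.\<close>

primrec poly_word_value :: "(bool list \<Rightarrow> real) \<Rightarrow> bool list \<Rightarrow> (bool \<times> real poly) list \<Rightarrow> real" where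
  "poly_word_value \<phi> w [] = \<phi> w"
| "poly_word_value \<phi> w (ip # ips) =
     (\<Sum>k\<le>degree (snd ip). coeff (snd ip) k * poly_word_value \<phi> (w @ replicate k (fst ip)) ips)"

text \<open>Freeness of the two indeterminates with respect to \<open>\<phi>\<close>: alternating products of centred
  elements of the unital subalgebras they generate are centred.\<close>

definition free_functional :: "(bool list \<Rightarrow> real) \<Rightarrow> bool" where
  "free_functional \<phi> \<longleftrightarrow> \<phi> [] = 1 \<and>
     (\<forall>ips. ips \<noteq> [] \<and> successively (\<lambda>a b. fst a \<noteq> fst b) ips \<and>
        (\<forall>ip\<in>set ips. poly_word_value \<phi> [] [ip] = 0) \<longrightarrow> poly_word_value \<phi> [] ips = 0)"

text \<open>The compactly supported distribution of \<open>X\<^bsub>True\<^esub> + X\<^bsub>False\<^esub>\<close> for free \<open>X\<^bsub>True\<^esub>\<close> and \<open>X\<^bsub>False\<^esub>\<close>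
  with distributions \<open>\<mu>\<close> and \<open>\<nu>\<close>.\<close>

definition free_conv :: "real measure \<Rightarrow> real measure \<Rightarrow> real measure" where
  "free_conv \<mu> \<nu> = (THE \<rho>. real_distribution \<rho> \<and> compactly_supported \<rho> \<and>
     (\<exists>\<phi>. free_functional \<phi> \<and>
        (\<forall>k. \<phi> (replicate k True) = (LINT t|\<mu>. t ^ k)) \<and>
        (\<forall>k. \<phi> (replicate k False) = (LINT t|\<nu>. t ^ k)) \<and>
        (\<forall>n. (LINT t|\<rho>. t ^ n) = (\<Sum>w | length w = n. \<phi> w))))"

end

theory Submission
  imports Defs "HOL-Complex_Analysis.Complex_Analysis" "HOL-Real_Asymp.Real_Asymp"
begin

text \<open>
  Splitting off the last letter of a word, the one next to the root, if it has type \<open>1\<close>, exhibits the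
  free product as copies of the graph of words not ending in type \<open>1\<close>, glued to the vertices of the
  first factor; doing the same to that graph, with the two factors exchanged, yields the infinite
  orthogonal product. The stage \<open>m\<close> of the chain consists of the words of length at most \<open>m + 1\<close>.

  For bounded degrees, a moment sequence determines the measure, and the spectral measures exist by
  Hausdorff's moment problem. The resolvent of the adjacency operator at the root is the only bounded
  solution of \<open>(z - A) \<psi> = \<delta>\<close> for large \<open>z\<close>; solving this equation explicitly on comb and
  orthogonal products by a product ansatz gives the functional equations of the monotone and the
  orthogonal convolution. So the approximating measures are spectral measures of subgraphs of the
  free product that contain all walks of length \<open>k\<close> from the root once \<open>m \<ge> k\<close>, and their moments
  are eventually constant.

  The adjacency operator of the free product is the sum of the adjacency operators along the edges of
  the two types. These are free: applied to a function that vanishes at the words starting with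
  type \<open>c\<close>, a centred polynomial in the operator of type \<open>c\<close> yields a function that is supported by
  the words starting with type \<open>c\<close>.
\<close>

section \<open>Moments and Stieltjes transforms\<close>

text \<open>The three convolutions are definite descriptions, so each identification needs a measure
  that meets the defining conditions as well as uniqueness. Graphs supply the measure: the spectral
  measure of a comb, orthogonal or free product exists because the degrees are bounded, and it is
  then shown to solve the conditions. Uniqueness always passes through moments, read off from the
  Stieltjes transform at infinity or, for \<open>free_conv\<close>, from the unique free functional
  with given marginals.

  Nested pairs change their shape from stage to stage, which makes a direct comparison with the free
  product unwieldy. Every vertex is therefore decoded to a word. The decoding is injective on each
  stage, respects edges and is unchanged by the embeddings of the chain, so that a vertex of the
  limit amounts to a single word.

  The orthogonal product glues no copy at its root because the nonempty words it codes have to end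
  in a letter of the outer factor. In the functional equations the same omission puts
  \<open>z\<close> in place of \<open>F_transform \<nu> z\<close> at the root alone.\<close>

lemma compactly_supported_iff:
  "compactly_supported \<rho> \<longleftrightarrow> (\<exists>C. AE t in \<rho>. \<bar>t\<bar> \<le> C)"
proof
  assume "compactly_supported \<rho>"
  then obtain K where K: "compact K" "AE t in \<rho>. t \<in> K"
    by (auto simp: compactly_supported_def)
  obtain C where "\<And>t. t \<in> K \<Longrightarrow> \<bar>t\<bar> \<le> C"
    using compact_imp_bounded[OF K(1)] by (auto simp: bounded_iff)
  then show "\<exists>C. AE t in \<rho>. \<bar>t\<bar> \<le> C"
    using K(2) by (intro exI[of _ C]) (auto elim!: eventually_mono)
next
  assume "\<exists>C. AE t in \<rho>. \<bar>t\<bar> \<le> C"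
  then obtain C where "AE t in \<rho>. \<bar>t\<bar> \<le> C" by blast
  then have "AE t in \<rho>. t \<in> {-C..C}"
    by (rule AE_mp) auto
  then show "compactly_supported \<rho>"
    unfolding compactly_supported_def by blast
qed

context real_distribution
begin

lemma integrable_power_AE_bounded:
  assumes "AE t in M. \<bar>t\<bar> \<le> C"
  shows "integrable M (\<lambda>t. t ^ k)" "integrable M (\<lambda>t. \<bar>t\<bar> ^ k)"
    and "(LINT t|M. \<bar>t\<bar> ^ k) \<le> C ^ k" "\<bar>LINT t|M. t ^ k\<bar> \<le> C ^ k"
proof -
  have ae: "AE t in M. \<bar>t\<bar> ^ k \<le> C ^ k"
    using assms by eventually_elim (auto intro: power_mono)
  show "integrable M (\<lambda>t. t ^ k)"
    by (rule integrable_const_bound[of _ "C ^ k"]) (use ae in \<open>auto simp: power_abs\<close>)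
  show i: "integrable M (\<lambda>t. \<bar>t\<bar> ^ k)"
    by (rule integrable_const_bound[of _ "C ^ k"]) (use ae in \<open>auto simp: power_abs\<close>)
  have "(LINT t|M. \<bar>t\<bar> ^ k) \<le> (LINT t|M. C ^ k)"
    by (rule integral_mono_AE) (use ae i in auto)
  then show *: "(LINT t|M. \<bar>t\<bar> ^ k) \<le> C ^ k"
    using prob_space by simp
  have "\<bar>LINT t|M. t ^ k\<bar> \<le> (LINT t|M. \<bar>t ^ k\<bar>)"
    by (rule integral_abs_bound)
  with * show "\<bar>LINT t|M. t ^ k\<bar> \<le> C ^ k"
    by (simp add: power_abs)
qed

text \<open>Markov's inequality for \<open>t ^ (2 * k)\<close> bounds the mass of
  \<open>\<bar>t\<bar> \<ge> r\<close> by \<open>(d / r) ^ (2 * k)\<close>; for \<open>r > d\<close>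
  this tends to 0 as \<open>k\<close> grows.\<close>

lemma AE_bounded_if_moments_bounded:
  assumes int: "\<And>k. integrable M (\<lambda>t. t ^ k)" and bd: "\<And>k. (LINT t|M. t ^ k) \<le> d ^ k" and "0 \<le> d"
  shows "AE t in M. \<bar>t\<bar> \<le> d"
proof -
  have *: "prob {t. \<bar>t\<bar> \<ge> r} = 0" if "r > d" for r
  proof -
    have "r > 0" using that \<open>0 \<le> d\<close> by simp
    have le: "prob {t. \<bar>t\<bar> \<ge> r} \<le> ((d / r)\<^sup>2) ^ k" for k
    proof -
      have "prob {t\<in>space M. t ^ (2*k) \<ge> r ^ (2*k)} \<le> (LINT t|M. t ^ (2*k)) / r ^ (2*k)"
        by (rule integral_Markov_inequality_measure[where A="space M"]) (use int \<open>r > 0\<close> in \<open>auto intro!: AE_I2\<close>)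
      also have "\<dots> \<le> d ^ (2*k) / r ^ (2*k)"
        using bd \<open>r > 0\<close> by (intro divide_right_mono) auto
      finally have "prob {t\<in>space M. t ^ (2*k) \<ge> r ^ (2*k)} \<le> ((d / r)\<^sup>2) ^ k"
        by (simp add: power_divide power_mult)
      moreover have "prob {t. \<bar>t\<bar> \<ge> r} \<le> prob {t\<in>space M. t ^ (2*k) \<ge> r ^ (2*k)}"
      proof (rule finite_measure_mono)
        show "{t. r \<le> \<bar>t\<bar>} \<subseteq> {t \<in> space M. r ^ (2 * k) \<le> t ^ (2 * k)}"
        proof safe
          fix t :: real assume "r \<le> \<bar>t\<bar>"
          then have "r ^ (2*k) \<le> \<bar>t\<bar> ^ (2*k)"
            using \<open>r > 0\<close> by (intro power_mono) auto
          then show "r ^ (2*k) \<le> t ^ (2*k)"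
            by (simp add: power_mult)
        qed simp
      qed measurable
      ultimately show ?thesis by linarith
    qed
    have "(d / r)\<^sup>2 < 1"
      using that \<open>0 \<le> d\<close> by (simp add: power_less_one_iff abs_square_less_1)
    then have "(\<lambda>k. ((d / r)\<^sup>2) ^ k) \<longlonglongrightarrow> 0"
      by (intro LIMSEQ_realpow_zero) auto
    then have "prob {t. \<bar>t\<bar> \<ge> r} \<le> 0"
      using le by (intro LIMSEQ_le_const) auto
    then show ?thesis
      by (simp add: measure_le_0_iff)
  qed
  have "AE t in M. \<bar>t\<bar> < d + 1 / Suc n" for n
  proof -
    have "AE t in M. t \<notin> {t. \<bar>t\<bar> \<ge> d + 1 / Suc n}"
      using *[of "d + 1 / Suc n"] by (intro AE_not_in) (auto simp: null_sets_def emeasure_eq_measure)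
    then show ?thesis by (rule AE_mp) auto
  qed
  then have "AE t in M. \<forall>n. \<bar>t\<bar> < d + 1 / Suc n"
    by (simp add: AE_all_countable)
  then show ?thesis
  proof (rule AE_mp, intro AE_I2 impI)
    fix t :: real assume t: "\<forall>n. \<bar>t\<bar> < d + 1 / Suc n"
    show "\<bar>t\<bar> \<le> d"
    proof (rule field_le_epsilon)
      fix e :: real assume "e > 0"
      then obtain n where "inverse (Suc n) < e"
        using reals_Archimedean by blast
      then show "\<bar>t\<bar> \<le> d + e"
        using t[rule_format, of n] by (simp add: inverse_eq_divide)
    qed
  qed
qed

text \<open>The Taylor error depends on the measure only through \<open>C\<close>, so measures with
  a common support bound are approximated uniformly by expressions in finitely many moments.\<close>

lemma char_approx_bounded:
  assumes "AE t in M. \<bar>t\<bar> \<le> C"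
  shows "cmod (char M t - (\<Sum>k\<le>n. ((\<i> * t) ^ k / fact k) * (LINT x|M. x ^ k))) \<le> 2 * (\<bar>t\<bar> * C) ^ n / fact n"
proof -
  have "cmod (char M t - (\<Sum>k\<le>n. ((\<i> * t) ^ k / fact k) * (LINT x|M. x ^ k)))
      \<le> (2 * \<bar>t\<bar> ^ n / fact n) * (LINT x|M. \<bar>x\<bar> ^ n)"
    by (rule char_approx1) (rule integrable_power_AE_bounded[OF assms])
  also have "\<dots> \<le> (2 * \<bar>t\<bar> ^ n / fact n) * C ^ n"
    by (intro mult_left_mono integrable_power_AE_bounded[OF assms]) auto
  finally show ?thesis by (simp add: power_mult_distrib)
qed

end

lemma char_tendsto_if_moments_tendsto:
  assumes "\<And>n. real_distribution (M n)" "real_distribution M'"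
    and M: "\<And>n. AE t in M n. \<bar>t\<bar> \<le> C" and M': "AE t in M'. \<bar>t\<bar> \<le> C"
    and lim: "\<And>k. (\<lambda>n. LINT t|M n. t ^ k) \<longlonglongrightarrow> (LINT t|M'. t ^ k)"
  shows "(\<lambda>n. char (M n) t) \<longlonglongrightarrow> char M' t"
proof (rule LIMSEQ_I)
  fix e :: real assume "e > 0"
  interpret M: real_distribution "M n" for n by fact
  interpret M': real_distribution M' by fact
  define S where "S = (\<lambda>N K. \<Sum>k\<le>K. ((\<i> * t) ^ k / fact k) * complex_of_real (LINT x|N. x ^ k))"
  have "(\<lambda>K. (\<bar>t\<bar> * C) ^ K / fact K) \<longlonglongrightarrow> 0"
    using summable_LIMSEQ_zero[OF summable_exp[of "\<bar>t\<bar> * C"]] by (simp add: divide_inverse mult.commute)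
  then have "(\<lambda>K. 2 * ((\<bar>t\<bar> * C) ^ K / fact K)) \<longlonglongrightarrow> 0"
    by (intro tendsto_mult_right_zero)
  then have "eventually (\<lambda>K. 2 * ((\<bar>t\<bar> * C) ^ K / fact K) < e / 3) sequentially"
    using \<open>e > 0\<close> by (intro order_tendstoD(2)[of _ 0]) auto
  then obtain K where "2 * ((\<bar>t\<bar> * C) ^ K / fact K) < e / 3"
    using eventually_happens'[OF sequentially_bot] by blast
  then have K: "2 * (\<bar>t\<bar> * C) ^ K / fact K < e / 3" by simp
  have "(\<lambda>n. S (M n) K) \<longlonglongrightarrow> S M' K"
    unfolding S_def by (intro tendsto_intros lim)
  then obtain n0 where n0: "\<And>n. n \<ge> n0 \<Longrightarrow> cmod (S (M n) K - S M' K) < e / 3"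
    using LIMSEQ_D[of _ _ "e / 3"] \<open>e > 0\<close> by (metis divide_pos_pos zero_less_numeral)
  have "cmod (char (M n) t - char M' t) < e" if "n \<ge> n0" for n
  proof -
    have "cmod (char (M n) t - S (M n) K) < e / 3" "cmod (char M' t - S M' K) < e / 3"
      using M.char_approx_bounded[OF M, of n t K] M'.char_approx_bounded[OF M', of t K] K
      unfolding S_def by linarith+
    moreover have "char (M n) t - char M' t =
        (char (M n) t - S (M n) K) + (S (M n) K - S M' K) - (char M' t - S M' K)" by simp
    then have "cmod (char (M n) t - char M' t) \<le>
        cmod (char (M n) t - S (M n) K) + cmod (S (M n) K - S M' K) + cmod (char M' t - S M' K)"
      by (metis norm_triangle_ineq norm_triangle_ineq4 add_right_mono order_trans)
    ultimately show ?thesis using n0[OF that] by linarith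
  qed
  then show "\<exists>n0. \<forall>n\<ge>n0. norm (char (M n) t - char M' t) < e" by blast
qed

lemma weak_conv_if_moments_tendsto:
  assumes "\<And>n. real_distribution (M n)" "real_distribution M'"
    and "\<And>n. AE t in M n. \<bar>t\<bar> \<le> C" and "AE t in M'. \<bar>t\<bar> \<le> C"
    and "\<And>k. (\<lambda>n. LINT t|M n. t ^ k) \<longlonglongrightarrow> (LINT t|M'. t ^ k)"
  shows "weak_conv_m M M'"
  by (rule levy_continuity[OF assms(1,2)]) (rule char_tendsto_if_moments_tendsto[OF assms])

text \<open>Convergence of moments is applied to a constant sequence: its characteristic functions
  tend to those of the other measure, hence equal them.\<close>

lemma compactly_supported_eqI:
  assumes "real_distribution M" "real_distribution M'"
    and "compactly_supported M" "compactly_supported M'"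
    and "\<And>k. (LINT t|M. t ^ k) = (LINT t|M'. t ^ k)"
  shows "M = M'"
proof -
  obtain C C' where "AE t in M. \<bar>t\<bar> \<le> C" "AE t in M'. \<bar>t\<bar> \<le> C'"
    using assms(3,4) by (auto simp: compactly_supported_iff)
  then have "AE t in M. \<bar>t\<bar> \<le> max C C'" "AE t in M'. \<bar>t\<bar> \<le> max C C'"
    by (auto elim!: AE_mp)
  then have "(\<lambda>n::nat. char M t) \<longlonglongrightarrow> char M' t" for t
    using assms by (intro char_tendsto_if_moments_tendsto[where C="max C C'"]) auto
  then have "char M = char M'"
    by (auto simp: LIMSEQ_const_iff)
  then show ?thesis using assms(1,2) by (rule Levy_uniqueness[rotated 2])
qed

section \<open>Stieltjes transforms on the upper half-plane\<close>

lemma resolvent_expansion: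
  fixes z :: complex
  assumes "z \<noteq> 0" "z \<noteq> t"
  shows "1 / (z - t) = (\<Sum>k<n. t ^ k / z ^ Suc k) + (t / z) ^ n / (z - t)"
proof (induction n)
  case (Suc n)
  have "(t / z) ^ n / (z - t) = t ^ n / z ^ Suc n + (t / z) ^ Suc n / (z - t)"
    using assms by (simp add: power_divide divide_simps) (simp add: algebra_simps)
  with Suc show ?case by simp
qed simp

lemma norm_resolvent_le:
  assumes "Im z \<noteq> 0"
  shows "cmod (1 / (z - complex_of_real t)) \<le> 1 / \<bar>Im z\<bar>"
proof -
  have "\<bar>Im z\<bar> \<le> cmod (z - complex_of_real t)"
    using abs_Im_le_cmod[of "z - complex_of_real t"] by simp
  with assms show ?thesis
    by (simp add: norm_divide frac_le)
qed

context real_distribution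
begin

lemma integrable_resolvent:
  assumes "Im z \<noteq> 0"
  shows "integrable M (\<lambda>t. 1 / (z - complex_of_real t))"
  by (rule integrable_const_bound[of _ "1 / \<bar>Im z\<bar>"]) (use norm_resolvent_le[OF assms] in auto)

text \<open>For the resolvent kernel, \<open>Im (f t) = - Im z * (cmod (f t))^2\<close>, so
  everything reduces to comparing the squared mean of \<open>cmod (f t)\<close> with the mean of its
  square, which is positivity of a variance. The bound allows transforms to be composed on every
  half-plane \<open>Im z > R\<close> with \<open>R \<ge> 0\<close>.\<close>

lemma Im_F_transform:
  assumes "Im z > 0"
  shows "Im (F_transform M z) \<ge> Im z" "G_transform M z \<noteq> 0"
proof -
  define f where "f = (\<lambda>t. 1 / (z - complex_of_real t))"
  have f: "integrable M f" unfolding f_def using assms by (intro integrable_resolvent) auto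
  have bound: "cmod (f t) \<le> 1 / Im z" for t
    using norm_resolvent_le[of z t] assms by (simp add: f_def)
  have f2: "integrable M (\<lambda>t. (cmod (f t))\<^sup>2)"
    using bound by (intro integrable_const_bound[of _ "(1 / Im z)\<^sup>2"])
      (auto simp: f_def power_mono intro!: power_mono)
  have nz: "f t \<noteq> 0" for t
  proof -
    have "Im (z - complex_of_real t) \<noteq> 0" using assms by simp
    then have "z - complex_of_real t \<noteq> 0" by (metis zero_complex.simps(2))
    then show ?thesis by (simp add: f_def)
  qed
  have Im_f: "Im (f t) = - Im z * (cmod (f t))\<^sup>2" for t
  proof -
    have "f t = inverse (z - complex_of_real t)" by (simp add: f_def divide_inverse)
    then show ?thesis
      by (simp add: norm_inverse power_inverse cmod_power2 divide_inverse)
  qed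
  have G: "G_transform M z = (LINT t|M. f t)" by (simp add: G_transform_def f_def)
  have "Im (G_transform M z) = (LINT t|M. Im (f t))"
    unfolding G using f by (simp add: integral_Im)
  also have "\<dots> = - Im z * (LINT t|M. (cmod (f t))\<^sup>2)"
    unfolding Im_f by simp
  finally have ImG: "Im (G_transform M z) = - Im z * (LINT t|M. (cmod (f t))\<^sup>2)" .
  have "0 < (LINT t|M. (cmod (f t))\<^sup>2)"
    by (rule expectation_greater[OF f2]) (use nz in auto)
  then have "Im (G_transform M z) \<noteq> 0" using assms ImG by simp
  then show nzG: "G_transform M z \<noteq> 0" by auto
  have "(cmod (G_transform M z))\<^sup>2 \<le> (LINT t|M. cmod (f t))\<^sup>2"
    unfolding G by (intro power_mono integral_norm_bound) auto
  also have "\<dots> \<le> (LINT t|M. (cmod (f t))\<^sup>2)"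
    using variance_eq[of "\<lambda>t. cmod (f t)"] variance_positive[of "\<lambda>t. cmod (f t)"] f f2 by simp
  finally have le: "(cmod (G_transform M z))\<^sup>2 \<le> (LINT t|M. (cmod (f t))\<^sup>2)" .
  have "Im (F_transform M z) = - Im (G_transform M z) / (cmod (G_transform M z))\<^sup>2"
    unfolding F_transform_def by (simp add: Im_divide cmod_power2)
  also have "\<dots> = Im z * ((LINT t|M. (cmod (f t))\<^sup>2) / (cmod (G_transform M z))\<^sup>2)"
    using ImG by simp
  also have "\<dots> \<ge> Im z * 1"
    using assms nzG le by (intro mult_left_mono) (auto simp: le_divide_eq)
  finally show "Im (F_transform M z) \<ge> Im z" by simp
qed

text \<open>By the resolvent identity, the difference quotient of \<open>1 / (z - t)\<close> differs
  from its limit \<open>- 1 / (w - t)^2\<close> by \<open>(z - w) / ((z - t) * (w - t)^2)\<close>,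
  which is bounded uniformly in \<open>t\<close>.\<close>

lemma holomorphic_G_transform: "G_transform M holomorphic_on {z. Im z > 0}"
proof (rule holomorphic_onI)
  fix w assume "w \<in> {z. Im z > 0}"
  then have w: "Im w > 0" by simp
  have i2: "integrable M (\<lambda>t. 1 / (w - complex_of_real t) * (1 / (w - complex_of_real t)))"
    by (rule integrable_const_bound[of _ "1 / \<bar>Im w\<bar> * (1 / \<bar>Im w\<bar>)"])
      (use norm_resolvent_le[of w] w in \<open>auto simp del: times_divide_eq_left times_divide_eq_right intro!: AE_I2 norm_mult_ineq[THEN order_trans] mult_mono\<close>)
  define D where "D = - (LINT t|M. 1 / (w - complex_of_real t) * (1 / (w - complex_of_real t)))"
  \<comment> \<open>For \<open>Im z > Im w / 2\<close> the resolvent at \<open>z\<close> is at most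
    \<open>2 / Im w\<close>, and each of the two at \<open>w\<close> is at most
    \<open>1 / Im w\<close>.\<close>
  define c where "c = 2 / Im w * (1 / Im w) * (1 / Im w)"
  have norm_scale: "cmod (LINT t|M. a * h t) = cmod a * cmod (LINT t|M. h t)" for a and h :: "real \<Rightarrow> complex"
    by (simp add: norm_mult)
  have est: "cmod ((G_transform M z - G_transform M w) / (z - w) - D) \<le> cmod (z - w) * c"
    if z: "Im z > Im w / 2" "z \<noteq> w" for z
  proof -
    have z': "Im z > 0" using z w by simp
    have iz: "integrable M (\<lambda>t. 1 / (z - complex_of_real t))" and iw: "integrable M (\<lambda>t. 1 / (w - complex_of_real t))"
      using w z' by (auto intro!: integrable_resolvent)
    have "(G_transform M z - G_transform M w) / (z - w) - D =
      (LINT t|M. (1 / (z - complex_of_real t) - 1 / (w - complex_of_real t)) / (z - w)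
           + 1 / (w - complex_of_real t) * (1 / (w - complex_of_real t)))"
      unfolding G_transform_def D_def using iz iw i2 by simp
    also have "\<dots> = (LINT t|M. (z - w) * (1 / (z - complex_of_real t) * (1 / (w - complex_of_real t)) * (1 / (w - complex_of_real t))))"
    proof (rule Bochner_Integration.integral_cong[OF refl])
      fix t
      have "z - complex_of_real t \<noteq> 0" "w - complex_of_real t \<noteq> 0" using w z' by (auto simp: complex_eq_iff)
      then show "(1 / (z - complex_of_real t) - 1 / (w - complex_of_real t)) / (z - w)
           + 1 / (w - complex_of_real t) * (1 / (w - complex_of_real t)) =
         (z - w) * (1 / (z - complex_of_real t) * (1 / (w - complex_of_real t)) * (1 / (w - complex_of_real t)))"
        using z(2) by (simp add: divide_simps) (simp add: algebra_simps)
    qed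
    finally have "cmod ((G_transform M z - G_transform M w) / (z - w) - D) = cmod (z - w) * cmod (LINT t|M. 1 / (z - complex_of_real t) * (1 / (w - complex_of_real t)) * (1 / (w - complex_of_real t)))"
      by (simp only: norm_scale)
    also have "\<dots> \<le> cmod (z - w) * c"
    proof (rule mult_left_mono[OF _ norm_ge_zero])
      have "cmod (LINT t|M. 1 / (z - complex_of_real t) * (1 / (w - complex_of_real t)) * (1 / (w - complex_of_real t)))
         \<le> (LINT t|M. c)"
      proof (rule Bochner_Integration.integral_norm_bound_integral)
        fix t
        have "cmod (1 / (z - complex_of_real t)) \<le> 1 / \<bar>Im z\<bar>" by (rule norm_resolvent_le) (use z' in auto)
        also have "\<dots> \<le> 2 / Im w" using z w by (simp add: field_simps)
        finally have 1: "cmod (1 / (z - complex_of_real t)) \<le> 2 / Im w" .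
        have 2: "cmod (1 / (w - complex_of_real t)) \<le> 1 / Im w" using norm_resolvent_le[of w t] w by simp
        show b: "norm (1 / (z - complex_of_real t) * (1 / (w - complex_of_real t)) * (1 / (w - complex_of_real t))) \<le> c"
          unfolding c_def norm_mult using 1 2 w by (intro mult_mono) auto
      next
        show "integrable M (\<lambda>t. 1 / (z - complex_of_real t) * (1 / (w - complex_of_real t)) * (1 / (w - complex_of_real t)))"
        proof (rule integrable_const_bound[of _ "1 / \<bar>Im z\<bar> * (1 / \<bar>Im w\<bar>) * (1 / \<bar>Im w\<bar>)"])
          show "AE t in M. norm (1 / (z - complex_of_real t) * (1 / (w - complex_of_real t)) * (1 / (w - complex_of_real t)))
              \<le> 1 / \<bar>Im z\<bar> * (1 / \<bar>Im w\<bar>) * (1 / \<bar>Im w\<bar>)"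
            unfolding norm_mult using norm_resolvent_le[of w] norm_resolvent_le[of z] w z'
            by (intro AE_I2 mult_mono) auto
        qed auto
      qed auto
      then show "cmod (LINT t|M. 1 / (z - complex_of_real t) * (1 / (w - complex_of_real t)) * (1 / (w - complex_of_real t))) \<le> c"
        using prob_space by simp
    qed
    finally show ?thesis .
  qed
  have ev: "\<forall>\<^sub>F z in at w. Im z > Im w / 2 \<and> z \<noteq> w"
  proof -
    have "\<forall>\<^sub>F z in at w. Im z > Im w / 2"
      by (rule order_tendstoD(1)[of _ "Im w"]) (use w in \<open>auto intro!: tendsto_intros\<close>)
    moreover have "\<forall>\<^sub>F z in at w. z \<noteq> w" by (simp add: eventually_at_filter)
    ultimately show ?thesis by eventually_elim auto
  qed
  have "((\<lambda>z. (G_transform M z - G_transform M w) / (z - w) - D) \<longlongrightarrow> 0) (at w)"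
  proof (rule Lim_null_comparison)
    show "\<forall>\<^sub>F z in at w. norm ((G_transform M z - G_transform M w) / (z - w) - D) \<le> cmod (z - w) * c"
      using ev by eventually_elim (use est in auto)
    have "((\<lambda>z. cmod (z - w) * c) \<longlongrightarrow> cmod (w - w) * c) (at w)" by (intro tendsto_intros)
    then show "((\<lambda>z. cmod (z - w) * c) \<longlongrightarrow> 0) (at w)" by simp
  qed
  then have "(G_transform M has_field_derivative D) (at w)"
    unfolding has_field_derivative_iff using Lim_null by blast
  then show "G_transform M field_differentiable at w within {z. Im z > 0}"
    using field_differentiable_at_within field_differentiable_def by blast
qed

lemma holomorphic_F_transform: "F_transform M holomorphic_on {z. Im z > 0}"
  unfolding F_transform_def[abs_def]
  by (intro holomorphic_intros holomorphic_G_transform) (use Im_F_transform in auto)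

text \<open>The geometric series is kept finite with its exact remainder because it serves in two
  regimes: \<open>n\<close> tending to infinity for fixed \<open>cmod z > C\<close>, and fixed
  \<open>n\<close> with \<open>z\<close> tending to infinity along the imaginary axis.\<close>

lemma G_transform_expansion:
  assumes "AE t in M. \<bar>t\<bar> \<le> C" "Im z > 0"
  shows "cmod (G_transform M z - (\<Sum>k<n. complex_of_real (LINT t|M. t ^ k) / z ^ Suc k)) \<le> (C / cmod z) ^ n / Im z"
proof -
  have [simp]: "z \<noteq> 0" using assms(2) by auto
  note i = integrable_power_AE_bounded(1)[OF assms(1)]
  have intc: "integrable M (\<lambda>t. complex_of_real t ^ k)" for k
    using i[of k] by (simp flip: of_real_power)
  have ae: "AE t in M. norm ((complex_of_real t / z) ^ n / (z - complex_of_real t)) \<le> (C / cmod z) ^ n / Im z"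
    using assms(1)
  proof eventually_elim
    fix t assume t: "\<bar>t\<bar> \<le> C"
    have "norm ((complex_of_real t / z) ^ n / (z - complex_of_real t)) = (\<bar>t\<bar> / cmod z) ^ n * cmod (1 / (z - complex_of_real t))"
      by (simp add: norm_divide norm_power norm_mult)
    also have "\<dots> \<le> (C / cmod z) ^ n * (1 / Im z)"
      using t norm_resolvent_le[of z t] assms(2)
      by (intro mult_mono power_mono divide_right_mono) auto
    finally show "norm ((complex_of_real t / z) ^ n / (z - complex_of_real t)) \<le> (C / cmod z) ^ n / Im z" by simp
  qed
  have int: "integrable M (\<lambda>t. (complex_of_real t / z) ^ n / (z - complex_of_real t))"
    by (rule integrable_const_bound[OF ae]) auto
  have "G_transform M z = (LINT t|M. (\<Sum>k<n. complex_of_real t ^ k / z ^ Suc k) + (complex_of_real t / z) ^ n / (z - complex_of_real t))"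
    unfolding G_transform_def
    by (intro Bochner_Integration.integral_cong[OF refl] resolvent_expansion) (use assms(2) in auto)
  also have "\<dots> = (\<Sum>k<n. complex_of_real (LINT t|M. t ^ k) / z ^ Suc k) + (LINT t|M. (complex_of_real t / z) ^ n / (z - complex_of_real t))"
    using int intc
    by (subst Bochner_Integration.integral_add) (auto simp flip: integral_complex_of_real)
  finally have "cmod (G_transform M z - (\<Sum>k<n. complex_of_real (LINT t|M. t ^ k) / z ^ Suc k)) =
     cmod (LINT t|M. (complex_of_real t / z) ^ n / (z - complex_of_real t))" by simp
  also have "\<dots> \<le> (LINT t|M. norm ((complex_of_real t / z) ^ n / (z - complex_of_real t)))"
    by (rule integral_norm_bound)
  also have "\<dots> \<le> (LINT t|M. (C / cmod z) ^ n / Im z)"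
    by (rule integral_mono_AE) (use int ae in auto)
  finally show ?thesis using prob_space by simp
qed

lemma G_transform_sums:
  assumes "AE t in M. \<bar>t\<bar> \<le> C" "Im z > 0" "cmod z > C" "C \<ge> 0"
  shows "(\<lambda>k. complex_of_real (LINT t|M. t ^ k) / z ^ Suc k) sums G_transform M z"
proof -
  have "(\<lambda>n. (\<Sum>k<n. complex_of_real (LINT t|M. t ^ k) / z ^ Suc k) - G_transform M z) \<longlonglongrightarrow> 0"
  proof (rule Lim_null_comparison)
    show "\<forall>\<^sub>F n in sequentially. norm ((\<Sum>k<n. complex_of_real (LINT t|M. t ^ k) / z ^ Suc k) - G_transform M z) \<le> (C / cmod z) ^ n / Im z"
      using G_transform_expansion[OF assms(1,2)] by (auto simp: norm_minus_commute)
    have "C / cmod z < 1" using assms by (subst divide_less_eq_1) auto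
    then have "(\<lambda>n. (C / cmod z) ^ n) \<longlonglongrightarrow> 0"
      using assms by (intro LIMSEQ_realpow_zero) auto
    then show "(\<lambda>n. (C / cmod z) ^ n / Im z) \<longlonglongrightarrow> 0"
      by (rule tendsto_divide_zero)
  qed
  then show ?thesis unfolding sums_def using Lim_null by blast
qed

end

text \<open>Moments are recovered one after the other from the expansion at infinity: once those
  below \<open>n\<close> agree, equality of the transforms at \<open>\<i> * y\<close> leaves a
  difference of the \<open>n\<close>-th moments of order \<open>1 / y\<close>.\<close>

lemma compactly_supported_eqI_F_transform:
  assumes "real_distribution M" "real_distribution M'"
    and "compactly_supported M" "compactly_supported M'"
    and F: "\<And>z. Im z > 0 \<Longrightarrow> F_transform M z = F_transform M' z"
  shows "M = M'"
proof (rule compactly_supported_eqI[OF assms(1-4)])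
  interpret M: real_distribution M by fact
  interpret M': real_distribution M' by fact
  obtain C C' where "AE t in M. \<bar>t\<bar> \<le> C" "AE t in M'. \<bar>t\<bar> \<le> C'"
    using assms(3,4) by (auto simp: compactly_supported_iff)
  then have C: "AE t in M. \<bar>t\<bar> \<le> max C C'" "AE t in M'. \<bar>t\<bar> \<le> max C C'"
    by (auto elim!: eventually_mono)
  define B where "B = max C C'"
  have G: "G_transform M z = G_transform M' z" if "Im z > 0" for z
    using F[OF that] by (simp add: F_transform_def)
  fix n show "(LINT t|M. t ^ n) = (LINT t|M'. t ^ n)"
  proof (induction n rule: less_induct)
    case (less n)
    have le: "\<bar>(LINT t|M. t ^ n) - (LINT t|M'. t ^ n)\<bar> \<le> 2 * B ^ Suc n / y" if "y > 0" for y
    proof -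
      let ?z = "\<i> * complex_of_real y"
      let ?S = "\<lambda>M n. \<Sum>k<n. complex_of_real (LINT t|M. t ^ k) / ?z ^ Suc k"
      let ?d = "complex_of_real ((LINT t|M. t ^ n) - (LINT t|M'. t ^ n))"
      have S: "?S M n = ?S M' n" using less by simp
      have e: "cmod (G_transform M ?z - ?S M (Suc n)) \<le> (B / y) ^ Suc n / y"
        "cmod (G_transform M' ?z - ?S M' (Suc n)) \<le> (B / y) ^ Suc n / y"
        using M.G_transform_expansion[OF C(1), of ?z "Suc n"] M'.G_transform_expansion[OF C(2), of ?z "Suc n"] that
        unfolding B_def by (simp_all add: norm_mult)
      have "cmod (?d / ?z ^ Suc n) = cmod ((G_transform M' ?z - ?S M' (Suc n)) - (G_transform M ?z - ?S M (Suc n)))"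
        using G[of ?z] that S by (simp add: diff_divide_distrib)
      also have "\<dots> \<le> 2 * ((B / y) ^ Suc n / y)"
        using e norm_triangle_ineq4[of "G_transform M' ?z - ?S M' (Suc n)" "G_transform M ?z - ?S M (Suc n)"] by linarith
      finally have "\<bar>(LINT t|M. t ^ n) - (LINT t|M'. t ^ n)\<bar> / y ^ Suc n \<le> 2 * (B ^ Suc n / y) / y ^ Suc n"
        using that by (simp add: norm_divide norm_power norm_mult power_divide mult_ac del: of_real_diff power_Suc)
      then show ?thesis
        using that unfolding divide_le_cancel by (auto simp del: power_Suc)
    qed
    have "((\<lambda>y. 2 * B ^ Suc n / y) \<longlongrightarrow> 0) at_top" by real_asymp
    then have "\<bar>(LINT t|M. t ^ n) - (LINT t|M'. t ^ n)\<bar> \<le> 0"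
      by (rule tendsto_lowerbound) (use le in \<open>auto simp: eventually_at_top_dense intro!: exI[of _ 0]\<close>)
    then show ?case by simp
  qed
qed

lemma monotone_conv_eqI:
  assumes "real_distribution \<rho>" "compactly_supported \<rho>"
    and "\<And>z. Im z > 0 \<Longrightarrow> F_transform \<rho> z = F_transform \<mu> (F_transform \<nu> z)"
  shows "monotone_conv \<mu> \<nu> = \<rho>"
  unfolding monotone_conv_def
  by (rule the_equality) (use assms in \<open>auto intro!: compactly_supported_eqI_F_transform\<close>)

lemma orth_conv_eqI:
  assumes "real_distribution \<rho>" "compactly_supported \<rho>"
    and "\<And>z. Im z > 0 \<Longrightarrow> K_transform \<rho> z = K_transform \<mu> (F_transform \<nu> z)"
  shows "orth_conv \<mu> \<nu> = \<rho>"
  unfolding orth_conv_def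
proof (rule the_equality)
  fix \<rho>' assume *: "real_distribution \<rho>' \<and> compactly_supported \<rho>' \<and>
     (\<forall>z. 0 < Im z \<longrightarrow> K_transform \<rho>' z = K_transform \<mu> (F_transform \<nu> z))"
  show "\<rho>' = \<rho>"
  proof (rule compactly_supported_eqI_F_transform)
    fix z :: complex assume "Im z > 0"
    then have "K_transform \<rho>' z = K_transform \<rho> z" using * assms by simp
    then show "F_transform \<rho>' z = F_transform \<rho> z" by (simp add: K_transform_def)
  qed (use * assms in auto)
qed (use assms in auto)

section \<open>Hausdorff's moment problem\<close>

text \<open>This is \<open>(t + (1 - t)) ^ N = 1\<close> integrated against
  \<open>t ^ a * (1 - t) ^ b\<close>, with the recursion of \<open>c\<close> standing for
  \<open>t + (1 - t) = 1\<close>; Pascal's rule drives the induction.\<close>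

lemma sum_binomial_recursion:
  fixes c :: "nat \<Rightarrow> nat \<Rightarrow> real"
  assumes rec: "\<And>k l. c k l = c (Suc k) l + c k (Suc l)"
  shows "(\<Sum>i\<le>N. (N choose i) * c (a + i) (b + (N - i))) = c a b"
proof (induction N arbitrary: a b)
  case (Suc N)
  define g where "g = (\<lambda>i. c (a + i) (b + (Suc N - i)))"
  have "(\<Sum>i\<le>Suc N. (Suc N choose i) * g i) = g 0 + (\<Sum>i\<le>N. (N choose Suc i) * g (Suc i)) + (\<Sum>i\<le>N. (N choose i) * g (Suc i))"
    by (simp add: sum.atMost_Suc_shift sum.distrib distrib_right del: sum.atMost_Suc)
  also have "g 0 + (\<Sum>i\<le>N. (N choose Suc i) * g (Suc i)) = (\<Sum>i\<le>Suc N. (N choose i) * g i)"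
    by (subst sum.atMost_Suc_shift) simp
  also have "\<dots> = (\<Sum>i\<le>N. (N choose i) * c (a + i) (Suc b + (N - i)))"
    by (auto simp: g_def Suc_diff_le intro!: sum.cong)
  also have "\<dots> = c a (Suc b)" by (rule Suc)
  also have "(\<Sum>i\<le>N. (N choose i) * g (Suc i)) = (\<Sum>i\<le>N. (N choose i) * c (Suc a + i) (b + (N - i)))"
    by (auto simp: g_def intro!: sum.cong)
  also have "\<dots> = c (Suc a) b" by (rule Suc)
  finally show ?case by (simp add: g_def rec[of a b])
qed simp

text \<open>\<open>(N choose k) * (k choose j) = (N choose j) * ((N - j) choose (k - j))\<close>
  reduces this to the preceding identity. It evaluates the normalised factorial moments of the
  approximating law exactly; they then only have to be compared with its ordinary moments.\<close>

lemma sum_binomial_recursion_shift: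
  fixes c :: "nat \<Rightarrow> nat \<Rightarrow> real"
  assumes rec: "\<And>k l. c k l = c (Suc k) l + c k (Suc l)" and "j \<le> N"
  shows "(\<Sum>k\<le>N. (k choose j) / (N choose j) * ((N choose k) * c k (N - k))) = c j 0"
proof -
  have "(\<Sum>k\<le>N. (k choose j) / (N choose j) * ((N choose k) * c k (N - k)))
      = (\<Sum>k\<in>{j..N}. (k choose j) / (N choose j) * ((N choose k) * c k (N - k)))"
    by (rule sum.mono_neutral_right) auto
  also have "\<dots> = (\<Sum>k\<in>{j..N}. ((N - j) choose (k - j)) * c k (N - k))"
  proof (rule sum.cong[OF refl])
    fix k assume "k \<in> {j..N}"
    then have "real ((N choose k) * (k choose j)) = real ((N choose j) * ((N - j) choose (k - j)))"
      by (subst choose_mult) auto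
    moreover have "real (N choose j) \<noteq> 0" using \<open>j \<le> N\<close> by simp
    ultimately have "real (k choose j) / real (N choose j) * real (N choose k) = real ((N - j) choose (k - j))"
      by (simp add: field_simps)
    then show "(k choose j) / (N choose j) * ((N choose k) * c k (N - k)) = ((N - j) choose (k - j)) * c k (N - k)"
      by (metis mult.assoc)
  qed
  also have "\<dots> = (\<Sum>i\<le>N - j. ((N - j) choose i) * c (j + i) (0 + (N - j - i)))"
    by (rule sum.reindex_bij_witness[of _ "\<lambda>i. j + i" "\<lambda>k. k - j"]) (use \<open>j \<le> N\<close> in auto)
  also have "\<dots> = c j 0" by (rule sum_binomial_recursion) (rule rec)
  finally show ?thesis .
qed

text \<open>Both quantities are products of \<open>j\<close> factors of modulus at most 1,
  \<open>(k - i) / (n - i)\<close> and \<open>k / n\<close>, so they differ by at most the sum of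
  the differences of the factors.\<close>

lemma choose_ratio_approx:
  assumes "k \<le> n" "2 * j < n"
  shows "\<bar>(k choose j) / (n choose j) - (real k / n) ^ j\<bar> \<le> j * (j / (n - j))"
proof -
  define a where "a = (\<lambda>i. (real k - real i) / (real n - real i))"
  have ch: "real (m choose j) = (\<Prod>i\<in>{0..<j}. real m - real i) / fact j" for m
    by (simp add: binomial_gbinomial gbinomial_prod_rev)
  have "(k choose j) / (n choose j) = (\<Prod>i\<in>{0..<j}. a i)"
    by (simp add: ch a_def prod_dividef)
  moreover have "(real k / n) ^ j = (\<Prod>i\<in>{0..<j}. real k / n)" by simp
  moreover have "norm ((\<Prod>i\<in>{0..<j}. a i) - (\<Prod>i\<in>{0..<j}. real k / n)) \<le> (\<Sum>i\<in>{0..<j}. norm (a i - real k / n))"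
  proof (rule norm_prod_diff)
    fix i assume "i \<in> {0..<j}"
    \<comment> \<open>For \<open>i > k\<close> the numerator is negative; \<open>2 * j < n\<close>
      keeps its modulus below the denominator.\<close>
    then have "\<bar>real k - real i\<bar> \<le> real n - real i" "real n - real i > 0" using assms by auto
    then show "norm (a i) \<le> 1" by (simp add: a_def abs_divide)
  qed (use assms in \<open>auto simp: divide_le_eq_1\<close>)
  moreover have "(\<Sum>i\<in>{0..<j}. norm (a i - real k / n)) \<le> (\<Sum>i\<in>{0..<j}. j / (real n - j))"
  proof (rule sum_mono)
    fix i assume i: "i \<in> {0..<j}"
    then have pos: "real n - real i > 0" "real n > 0" "real n - real j > 0" using assms by auto
    then have "a i - real k / n = - (real i / (real n - real i) * ((real n - real k) / real n))"
      by (simp add: a_def field_simps)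
    then have "norm (a i - real k / n) = real i / (real n - real i) * ((real n - real k) / real n)"
      using pos assms by (simp add: abs_mult)
    also have "\<dots> \<le> real i / (real n - real i) * 1"
      using pos assms by (intro mult_left_mono) auto
    also have "\<dots> \<le> j / (real n - j)"
      using pos i by (auto intro!: frac_le)
    finally show "norm (a i - real k / n) \<le> j / (real n - j)" .
  qed
  ultimately show ?thesis using assms by (simp add: of_nat_diff)
qed

text \<open>Weak convergence is tested against a bounded continuous function that vanishes exactly
  on \<open>[a, b]\<close>.\<close>

lemma real_distribution_AE_in_limit:
  assumes M: "\<And>n. real_distribution (M n)" "real_distribution L" "weak_conv_m M L"
    and AE: "\<And>n. AE t in M n. a \<le> t \<and> t \<le> b"
  shows "AE t in L. a \<le> t \<and> t \<le> b"
proof -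
  interpret L: real_distribution L by fact
  interpret M: real_distribution "M n" for n by fact
  define g :: "real \<Rightarrow> real" where "g t = min 1 (max 0 (t - b) + max 0 (a - t))" for t
  have cont: "continuous_on UNIV g" unfolding g_def by (intro continuous_intros)
  have bd: "norm (g t) \<le> 1" for t by (auto simp: g_def min_def max_def)
  have [measurable]: "g \<in> borel_measurable borel" using cont by (rule borel_measurable_continuous_onI)
  have "(LINT t|M n. g t) = (LINT t|M n. 0)" for n
    by (rule integral_cong_AE) (use AE[of n] in \<open>auto simp: g_def simp del: AE_conj_iff elim!: eventually_mono\<close>)
  moreover have "(\<lambda>n. LINT t|M n. g t) \<longlonglongrightarrow> (LINT t|L. g t)"
    by (rule weak_conv_imp_integral_bdd_continuous_conv[OF M]) (use cont bd in \<open>auto simp: continuous_on_eq_continuous_at\<close>)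
  ultimately have "(LINT t|L. g t) = 0"
    by (simp add: LIMSEQ_const_iff)
  moreover have "integrable L g" by (rule L.integrable_const_bound[of _ 1]) (use bd in auto)
  ultimately have "AE t in L. g t = 0"
    by (subst (asm) integral_nonneg_eq_0_iff_AE) (auto simp: g_def)
  then show ?thesis
    by eventually_elim (auto simp: g_def min_def max_def split: if_splits)
qed

text \<open>The doubly indexed sequence stands for the integrals of
  \<open>t ^ k * (1 - t) ^ l\<close>; the approximating laws put mass \<open>(n choose k) * c k (n - k)\<close> on \<open>k / n\<close>.\<close>

theorem hausdorff_moment_problem:
  fixes c :: "nat \<Rightarrow> nat \<Rightarrow> real"
  assumes rec: "\<And>k l. c k l = c (Suc k) l + c k (Suc l)" and nonneg: "\<And>k l. c k l \<ge> 0" and "c 0 0 = 1"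
  obtains M where "real_distribution M" "AE t in M. 0 \<le> t \<and> t \<le> 1" "\<And>k. (LINT t|M. t ^ k) = c k 0"
proof -
  \<comment> \<open>The index is shifted to \<open>Suc n\<close> so that the grid points
    \<open>k / Suc n\<close> make sense for every \<open>n\<close>.\<close>
  define w where "w n k = (if k \<le> Suc n then (Suc n choose k) * c k (Suc n - k) else 0)" for n k
  have w_nonneg: "w n k \<ge> 0" for n k using nonneg by (simp add: w_def)
  have w_sum: "(\<Sum>k\<le>Suc n. w n k) = 1" for n
    using sum_binomial_recursion[of c "Suc n" 0 0, OF rec] \<open>c 0 0 = 1\<close> by (simp add: w_def del: sum.atMost_Suc)
  have w_nn: "(\<integral>\<^sup>+k. ennreal (w n k) \<partial>count_space UNIV) = 1" for n
  proof -
    have "(\<integral>\<^sup>+k. ennreal (w n k) \<partial>count_space UNIV) = (\<Sum>k\<le>Suc n. ennreal (w n k))"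
      by (rule nn_integral_count_space'[of "{..Suc n}"]) (auto simp: w_def)
    also have "\<dots> = 1" using w_sum[of n] w_nonneg by (subst sum_ennreal) auto
    finally show ?thesis .
  qed
  define p where "p n = embed_pmf (w n)" for n
  have p: "pmf (p n) k = w n k" for n k
    unfolding p_def using w_nonneg w_nn by (rule pmf_embed_pmf)
  have p_supp: "k \<le> Suc n" if "k \<in> set_pmf (p n)" for n k
    using that by (auto simp: set_pmf_iff p w_def split: if_splits)
  define M where "M n = distr (measure_pmf (p n)) borel (\<lambda>k. real k / Suc n)" for n
  have rd: "real_distribution (M n)" for n
    unfolding M_def by (rule prob_space.real_distribution_distr) (auto intro: measure_pmf.prob_space_axioms)
  interpret M: real_distribution "M n" for n by (rule rd)
  have AE_M: "AE t in M n. 0 \<le> t \<and> t \<le> 1" for n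
    unfolding M_def by (subst AE_distr_iff) (auto simp: AE_measure_pmf_iff dest!: p_supp)
  have int_M: "(LINT t|M n. f t) = (\<Sum>k\<le>Suc n. f (real k / Suc n) * w n k)"
    if [measurable]: "f \<in> borel_measurable borel" for f :: "real \<Rightarrow> real" and n
  proof -
    have "(LINT t|M n. f t) = (LINT k|measure_pmf (p n). f (real k / Suc n))"
      unfolding M_def by (rule integral_distr) auto
    also have "\<dots> = (\<Sum>k\<le>Suc n. f (real k / Suc n) * pmf (p n) k)"
      by (rule integral_measure_pmf_real) (use p_supp in auto)
    finally show ?thesis by (simp add: p)
  qed
  have mom: "(\<lambda>n. LINT t|M n. t ^ j) \<longlonglongrightarrow> c j 0" for j
  proof -
    have est: "\<bar>(LINT t|M n. t ^ j) - c j 0\<bar> \<le> j * (j / (Suc n - j))" if n: "2 * j < Suc n" for n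
    proof -
      have eq: "c j 0 = (\<Sum>k\<le>Suc n. (k choose j) / (Suc n choose j) * w n k)"
        using sum_binomial_recursion_shift[of c j "Suc n", OF rec] n by (simp add: w_def del: sum.atMost_Suc)
      have "c j 0 - (LINT t|M n. t ^ j) = (\<Sum>k\<le>Suc n. ((k choose j) / (Suc n choose j) - (real k / Suc n) ^ j) * w n k)"
        unfolding eq by (subst int_M) (auto simp: left_diff_distrib sum_subtractf simp del: sum.atMost_Suc)
      also have "\<bar>\<dots>\<bar> \<le> (\<Sum>k\<le>Suc n. \<bar>((k choose j) / (Suc n choose j) - (real k / Suc n) ^ j) * w n k\<bar>)"
        by (rule sum_abs)
      also have "\<dots> \<le> (\<Sum>k\<le>Suc n. (j * (j / (Suc n - j))) * w n k)"
        unfolding abs_mult using choose_ratio_approx[of _ "Suc n" j] n w_nonneg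
        by (intro sum_mono mult_mono) auto
      also have "\<dots> = j * (j / (Suc n - j))"
        by (simp only: sum_distrib_left[symmetric] w_sum mult_1_right)
      finally show ?thesis by (simp add: abs_minus_commute)
    qed
    have "(\<lambda>n. (LINT t|M n. t ^ j) - c j 0) \<longlonglongrightarrow> 0"
    proof (rule Lim_null_comparison)
      show "\<forall>\<^sub>F n in sequentially. norm ((LINT t|M n. t ^ j) - c j 0) \<le> j * (j / (real n + 1 - j))"
        using eventually_gt_at_top[of "2 * j"]
      proof eventually_elim
        case (elim n)
        then show ?case using est[of n] by (simp add: of_nat_diff algebra_simps)
      qed
      show "(\<lambda>n. j * (j / (real n + 1 - j))) \<longlonglongrightarrow> 0" by real_asymp
    qed
    then show ?thesis using Lim_null by blast
  qed
  have "tight M"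
    unfolding tight_def
  proof (intro conjI allI impI rd)
    fix e :: real assume "e > 0"
    \<comment> \<open>The half-open interval must contain a possible atom at 0, hence the left end
      \<open>-1\<close>.\<close>
    have "measure (M n) {-1<..1} = 1" for n
    proof -
      have "AE t in M n. t \<in> {-1<..1}" using AE_M[of n] by eventually_elim auto
      then show ?thesis by (intro M.prob_eq_1[THEN iffD2]) auto
    qed
    then show "\<exists>a b. a < b \<and> (\<forall>n. 1 - e < measure (M n) {a<..b})"
      using \<open>e > 0\<close> by (intro exI[of _ "-1"] exI[of _ 1]) auto
  qed
  from tight_imp_convergent_subsubsequence[OF this strict_mono_id]
  obtain r L where r: "strict_mono r" "real_distribution L" "weak_conv_m (M \<circ> r) L" by auto
  interpret L: real_distribution L by fact
  have AE_L: "AE t in L. 0 \<le> t \<and> t \<le> 1"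
    by (rule real_distribution_AE_in_limit[OF _ r(2,3)]) (simp_all only: o_apply rd AE_M)
  have "(LINT t|L. t ^ j) = c j 0" for j
  proof -
    \<comment> \<open>Truncation outside \<open>[0, 1]\<close> turns the power into a bounded test
      function without changing any of the integrals.\<close>
    define f :: "real \<Rightarrow> real" where "f t = (max 0 (min 1 t)) ^ j" for t
    have cont: "continuous_on UNIV f" unfolding f_def by (intro continuous_intros)
    have bd: "norm (f t) \<le> 1" for t by (auto simp: f_def min_def max_def intro: power_le_one)
    have [measurable]: "f \<in> borel_measurable borel" using cont by (rule borel_measurable_continuous_onI)
    have "(LINT t|L. f t) = (LINT t|L. t ^ j)"
      by (rule integral_cong_AE) (use AE_L in \<open>auto simp: f_def simp del: AE_conj_iff elim!: eventually_mono\<close>)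
    moreover have "(LINT t|M n. f t) = (LINT t|M n. t ^ j)" for n
      by (rule integral_cong_AE) (use AE_M[of n] in \<open>auto simp: f_def simp del: AE_conj_iff elim!: eventually_mono\<close>)
    moreover have "(\<lambda>n. LINT t|(M \<circ> r) n. f t) \<longlonglongrightarrow> (LINT t|L. f t)"
      by (rule weak_conv_imp_integral_bdd_continuous_conv[OF _ r(2,3)])
        (use cont bd rd in \<open>auto simp: continuous_on_eq_continuous_at\<close>)
    ultimately have "(\<lambda>n. LINT t|M (r n). t ^ j) \<longlonglongrightarrow> (LINT t|L. t ^ j)" by simp
    moreover have "(\<lambda>n. LINT t|M (r n). t ^ j) \<longlonglongrightarrow> c j 0"
      using LIMSEQ_subseq_LIMSEQ[OF mom r(1)] by (simp add: o_def)
    ultimately show ?thesis by (rule LIMSEQ_unique)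
  qed
  then show ?thesis using that[OF r(2) AE_L] by blast
qed

section \<open>Rooted graphs of bounded degree\<close>

locale simple_rooted_graph =
  fixes G :: "'a rgraph"
  assumes root_in_verts [simp]: "root G \<in> verts G"
    and edges_subset: "edges G \<subseteq> {{x, y} | x y. x \<in> verts G \<and> y \<in> verts G \<and> x \<noteq> y}"
begin

lemma edge_verts:
  assumes "{x, y} \<in> edges G"
  shows "x \<in> verts G" "y \<in> verts G" "x \<noteq> y"
  using subsetD[OF edges_subset assms] by (auto simp: doubleton_eq_iff)

lemma neighboursD:
  assumes "y \<in> neighbours G x"
  shows "x \<in> verts G" "y \<in> verts G" "x \<noteq> y"
  using edge_verts[of x y] assms by (auto simp: neighbours_def)

lemma neighbours_sym: "y \<in> neighbours G x \<longleftrightarrow> x \<in> neighbours G y"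
  by (simp add: neighbours_def insert_commute)

lemma neighbours_outside: "x \<notin> verts G \<Longrightarrow> neighbours G x = {}"
  using neighboursD(1) by blast

end

lemma rooted_graph_imp_simple: "rooted_graph G \<Longrightarrow> simple_rooted_graph G"
  by (simp add: rooted_graph_def simple_rooted_graph_def)

text \<open>The conditions range over the whole type: a point outside \<open>verts G\<close> has no
  neighbours, and membership side conditions disappear.\<close>

locale bounded_degree_graph = simple_rooted_graph G for G :: "'a rgraph" +
  fixes d :: nat
  assumes finite_neighbours [simp]: "finite (neighbours G x)"
    and card_neighbours: "card (neighbours G x) \<le> d"

lemma bounded_degree_graphI:
  assumes "simple_rooted_graph G"
    and "\<And>x. x \<in> verts G \<Longrightarrow> finite (neighbours G x) \<and> card (neighbours G x) \<le> d"
  shows "bounded_degree_graph G d"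
proof -
  interpret simple_rooted_graph G by fact
  show ?thesis
  proof
    fix x show "finite (neighbours G x)" "card (neighbours G x) \<le> d"
      using assms(2)[of x] neighbours_outside[of x] by (cases "x \<in> verts G"; simp)+
  qed
qed

lemma rooted_graph_imp_bounded:
  assumes "rooted_graph G" "uniformly_locally_finite G"
  obtains d where "bounded_degree_graph G d"
proof -
  obtain d where "\<forall>x\<in>verts G. card (neighbours G x) \<le> d"
    using assms(2) by (auto simp: uniformly_locally_finite_def)
  then have "bounded_degree_graph G d"
    using assms(1) by (intro bounded_degree_graphI rooted_graph_imp_simple) (auto simp: rooted_graph_def)
  then show ?thesis by (rule that)
qed

section \<open>The adjacency operator as a symmetric form; existence of spectral measures\<close>

lemma l2_inner_delta: "x \<in> verts G \<Longrightarrow> l2_inner G f (delta x) = f x"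
  unfolding l2_inner_def
  by (subst infsum_cong_neutral[of "{x}" _ "\<lambda>y. f y * delta x y" "\<lambda>y. f y * delta x y"]) (auto simp: delta_def)

lemma adj_op_linear: "adj_op G (\<lambda>x. a * f x + b * g x) = (\<lambda>x. a * adj_op G f x + b * adj_op G g x)"
  by (simp add: adj_op_def sum.distrib sum_distrib_left)

text \<open>The polynomials of degree at most one in the adjacency operator. They commute and are
  symmetric, and the moment problem below is built from two of them that add up to the
  identity.\<close>

definition affine_adj :: "'a rgraph \<Rightarrow> real \<Rightarrow> real \<Rightarrow> ('a \<Rightarrow> real) \<Rightarrow> 'a \<Rightarrow> real" where
  "affine_adj G a b f = (\<lambda>x. a * f x + b * adj_op G f x)"

lemma affine_adj_linear:
  "affine_adj G a b (\<lambda>x. s * f x + t * g x) = (\<lambda>x. s * affine_adj G a b f x + t * affine_adj G a b g x)"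
  unfolding affine_adj_def adj_op_linear by (auto simp: algebra_simps)

lemma affine_adj_pow_linear:
  "(affine_adj G a b ^^ k) (\<lambda>x. s * f x + t * g x) =
    (\<lambda>x. s * (affine_adj G a b ^^ k) f x + t * (affine_adj G a b ^^ k) g x)"
  by (induction k) (auto simp: affine_adj_linear)

lemma affine_adj_commute: "affine_adj G a b (affine_adj G a' b' f) = affine_adj G a' b' (affine_adj G a b f)"
  unfolding affine_adj_def adj_op_linear by (auto simp: algebra_simps)

lemma affine_adj_pow_commute:
  "(affine_adj G a b ^^ k) ((affine_adj G a' b' ^^ l) f) = (affine_adj G a' b' ^^ l) ((affine_adj G a b ^^ k) f)"
proof -
  have "affine_adj G a b ((affine_adj G a' b' ^^ l) f) = (affine_adj G a' b' ^^ l) (affine_adj G a b f)" for f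
    by (induction l) (simp_all add: affine_adj_commute[of G a b a' b'])
  then show ?thesis by (induction k) simp_all
qed

text \<open>Junk if \<open>f\<close> has infinite support.\<close>

definition fin_inner :: "('a \<Rightarrow> real) \<Rightarrow> ('a \<Rightarrow> real) \<Rightarrow> real" where
  "fin_inner f g = (\<Sum>x | f x \<noteq> 0. f x * g x)"

definition finsupp :: "('a \<Rightarrow> real) \<Rightarrow> bool" where
  "finsupp f \<longleftrightarrow> finite {x. f x \<noteq> 0}"

lemma fin_inner_eq: "finite S \<Longrightarrow> {x. f x \<noteq> 0} \<subseteq> S \<Longrightarrow> fin_inner f g = (\<Sum>x\<in>S. f x * g x)"
  unfolding fin_inner_def by (rule sum.mono_neutral_left) auto

lemma fin_inner_delta: "fin_inner (delta x) f = f x"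
  by (subst fin_inner_eq[of "{x}"]) (auto simp: delta_def)

lemma finsupp_delta: "finsupp (delta x)"
  unfolding finsupp_def delta_def by (rule finite_subset[of _ "{x}"]) auto

context bounded_degree_graph
begin

lemma abs_adj_op_pow_delta: "\<bar>(adj_op G ^^ k) (delta (root G)) x\<bar> \<le> real d ^ k"
proof (induction k arbitrary: x)
  case (Suc k)
  have "\<bar>(adj_op G ^^ Suc k) (delta (root G)) x\<bar> \<le> (\<Sum>y\<in>neighbours G x. \<bar>(adj_op G ^^ k) (delta (root G)) y\<bar>)"
    by (simp add: adj_op_def sum_abs)
  also have "\<dots> \<le> (\<Sum>y\<in>neighbours G x. real d ^ k)"
    by (intro sum_mono) (rule Suc)
  also have "\<dots> \<le> real d * real d ^ k"
    using card_neighbours[of x] by (simp add: mult_right_mono)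
  finally show ?case by simp
qed (auto simp: delta_def)

lemma spectral_distribution_iff:
  "spectral_distribution G \<mu> \<longleftrightarrow> real_distribution \<mu> \<and>
     (\<forall>k. integrable \<mu> (\<lambda>t. t ^ k) \<and> (LINT t|\<mu>. t ^ k) = (adj_op G ^^ k) (delta (root G)) (root G))"
  by (simp add: spectral_distribution_def l2_inner_delta)

lemma spectral_distribution_AE:
  assumes "spectral_distribution G \<mu>"
  shows "AE t in \<mu>. \<bar>t\<bar> \<le> d"
proof -
  interpret real_distribution \<mu> using assms by (simp add: spectral_distribution_iff)
  show ?thesis
  proof (rule AE_bounded_if_moments_bounded)
    fix k show "(LINT t|\<mu>. t ^ k) \<le> real d ^ k"
      using assms abs_adj_op_pow_delta[of k "root G"] by (auto simp: spectral_distribution_iff)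
  qed (use assms in \<open>auto simp: spectral_distribution_iff\<close>)
qed

lemma spectral_distribution_compactly_supported: "spectral_distribution G \<mu> \<Longrightarrow> compactly_supported \<mu>"
  using spectral_distribution_AE compactly_supported_iff by blast

lemma finsupp_adj_op:
  assumes "finsupp f"
  shows "finsupp (adj_op G f)"
proof -
  have "{x. adj_op G f x \<noteq> 0} \<subseteq> (\<Union>y\<in>{y. f y \<noteq> 0}. neighbours G y)"
  proof
    fix x assume "x \<in> {x. adj_op G f x \<noteq> 0}"
    then obtain y where "y \<in> neighbours G x" "f y \<noteq> 0"
      by (auto simp: adj_op_def elim: sum.not_neutral_contains_not_neutral)
    then show "x \<in> (\<Union>y\<in>{y. f y \<noteq> 0}. neighbours G y)"
      using neighbours_sym by blast
  qed
  moreover have "finite (\<Union>y\<in>{y. f y \<noteq> 0}. neighbours G y)"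
    using assms by (auto simp: finsupp_def)
  ultimately show ?thesis unfolding finsupp_def by (rule finite_subset)
qed

lemma finsupp_affine_adj: "finsupp f \<Longrightarrow> finsupp (affine_adj G a b f)"
  unfolding finsupp_def
  by (rule finite_subset[of _ "{x. f x \<noteq> 0} \<union> {x. adj_op G f x \<noteq> 0}"])
    (use finsupp_adj_op in \<open>auto simp: affine_adj_def finsupp_def\<close>)

lemma finsupp_affine_adj_pow: "finsupp f \<Longrightarrow> finsupp ((affine_adj G a b ^^ k) f)"
  by (induction k) (auto intro: finsupp_affine_adj)

lemma adj_op_sum_on:
  assumes "finite S" "{x. f x \<noteq> 0} \<subseteq> S"
  shows "adj_op G f x = (\<Sum>y\<in>S. of_bool ({x, y} \<in> edges G) * f y)"
proof -
  have "adj_op G f x = (\<Sum>y\<in>neighbours G x \<inter> S. f y)"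
    unfolding adj_op_def by (rule sum.mono_neutral_right) (use assms in auto)
  also have "\<dots> = (\<Sum>y\<in>S. of_bool ({x, y} \<in> edges G) * f y)"
    by (rule sum.mono_neutral_cong_left) (use assms(1) in \<open>auto simp: neighbours_def\<close>)
  finally show ?thesis .
qed

lemma fin_inner_affine_adj:
  assumes "finsupp f" "finsupp g"
  shows "fin_inner (affine_adj G a b f) g = fin_inner f (affine_adj G a b g)"
proof -
  define S where "S = {x. f x \<noteq> 0} \<union> {x. g x \<noteq> 0} \<union> {x. affine_adj G a b f x \<noteq> 0}"
  have S: "finite S" "{x. f x \<noteq> 0} \<subseteq> S" "{x. g x \<noteq> 0} \<subseteq> S" "{x. affine_adj G a b f x \<noteq> 0} \<subseteq> S"
    using assms finsupp_affine_adj[OF assms(1), of a b] by (auto simp: S_def finsupp_def)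
  have "(\<Sum>x\<in>S. adj_op G f x * g x) = (\<Sum>x\<in>S. \<Sum>y\<in>S. of_bool ({x, y} \<in> edges G) * f y * g x)"
    unfolding adj_op_sum_on[OF S(1,2)] sum_distrib_right ..
  also have "\<dots> = (\<Sum>y\<in>S. \<Sum>x\<in>S. of_bool ({x, y} \<in> edges G) * f y * g x)"
    by (rule sum.swap)
  also have "\<dots> = (\<Sum>x\<in>S. f x * adj_op G g x)"
    unfolding adj_op_sum_on[OF S(1,3)] sum_distrib_left
    by (intro sum.cong refl) (simp add: insert_commute[of _ _ "{}"])
  finally have "(\<Sum>x\<in>S. adj_op G f x * g x) = (\<Sum>x\<in>S. f x * adj_op G g x)" .
  moreover have "fin_inner (affine_adj G a b f) g = a * (\<Sum>x\<in>S. f x * g x) + b * (\<Sum>x\<in>S. adj_op G f x * g x)"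
    using S by (simp add: fin_inner_eq[of S] affine_adj_def algebra_simps sum.distrib sum_distrib_left)
  moreover have "fin_inner f (affine_adj G a b g) = a * (\<Sum>x\<in>S. f x * g x) + b * (\<Sum>x\<in>S. f x * adj_op G g x)"
    using S by (simp add: fin_inner_eq[of S] affine_adj_def algebra_simps sum.distrib sum_distrib_left)
  ultimately show ?thesis by simp
qed

lemma fin_inner_affine_adj_pow:
  assumes "finsupp f" "finsupp g"
  shows "fin_inner ((affine_adj G a b ^^ k) f) g = fin_inner f ((affine_adj G a b ^^ k) g)"
  using assms
proof (induction k arbitrary: g)
  case (Suc k)
  have "fin_inner ((affine_adj G a b ^^ Suc k) f) g = fin_inner ((affine_adj G a b ^^ k) f) (affine_adj G a b g)"
    using Suc.prems by (simp add: fin_inner_affine_adj finsupp_affine_adj_pow)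
  also have "\<dots> = fin_inner f ((affine_adj G a b ^^ k) (affine_adj G a b g))"
    by (rule Suc.IH) (use Suc.prems in \<open>auto intro: finsupp_affine_adj\<close>)
  finally show ?case by (simp add: funpow_swap1)
qed simp

text \<open>Summing \<open>2 * \<bar>f x * f y\<bar> \<le> (f x)^2 + (f y)^2\<close> over adjacent
  pairs bounds the quadratic form of the adjacency operator by \<open>d\<close> times the squared
  norm, which \<open>a\<close> then dominates.\<close>

lemma fin_inner_affine_adj_nonneg:
  fixes a b :: real
  assumes "finsupp f" "\<bar>b\<bar> * d \<le> a"
  shows "fin_inner f (affine_adj G a b f) \<ge> 0"
proof -
  define S where "S = {x. f x \<noteq> 0}"
  have S: "finite S" "{x. f x \<noteq> 0} \<subseteq> S" using assms by (auto simp: S_def finsupp_def)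
  define e where "e x y = (of_bool ({x, y} \<in> edges G) :: real)" for x y
  have e_sym: "e x y = e y x" for x y by (simp add: e_def insert_commute)
  have e_nonneg: "e x y \<ge> 0" for x y by (simp add: e_def)
  have deg: "(\<Sum>x\<in>S. \<Sum>y\<in>S. e x y * (f x)\<^sup>2) \<le> d * (\<Sum>x\<in>S. (f x)\<^sup>2)"
  proof -
    have "(\<Sum>y\<in>S. e x y) \<le> d" for x
    proof -
      have "(\<Sum>y\<in>S. e x y) = card (S \<inter> neighbours G x)"
        using S(1) by (simp add: e_def neighbours_def Int_def)
      also have "\<dots> \<le> card (neighbours G x)"
        by (simp add: card_mono)
      finally show ?thesis using card_neighbours[of x] by linarith
    qed
    then show ?thesis unfolding sum_distrib_left sum_distrib_right[symmetric]
      by (intro sum_mono mult_right_mono) auto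
  qed
  have swap: "(\<Sum>x\<in>S. \<Sum>y\<in>S. e x y * (f y)\<^sup>2) = (\<Sum>x\<in>S. \<Sum>y\<in>S. e x y * (f x)\<^sup>2)"
    by (subst sum.swap) (simp add: e_sym)
  have "\<bar>\<Sum>x\<in>S. f x * adj_op G f x\<bar> = \<bar>\<Sum>x\<in>S. \<Sum>y\<in>S. e x y * (f x * f y)\<bar>"
    unfolding adj_op_sum_on[OF S] sum_distrib_left e_def
    by (intro arg_cong[of _ _ abs] sum.cong refl) simp
  also have "\<dots> \<le> (\<Sum>x\<in>S. \<Sum>y\<in>S. \<bar>e x y * (f x * f y)\<bar>)"
    by (intro sum_abs[THEN order_trans] sum_mono sum_abs)
  also have "\<dots> \<le> (\<Sum>x\<in>S. \<Sum>y\<in>S. e x y * (f x)\<^sup>2 / 2 + e x y * (f y)\<^sup>2 / 2)"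
  proof (intro sum_mono)
    fix x y
    have "2 * (\<bar>f x\<bar> * \<bar>f y\<bar>) \<le> (f x)\<^sup>2 + (f y)\<^sup>2"
      using sum_squares_bound[of "\<bar>f x\<bar>" "\<bar>f y\<bar>"] by simp
    then have "e x y * (\<bar>f x\<bar> * \<bar>f y\<bar>) \<le> e x y * (((f x)\<^sup>2 + (f y)\<^sup>2) / 2)"
      by (intro mult_left_mono e_nonneg) simp
    then show "\<bar>e x y * (f x * f y)\<bar> \<le> e x y * (f x)\<^sup>2 / 2 + e x y * (f y)\<^sup>2 / 2"
      using e_nonneg[of x y] by (simp add: abs_mult algebra_simps add_divide_distrib)
  qed
  also have "\<dots> = (\<Sum>x\<in>S. \<Sum>y\<in>S. e x y * (f x)\<^sup>2)"
    unfolding sum.distrib sum_divide_distrib[symmetric] swap by simp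
  finally have A: "\<bar>\<Sum>x\<in>S. f x * adj_op G f x\<bar> \<le> d * (\<Sum>x\<in>S. (f x)\<^sup>2)" using deg by linarith
  have "\<bar>b * (\<Sum>x\<in>S. f x * adj_op G f x)\<bar> \<le> \<bar>b\<bar> * (d * (\<Sum>x\<in>S. (f x)\<^sup>2))"
    unfolding abs_mult by (intro mult_left_mono A) auto
  also have "\<dots> \<le> a * (\<Sum>x\<in>S. (f x)\<^sup>2)"
    using assms(2) by (simp flip: mult.assoc add: mult_right_mono sum_nonneg)
  finally have "0 \<le> a * (\<Sum>x\<in>S. (f x)\<^sup>2) + b * (\<Sum>x\<in>S. f x * adj_op G f x)" by linarith
  also have "\<dots> = fin_inner f (affine_adj G a b f)"
    using S by (simp add: fin_inner_eq[of S] affine_adj_def algebra_simps sum.distrib sum_distrib_left power2_eq_square)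
  finally show ?thesis .
qed

text \<open>The adjacency operator \<open>A\<close> has norm at most \<open>D = d + 1\<close>, so \<open>B = (D + A) / (2 D)\<close>
  lies between \<open>0\<close> and \<open>1\<close>, and the numbers \<open>\<langle>B ^ k (1 - B) ^ l \<delta>, \<delta>\<rangle>\<close> solve a Hausdorff moment problem.\<close>

theorem spectral_distribution_exists: "\<exists>\<mu>. spectral_distribution G \<mu>"
proof -
  \<comment> \<open>The summand 1 keeps \<open>D\<close> nonzero for \<open>d = 0\<close>.\<close>
  define D where "D = real d + 1"
  define B where "B = affine_adj G (1 / 2) (1 / (2 * D))"
  define C where "C = affine_adj G (1 / 2) (- 1 / (2 * D))"
  let ?\<delta> = "delta (root G)"
  define c where "c k l = (B ^^ k) ((C ^^ l) ?\<delta>) (root G)" for k l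
  have "D > 0" by (simp add: D_def)
  have BC: "(\<lambda>x. 1 * B f x + 1 * C f x) = f" for f
    using \<open>D > 0\<close> by (auto simp: B_def C_def affine_adj_def field_simps)
  have rec: "c k l = c (Suc k) l + c k (Suc l)" for k l
  proof -
    have "c k l = (B ^^ k) (\<lambda>x. 1 * B ((C ^^ l) ?\<delta>) x + 1 * C ((C ^^ l) ?\<delta>) x) (root G)"
      unfolding BC c_def ..
    also have "\<dots> = c (Suc k) l + c k (Suc l)"
      unfolding B_def affine_adj_pow_linear by (simp add: c_def B_def funpow_swap1)
    finally show ?thesis .
  qed
  \<comment> \<open>Half of each even power is moved to the other side of the inner product, so that
    positivity is only in question for \<open>s\<close> and \<open>t\<close> equal to 0 or
    1.\<close>
  have even: "c (2 * p + s) (2 * q + t) =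
      fin_inner ((B ^^ p) ((C ^^ q) ?\<delta>)) ((B ^^ s) ((C ^^ t) ((B ^^ p) ((C ^^ q) ?\<delta>))))" for p q s t
  proof -
    have comm: "(B ^^ m) ((C ^^ n) f) = (C ^^ n) ((B ^^ m) f)" for m n f
      unfolding B_def C_def by (rule affine_adj_pow_commute)
    have pow: "(F ^^ (2 * m + n)) f = (F ^^ m) ((F ^^ n) ((F ^^ m) f))" for F :: "('a \<Rightarrow> real) \<Rightarrow> 'a \<Rightarrow> real" and m n f
    proof -
      have "2 * m + n = m + (n + m)" by simp
      then show ?thesis by (simp only: funpow_add o_apply)
    qed
    have fs: "finsupp ((B ^^ m) f)" "finsupp ((C ^^ m) f)" if "finsupp f" for m f
      using that by (auto simp: B_def C_def finsupp_affine_adj_pow)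
    have ip: "fin_inner ((B ^^ m) f) g = fin_inner f ((B ^^ m) g)" "fin_inner ((C ^^ m) f) g = fin_inner f ((C ^^ m) g)"
      if "finsupp f" "finsupp g" for m f g
      using that by (auto simp: B_def C_def fin_inner_affine_adj_pow)
    have "c (2 * p + s) (2 * q + t) = fin_inner ?\<delta> ((B ^^ p) ((B ^^ s) ((B ^^ p) ((C ^^ q) ((C ^^ t) ((C ^^ q) ?\<delta>))))))"
      unfolding c_def fin_inner_delta pow ..
    also have "\<dots> = fin_inner ?\<delta> ((C ^^ q) ((B ^^ p) ((B ^^ s) ((C ^^ t) ((B ^^ p) ((C ^^ q) ?\<delta>))))))"
      by (simp add: comm)
    also have "\<dots> = fin_inner ((B ^^ p) ((C ^^ q) ?\<delta>)) ((B ^^ s) ((C ^^ t) ((B ^^ p) ((C ^^ q) ?\<delta>))))"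
      by (simp add: ip fs finsupp_delta)
    finally show ?thesis .
  qed
  have fsv: "finsupp ((B ^^ p) ((C ^^ q) ?\<delta>))" for p q
    by (simp add: B_def C_def finsupp_affine_adj_pow finsupp_delta)
  have dD: "\<bar>1 / (2 * D)\<bar> * d \<le> 1 / 2" "\<bar>- 1 / (2 * D)\<bar> * d \<le> 1 / 2"
    by (auto simp: D_def field_simps abs_if)
  have ee: "c (2 * p) (2 * q) \<ge> 0" for p q
    using even[of p 0 q 0] by (simp add: fin_inner_def sum_nonneg)
  have oe: "c (2 * p + 1) (2 * q) \<ge> 0" for p q
    using even[of p 1 q 0] fin_inner_affine_adj_nonneg[OF fsv dD(1), of p q] by (simp add: B_def)
  have eo: "c (2 * p) (2 * q + 1) \<ge> 0" for p q
    using even[of p 0 q 1] fin_inner_affine_adj_nonneg[OF fsv dD(2), of p q] by (simp add: C_def)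
  \<comment> \<open>\<open>B C = B^2 C + B C^2\<close>, by the recursion, and both summands have
    been treated.\<close>
  have oo: "c (2 * p + 1) (2 * q + 1) \<ge> 0" for p q
    using rec[of "2 * p + 1" "2 * q + 1"] eo[of "p + 1" q] oe[of p "q + 1"] by simp
  have nonneg: "c k l \<ge> 0" for k l
    using ee[of "k div 2" "l div 2"] oe[of "k div 2" "l div 2"] eo[of "k div 2" "l div 2"] oo[of "k div 2" "l div 2"]
    by (cases "even k"; cases "even l") (auto elim!: evenE oddE)
  have "c 0 0 = 1" by (simp add: c_def delta_def)
  from hausdorff_moment_problem[of c, OF rec nonneg this]
  obtain M where M: "real_distribution M" "AE t in M. 0 \<le> t \<and> t \<le> 1" "\<And>k. (LINT t|M. t ^ k) = c k 0" by blast
  interpret M: real_distribution M by fact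
  have int: "integrable M (\<lambda>t. t ^ j * (2 * D * t - D) ^ k)" for j k
  proof (rule M.integrable_const_bound[of _ "D ^ k"])
    show "AE t in M. norm (t ^ j * (2 * D * t - D) ^ k) \<le> D ^ k"
      using M(2)
    proof eventually_elim
      fix t :: real assume t: "0 \<le> t \<and> t \<le> 1"
      have "\<bar>2 * D * t - D\<bar> \<le> D" using t \<open>D > 0\<close> by (auto simp: abs_if field_simps)
      then have "\<bar>t\<bar> ^ j * \<bar>2 * D * t - D\<bar> ^ k \<le> 1 * D ^ k"
        using t \<open>D > 0\<close> by (intro mult_mono power_mono power_le_one) auto
      then show "norm (t ^ j * (2 * D * t - D) ^ k) \<le> D ^ k" by (simp add: abs_mult power_abs)
    qed
  qed auto
  have A_eq: "adj_op G f = (\<lambda>x. 2 * D * B f x + - D * f x)" for f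
    using \<open>D > 0\<close> by (auto simp: B_def affine_adj_def field_simps)
  \<comment> \<open>The factor \<open>t ^ j\<close> is carried along because expanding one factor
    \<open>2 * D * t - D\<close> raises \<open>j\<close>; the case \<open>j = 0\<close> is the
    goal.\<close>
  have mom: "(LINT t|M. t ^ j * (2 * D * t - D) ^ k) = (B ^^ j) ((adj_op G ^^ k) ?\<delta>) (root G)" for j k
  proof (induction k arbitrary: j)
    case 0
    then show ?case by (simp add: M(3) c_def)
  next
    case (Suc k)
    have "(LINT t|M. t ^ j * (2 * D * t - D) ^ Suc k) =
        (LINT t|M. 2 * D * (t ^ Suc j * (2 * D * t - D) ^ k) - D * (t ^ j * (2 * D * t - D) ^ k))"
      by (simp add: algebra_simps)
    also have "\<dots> = 2 * D * (LINT t|M. t ^ Suc j * (2 * D * t - D) ^ k) - D * (LINT t|M. t ^ j * (2 * D * t - D) ^ k)"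
      by (subst Bochner_Integration.integral_diff) (use int in \<open>auto simp del: power_Suc\<close>)
    also have "\<dots> = (B ^^ j) (adj_op G ((adj_op G ^^ k) ?\<delta>)) (root G)"
      unfolding Suc unfolding A_eq[of "(adj_op G ^^ k) ?\<delta>"] unfolding B_def affine_adj_pow_linear
      by (simp add: funpow_swap1)
    finally show ?case by simp
  qed
  define \<mu> where "\<mu> = distr M borel (\<lambda>t. 2 * D * t - D)"
  have "real_distribution \<mu>" unfolding \<mu>_def by simp
  moreover have "integrable \<mu> (\<lambda>t. t ^ k)" for k
    unfolding \<mu>_def using int[of 0 k] by (subst integrable_distr_eq) auto
  moreover have "(LINT t|\<mu>. t ^ k) = (adj_op G ^^ k) ?\<delta> (root G)" for k
    unfolding \<mu>_def using mom[of 0 k] by (subst integral_distr) auto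
  ultimately show ?thesis unfolding spectral_distribution_iff by blast
qed

end

section \<open>The resolvent of the adjacency operator\<close>

text \<open>The Neumann series of \<open>(z - A)^-1\<close> applied to the delta function at the
  root, taken pointwise; it converges for \<open>cmod z > d\<close> when the degrees are at most
  \<open>d\<close>.\<close>

definition green :: "'a rgraph \<Rightarrow> complex \<Rightarrow> 'a \<Rightarrow> complex" where
  "green G z x = (\<Sum>k. complex_of_real ((adj_op G ^^ k) (delta (root G)) x) / z ^ Suc k)"

text \<open>Boundedness takes the place of square summability: beyond the degree bound it already
  forces uniqueness, and it is immediate for products of bounded functions.\<close>

definition resolvent_at_root :: "'a rgraph \<Rightarrow> complex \<Rightarrow> ('a \<Rightarrow> complex) \<Rightarrow> bool" where
  "resolvent_at_root G z \<psi> \<longleftrightarrow>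
     (\<exists>B. \<forall>x. cmod (\<psi> x) \<le> B) \<and>
     (\<forall>x\<in>verts G. z * \<psi> x - (\<Sum>y\<in>neighbours G x. \<psi> y) = (if x = root G then 1 else 0))"

context bounded_degree_graph
begin

lemma green_summable:
  assumes "cmod z > d"
  shows "summable (\<lambda>k. real d ^ k / cmod z ^ Suc k)"
    "summable (\<lambda>k. cmod (complex_of_real ((adj_op G ^^ k) (delta (root G)) x) / z ^ Suc k))"
proof -
  have "norm (d / cmod z) < 1" using assms by (auto simp: divide_less_eq_1)
  then have "summable (\<lambda>k. (d / cmod z) ^ k / cmod z)"
    by (intro summable_divide summable_geometric)
  then show *: "summable (\<lambda>k. real d ^ k / cmod z ^ Suc k)"
    by (simp add: power_divide mult.commute)
  show "summable (\<lambda>k. cmod (complex_of_real ((adj_op G ^^ k) (delta (root G)) x) / z ^ Suc k))"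
    by (rule summable_comparison_test'[OF *, of 0])
      (use abs_adj_op_pow_delta in \<open>auto simp: norm_divide norm_power norm_mult intro!: divide_right_mono\<close>)
qed

lemma resolvent_green:
  assumes z: "cmod z > d"
  shows "resolvent_at_root G z (green G z)"
  unfolding resolvent_at_root_def
proof (intro conjI exI allI ballI)
  let ?a = "\<lambda>k x. complex_of_real ((adj_op G ^^ k) (delta (root G)) x)"
  note summ = summable_norm_cancel[OF green_summable(2)[OF z]]
  show "cmod (green G z x) \<le> (\<Sum>k. real d ^ k / cmod z ^ Suc k)" for x
  proof -
    have "cmod (green G z x) \<le> (\<Sum>k. cmod (?a k x / z ^ Suc k))"
      unfolding green_def by (rule summable_norm[OF green_summable(2)[OF z]])
    also have "\<dots> \<le> (\<Sum>k. real d ^ k / cmod z ^ Suc k)"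
      by (rule suminf_le[OF _ green_summable(2)[OF z] green_summable(1)[OF z]])
        (use abs_adj_op_pow_delta in \<open>auto simp: norm_divide norm_power norm_mult intro!: divide_right_mono\<close>)
    finally show ?thesis .
  qed
  fix x
  have "z \<noteq> 0" using z by auto
  have "(\<Sum>y\<in>neighbours G x. green G z y) = (\<Sum>k. \<Sum>y\<in>neighbours G x. ?a k y / z ^ Suc k)"
    unfolding green_def by (rule suminf_sum[symmetric]) (rule summ)
  also have "\<dots> = (\<Sum>k. ?a (Suc k) x / z ^ Suc k)"
    by (simp add: adj_op_def sum_divide_distrib)
  finally have 1: "(\<Sum>y\<in>neighbours G x. green G z y) = (\<Sum>k. ?a (Suc k) x / z ^ Suc k)" .
  have zs: "summable (\<lambda>k. z * (?a k x / z ^ Suc k))" by (rule summable_mult[OF summ])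
  have "z * green G z x = (\<Sum>k. z * (?a k x / z ^ Suc k))"
    unfolding green_def by (rule suminf_mult[OF summ, symmetric])
  also have "\<dots> = (\<Sum>k. z * (?a (Suc k) x / z ^ Suc (Suc k))) + z * (?a 0 x / z ^ Suc 0)"
    using suminf_split_head[OF zs] by simp
  also have "\<dots> = (\<Sum>k. ?a (Suc k) x / z ^ Suc k) + (if x = root G then 1 else 0)"
    using \<open>z \<noteq> 0\<close> by (simp add: delta_def)
  finally show "z * green G z x - (\<Sum>y\<in>neighbours G x. green G z y) = (if x = root G then 1 else 0)"
    using 1 by simp
qed

text \<open>The difference \<open>h\<close> of two bounded solutions satisfies \<open>z * h = A h\<close>, hence
  \<open>\<bar>h\<bar> \<le> (d / \<bar>z\<bar>) ^ n * B\<close> for all \<open>n\<close>.\<close>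

lemma resolvent_at_root_unique:
  assumes z: "cmod z > d" and "resolvent_at_root G z \<psi>" "resolvent_at_root G z \<psi>'" and x: "x \<in> verts G"
  shows "\<psi> x = \<psi>' x"
proof -
  obtain B B' where B: "\<And>x. cmod (\<psi> x) \<le> B" "\<And>x. cmod (\<psi>' x) \<le> B'"
    using assms(2,3) unfolding resolvent_at_root_def by metis
  define h where "h = (\<lambda>x. \<psi> x - \<psi>' x)"
  have eq: "z * h x = (\<Sum>y\<in>neighbours G x. h y)" if "x \<in> verts G" for x
  proof -
    have "z * \<psi> x = (if x = root G then 1 else 0) + (\<Sum>y\<in>neighbours G x. \<psi> y)"
      "z * \<psi>' x = (if x = root G then 1 else 0) + (\<Sum>y\<in>neighbours G x. \<psi>' y)"
      using assms(2,3) that unfolding resolvent_at_root_def diff_eq_eq by blast+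
    then show ?thesis
      by (simp only: h_def sum_subtractf right_diff_distrib) simp
  qed
  have nz: "cmod z > 0" using z by (rule le_less_trans[rotated]) simp
  have le: "cmod (h x) \<le> (d / cmod z) ^ n * (B + B')" if "x \<in> verts G" for x n
    using that
  proof (induction n arbitrary: x)
    case 0
    then show ?case using B[of x] norm_triangle_ineq4[of "\<psi> x" "\<psi>' x"] by (simp add: h_def)
  next
    case (Suc n)
    have "B + B' \<ge> 0" using B[of x] norm_ge_zero[of "\<psi> x"] norm_ge_zero[of "\<psi>' x"] by linarith
    have "cmod z * cmod (h x) \<le> (\<Sum>y\<in>neighbours G x. cmod (h y))"
      unfolding norm_mult[symmetric] eq[OF Suc.prems] by (rule norm_sum)
    also have "\<dots> \<le> (\<Sum>y\<in>neighbours G x. (d / cmod z) ^ n * (B + B'))"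
      by (intro sum_mono Suc.IH neighboursD(2)[of _ x])
    also have "\<dots> \<le> d * ((d / cmod z) ^ n * (B + B'))"
      using card_neighbours[of x] \<open>B + B' \<ge> 0\<close> by (simp add: mult_right_mono)
    finally have "cmod (h x) \<le> d * ((d / cmod z) ^ n * (B + B')) / cmod z"
      using nz by (simp add: pos_le_divide_eq mult.commute)
    then show ?case by simp
  qed
  have "(\<lambda>n. (d / cmod z) ^ n * (B + B')) \<longlonglongrightarrow> 0"
    using z nz by (intro tendsto_mult_left_zero LIMSEQ_realpow_zero) auto
  then have "cmod (h x) \<le> 0"
    by (rule LIMSEQ_le_const) (intro exI allI impI le x)
  then show ?thesis by (simp add: h_def)
qed

lemma G_transform_eq_green:
  assumes "spectral_distribution G \<mu>" "Im z > d"
  shows "G_transform \<mu> z = green G z (root G)"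
proof -
  interpret real_distribution \<mu> using assms(1) by (simp add: spectral_distribution_iff)
  have "cmod z > d" using assms(2) abs_Im_le_cmod[of z] by linarith
  then have "(\<lambda>k. complex_of_real (LINT t|\<mu>. t ^ k) / z ^ Suc k) sums G_transform \<mu> z"
    using assms by (intro G_transform_sums[of "real d"] spectral_distribution_AE) (auto intro: le_less_trans[of 0 "real d"])
  then show ?thesis
    using assms(1) unfolding green_def by (simp add: spectral_distribution_iff sums_unique)
qed

text \<open>This turns the computation of a Stieltjes transform into guessing a bounded solution of
  a linear equation on the graph.\<close>

lemma G_transform_eq_resolvent:
  assumes "spectral_distribution G \<mu>" "Im z > d" "resolvent_at_root G z \<psi>"
  shows "G_transform \<mu> z = \<psi> (root G)"
proof -
  have "cmod z > d" using assms(2) abs_Im_le_cmod[of z] by linarith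
  then show ?thesis
    using G_transform_eq_green[OF assms(1,2)] resolvent_at_root_unique[OF _ resolvent_green assms(3)] by simp
qed

end

section \<open>Comb and orthogonal products\<close>

text \<open>\<open>X\<close> is the set of vertices of \<open>G\<close> that carry a copy of
  \<open>H\<close>: all of them for the comb product, all but the root for the orthogonal
  product.\<close>

definition glue_edges :: "'a rgraph \<Rightarrow> 'b rgraph \<Rightarrow> 'a set \<Rightarrow> ('a \<times> 'b) set set" where
  "glue_edges G H X = {{(x, root H), (x', root H)} | x x'. {x, x'} \<in> edges G} \<union>
     {{(x, y), (x, y')} | x y y'. x \<in> X \<and> {y, y'} \<in> edges H}"

lemma in_glue_edges:
  "{(x, y), (x', y')} \<in> glue_edges G H X \<longleftrightarrow>
     y = root H \<and> y' = root H \<and> {x, x'} \<in> edges G \<or> x = x' \<and> x \<in> X \<and> {y, y'} \<in> edges H"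
proof -
  have "(\<exists>a a'. {(x, y), (x', y')} = {(a, root H), (a', root H)} \<and> {a, a'} \<in> edges G) \<longleftrightarrow>
      y = root H \<and> y' = root H \<and> {x, x'} \<in> edges G"
    unfolding doubleton_eq_iff prod.inject by (metis insert_commute)
  moreover have "(\<exists>a b b'. {(x, y), (x', y')} = {(a, b), (a, b')} \<and> a \<in> X \<and> {b, b'} \<in> edges H) \<longleftrightarrow>
      x = x' \<and> x \<in> X \<and> {y, y'} \<in> edges H"
    unfolding doubleton_eq_iff prod.inject by (metis insert_commute)
  ultimately show ?thesis
    unfolding glue_edges_def Un_iff mem_Collect_eq by simp
qed

lemma comb_product_simps [simp]:
  "verts (comb_product G H) = verts G \<times> verts H"
  "edges (comb_product G H) = glue_edges G H (verts G)"
  "root (comb_product G H) = (root G, root H)"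
  by (simp_all add: comb_product_def glue_edges_def)

lemma orth_product_simps [simp]:
  "verts (orth_product G H) = (verts G - {root G}) \<times> verts H \<union> {(root G, root H)}"
  "edges (orth_product G H) = glue_edges G H (verts G - {root G})"
  "root (orth_product G H) = (root G, root H)"
  by (simp_all add: orth_product_def glue_edges_def)

lemma glue_neighbours:
  assumes "edges K = glue_edges G H X"
  shows "neighbours K (x, y) = (if y = root H then (\<lambda>x'. (x', root H)) ` neighbours G x else {}) \<union>
    (if x \<in> X then Pair x ` neighbours H y else {})"
  unfolding neighbours_def assms by (auto simp: in_glue_edges)

text \<open>Since \<open>G\<close> has no loops, the neighbours along \<open>G\<close> and those
  inside the copy of \<open>H\<close> are disjoint.\<close>

lemma sum_glue_neighbours:
  fixes f :: "'a \<times> 'b \<Rightarrow> complex"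
  assumes "edges K = glue_edges G H X" "bounded_degree_graph G d" "bounded_degree_graph H d'"
  shows "(\<Sum>p\<in>neighbours K (x, y). f p) = (if y = root H then \<Sum>x'\<in>neighbours G x. f (x', root H) else 0) +
    (if x \<in> X then \<Sum>y'\<in>neighbours H y. f (x, y') else 0)"
proof -
  interpret G: bounded_degree_graph G d by fact
  interpret H: bounded_degree_graph H d' by fact
  have "inj_on (\<lambda>x'. (x', root H)) (neighbours G x)" "inj_on (Pair x) (neighbours H y)"
    by (auto simp: inj_on_def)
  moreover have "(\<lambda>x'. (x', root H)) ` neighbours G x \<inter> Pair x ` neighbours H y = {}"
    using G.neighboursD(3) by auto
  ultimately show ?thesis
    unfolding glue_neighbours[OF assms(1)] by (auto simp: sum.union_disjoint sum.reindex)
qed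

lemma bounded_degree_glue:
  assumes "edges K = glue_edges G H X" "bounded_degree_graph G d" "bounded_degree_graph H d'"
    and K: "simple_rooted_graph K"
  shows "bounded_degree_graph K (d + d')"
proof -
  interpret G: bounded_degree_graph G d by fact
  interpret H: bounded_degree_graph H d' by fact
  have *: "card (A \<union> B) \<le> d + d'" if "card A \<le> d" "card B \<le> d'" for A B :: "('a \<times> 'b) set"
    using card_Un_le[of A B] that by linarith
  show ?thesis
  proof (rule bounded_degree_graphI[OF K])
    fix p assume "p \<in> verts K"
    obtain x y where p: "p = (x, y)" by force
    have "card ((\<lambda>x'. (x', root H)) ` neighbours G x) \<le> d" "card (Pair x ` neighbours H y) \<le> d'"
      using G.card_neighbours[of x] H.card_neighbours[of y]
      by (auto intro: card_image_le[THEN order_trans])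
    then show "finite (neighbours K p) \<and> card (neighbours K p) \<le> d + d'"
      unfolding p glue_neighbours[OF assms(1)] by (auto intro!: *)
  qed
qed

lemma simple_rooted_glue:
  assumes "simple_rooted_graph G" "simple_rooted_graph H" and "edges K = glue_edges G H X"
    and "root K \<in> verts K" "verts G \<times> {root H} \<subseteq> verts K" "X \<times> verts H \<subseteq> verts K"
  shows "simple_rooted_graph K"
proof
  interpret G: simple_rooted_graph G by fact
  interpret H: simple_rooted_graph H by fact
  show "edges K \<subseteq> {{p, q} | p q. p \<in> verts K \<and> q \<in> verts K \<and> p \<noteq> q}"
  proof
    fix e assume "e \<in> edges K"
    then consider x x' where "e = {(x, root H), (x', root H)}" "{x, x'} \<in> edges G"
      | x y y' where "e = {(x, y), (x, y')}" "x \<in> X" "{y, y'} \<in> edges H"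
      by (auto simp: assms glue_edges_def)
    then show "e \<in> {{p, q} | p q. p \<in> verts K \<and> q \<in> verts K \<and> p \<noteq> q}"
    proof cases
      case 1
      then show ?thesis using G.edge_verts[of x x'] assms(5)
        by (intro CollectI exI[of _ "(x, root H)"] exI[of _ "(x', root H)"]) auto
    next
      case 2
      then show ?thesis using H.edge_verts[of y y'] assms(6)
        by (intro CollectI exI[of _ "(x, y)"] exI[of _ "(x, y')"]) auto
    qed
  qed
qed fact

lemma simple_rooted_comb_product:
  "simple_rooted_graph G \<Longrightarrow> simple_rooted_graph H \<Longrightarrow> simple_rooted_graph (comb_product G H)"
  by (rule simple_rooted_glue) (auto simp: simple_rooted_graph.root_in_verts)

lemma simple_rooted_orth_product:
  "simple_rooted_graph G \<Longrightarrow> simple_rooted_graph H \<Longrightarrow> simple_rooted_graph (orth_product G H)"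
  by (rule simple_rooted_glue) (auto simp: simple_rooted_graph.root_in_verts)

lemma bounded_degree_comb_product:
  "bounded_degree_graph G d \<Longrightarrow> bounded_degree_graph H d' \<Longrightarrow> bounded_degree_graph (comb_product G H) (d + d')"
  by (intro bounded_degree_glue[where X="verts G"] simple_rooted_comb_product) (auto simp: bounded_degree_graph_def)

lemma bounded_degree_orth_product:
  "bounded_degree_graph G d \<Longrightarrow> bounded_degree_graph H d' \<Longrightarrow> bounded_degree_graph (orth_product G H) (d + d')"
  by (intro bounded_degree_glue[where X="verts G - {root G}"] simple_rooted_orth_product) (auto simp: bounded_degree_graph_def)

text \<open>The resolvent arguments give the functional equations for large imaginary part only; the
  identity theorem carries them to the whole half-plane on which the convolutions are
  defined.\<close>

lemma upper_half_plane_identity: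
  assumes "f holomorphic_on {z. Im z > 0}" "g holomorphic_on {z. Im z > 0}"
    and "R \<ge> 0" "\<And>z. Im z > R \<Longrightarrow> f z = g z" and "Im z > 0"
  shows "f z = g z"
proof (rule analytic_continuation_open[where f = f and g = g and z = z and s = "{z. Im z > R}" and s' = "{z. Im z > 0}"])
  show "{z. Im z > R} \<noteq> {}" by (metis (mono_tags) empty_iff mem_Collect_eq complex.sel(2) gt_ex)
  show "connected {z. Im z > 0}" by (intro convex_connected convex_halfspace_Im_gt)
qed (use assms in \<open>auto simp: open_halfspace_Im_gt\<close>)

section \<open>Functional equations for comb and orthogonal products\<close>

locale two_spectral_graphs =
  G: bounded_degree_graph G d + H: bounded_degree_graph H d'
  for G :: "'a rgraph" and d and H :: "'b rgraph" and d' +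
  fixes \<mu> \<nu> :: "real measure"
  assumes \<mu>: "spectral_distribution G \<mu>" and \<nu>: "spectral_distribution H \<nu>"
begin

sublocale M: real_distribution \<mu> using \<mu> by (simp add: G.spectral_distribution_iff)
sublocale N: real_distribution \<nu> using \<nu> by (simp add: H.spectral_distribution_iff)

text \<open>The bound \<open>d + d'\<close> puts \<open>z\<close> beyond the degree bounds of
  \<open>H\<close> and of the product. As \<open>F_transform\<close> does not decrease imaginary
  parts, \<open>F_transform \<nu> z\<close> lies beyond the bound of \<open>G\<close>, and the last
  expression has imaginary part at least \<open>Im z\<close>.\<close>

lemma
  assumes z: "Im z > real (d + d')"
  shows green_H_root: "green H z (root H) = 1 / F_transform \<nu> z"
    and green_G_root: "green G (F_transform \<nu> z) (root G) = 1 / F_transform \<mu> (F_transform \<nu> z)"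
    and res_H: "resolvent_at_root H z (green H z)"
    and res_G: "resolvent_at_root G (F_transform \<nu> z) (green G (F_transform \<nu> z))"
    and nonzero: "F_transform \<nu> z \<noteq> 0" "F_transform \<mu> (F_transform \<nu> z) \<noteq> 0"
      "F_transform \<mu> (F_transform \<nu> z) + z - F_transform \<nu> z \<noteq> 0"
proof -
  let ?w = "F_transform \<nu> z"
  have z': "Im z > 0" "Im z > d" "Im z > d'" using z by auto
  have w: "Im ?w \<ge> Im z" using N.Im_F_transform z' by auto
  then have wl: "Im ?w > d" using z' by linarith
  then have wl': "Im ?w > 0" "cmod ?w > d" using abs_Im_le_cmod[of ?w] by linarith+
  show "green H z (root H) = 1 / ?w"
    using H.G_transform_eq_green[OF \<nu> z'(3)] by (simp add: F_transform_def)
  show "green G ?w (root G) = 1 / F_transform \<mu> ?w"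
    using G.G_transform_eq_green[OF \<mu> wl] by (simp add: F_transform_def)
  show "resolvent_at_root H z (green H z)"
    using z'(3) abs_Im_le_cmod[of z] by (intro H.resolvent_green) linarith
  show "resolvent_at_root G ?w (green G ?w)"
    by (intro G.resolvent_green wl')
  have "Im (F_transform \<mu> ?w) \<ge> Im ?w" using M.Im_F_transform(1) wl' by auto
  then have "Im (F_transform \<mu> ?w + z - ?w) > 0" "Im (F_transform \<mu> ?w) > 0" using z' wl' by auto
  moreover have "q \<noteq> 0" if "Im q > 0" for q using that by auto
  ultimately show "?w \<noteq> 0" "F_transform \<mu> ?w \<noteq> 0" "F_transform \<mu> ?w + z - ?w \<noteq> 0"
    using wl' by blast+
qed

lemma holomorphic_F_F: "(\<lambda>z. F_transform \<mu> (F_transform \<nu> z)) holomorphic_on {z. Im z > 0}"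
proof -
  have "F_transform \<nu> ` {z. Im z > 0} \<subseteq> {z. Im z > 0}"
    using N.Im_F_transform(1) by (auto intro: less_le_trans)
  from holomorphic_on_compose_gen[OF N.holomorphic_F_transform M.holomorphic_F_transform this]
  show ?thesis by (simp add: o_def)
qed

text \<open>On each copy of \<open>H\<close> the solution is a multiple of \<open>green H z\<close>.
  Eliminating the copies replaces \<open>z\<close> by \<open>w = F_transform \<nu> z\<close> in the
  equation along \<open>G\<close>, whose solution is \<open>green G w\<close>.\<close>

lemma F_transform_comb:
  assumes \<rho>: "spectral_distribution (comb_product G H) \<rho>" and "Im z > 0"
  shows "F_transform \<rho> z = F_transform \<mu> (F_transform \<nu> z)"
proof -
  interpret K: bounded_degree_graph "comb_product G H" "d + d'"
    by (rule bounded_degree_comb_product) unfold_locales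
  interpret real_distribution \<rho> using \<rho> by (simp add: K.spectral_distribution_iff)
  have large: "F_transform \<rho> z = F_transform \<mu> (F_transform \<nu> z)" if z: "Im z > real (d + d')" for z
  proof -
    define w where "w = F_transform \<nu> z"
    \<comment> \<open>As \<open>green H z (root H) = 1 / w\<close>, the factor \<open>w\<close>
      normalises the second factor to 1 at the gluing vertex.\<close>
    define \<psi> where "\<psi> = (\<lambda>(x, y). green G w x * green H z y * w)"
    have g: "w * green G w x - (\<Sum>x'\<in>neighbours G x. green G w x') = (if x = root G then 1 else 0)" if "x \<in> verts G" for x
      using res_G[OF z] that by (auto simp: resolvent_at_root_def w_def)
    have h: "z * green H z y - (\<Sum>y'\<in>neighbours H y. green H z y') = (if y = root H then 1 else 0)" if "y \<in> verts H" for y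
      using res_H[OF z] that by (auto simp: resolvent_at_root_def)
    have "w \<noteq> 0" using nonzero[OF z] by (simp add: w_def)
    have hr: "green H z (root H) = 1 / w" using green_H_root[OF z] by (simp add: w_def)
    have "resolvent_at_root (comb_product G H) z \<psi>"
      unfolding resolvent_at_root_def
    proof
      obtain B B' where B: "\<And>x. cmod (green G w x) \<le> B" "\<And>y. cmod (green H z y) \<le> B'"
        using res_G[OF z] res_H[OF z] unfolding resolvent_at_root_def w_def by metis
      have B0: "0 \<le> B" "0 \<le> B'" using B order_trans[OF norm_ge_zero] by blast+
      have "cmod (\<psi> p) \<le> B * B' * cmod w" for p
        unfolding \<psi>_def case_prod_beta norm_mult by (intro mult_mono B B0 mult_nonneg_nonneg norm_ge_zero order_refl)
      then show "\<exists>B. \<forall>p. cmod (\<psi> p) \<le> B" by blast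
      show "\<forall>p\<in>verts (comb_product G H). z * \<psi> p - (\<Sum>q\<in>neighbours (comb_product G H) p. \<psi> q) = (if p = root (comb_product G H) then 1 else 0)"
      proof safe
        fix x y assume "(x, y) \<in> verts (comb_product G H)"
        then have xy: "x \<in> verts G" "y \<in> verts H" by auto
        have S: "(\<Sum>q\<in>neighbours (comb_product G H) (x, y). \<psi> q) =
           (if y = root H then \<Sum>x'\<in>neighbours G x. green G w x' else 0) + green G w x * w * (\<Sum>y'\<in>neighbours H y. green H z y')"
          using xy \<open>w \<noteq> 0\<close>
          by (subst sum_glue_neighbours[of _ _ _ "verts G", OF _ G.bounded_degree_graph_axioms H.bounded_degree_graph_axioms])
             (auto simp: \<psi>_def hr sum_distrib_left mult_ac)
        have "z * \<psi> (x, y) - (\<Sum>q\<in>neighbours (comb_product G H) (x, y). \<psi> q) =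
            green G w x * w * (z * green H z y - (\<Sum>y'\<in>neighbours H y. green H z y'))
            - (if y = root H then \<Sum>x'\<in>neighbours G x. green G w x' else 0)"
          unfolding S by (simp add: \<psi>_def algebra_simps)
        also have "\<dots> = (if (x, y) = root (comb_product G H) then 1 else 0)"
          unfolding h[OF xy(2)] using g[OF xy(1)] by (auto simp: mult.commute)
        finally show "z * \<psi> (x, y) - (\<Sum>q\<in>neighbours (comb_product G H) (x, y). \<psi> q) = (if (x, y) = root (comb_product G H) then 1 else 0)" .
      qed
    qed
    then have "G_transform \<rho> z = \<psi> (root G, root H)"
      using K.G_transform_eq_resolvent[OF \<rho> z] by simp
    also have "\<dots> = 1 / F_transform \<mu> w"
      using green_G_root[OF z] \<open>w \<noteq> 0\<close> by (simp add: \<psi>_def hr w_def)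
    finally show ?thesis by (simp add: F_transform_def w_def)
  qed
  show ?thesis
    by (rule upper_half_plane_identity[where R="real (d + d')" and f="F_transform \<rho>" and z=z and
      g="\<lambda>z. F_transform \<mu> (F_transform \<nu> z)"])
      (use large holomorphic_F_transform holomorphic_F_F \<open>Im z > 0\<close> in auto)
qed

text \<open>The ansatz for the comb product still solves the equation away from the root, where
  \<open>z\<close> is effectively replaced by \<open>w\<close>. At the root, which carries no copy,
  \<open>z\<close> itself remains, and a constant multiple repairs that single equation.\<close>

lemma F_transform_orth:
  assumes \<rho>: "spectral_distribution (orth_product G H) \<rho>" and "Im z > 0"
  shows "F_transform \<rho> z = F_transform \<mu> (F_transform \<nu> z) + z - F_transform \<nu> z"
proof -
  interpret K: bounded_degree_graph "orth_product G H" "d + d'"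
    by (rule bounded_degree_orth_product) unfold_locales
  interpret real_distribution \<rho> using \<rho> by (simp add: K.spectral_distribution_iff)
  have large: "F_transform \<rho> z = F_transform \<mu> (F_transform \<nu> z) + z - F_transform \<nu> z" if z: "Im z > real (d + d')" for z
  proof -
    define w where "w = F_transform \<nu> z"
    define u where "u = F_transform \<mu> w"
    \<comment> \<open>Without \<open>c\<close> the equation at the root would have the value
      \<open>z / u - (w / u - 1) = (u + z - w) / u\<close> in place of 1.\<close>
    define c where "c = u / (u + z - w)"
    define \<psi> where "\<psi> = (\<lambda>(x, y). c * green G w x * green H z y * w)"
    have g: "w * green G w x - (\<Sum>x'\<in>neighbours G x. green G w x') = (if x = root G then 1 else 0)" if "x \<in> verts G" for x
      using res_G[OF z] that by (auto simp: resolvent_at_root_def w_def)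
    have h: "z * green H z y - (\<Sum>y'\<in>neighbours H y. green H z y') = (if y = root H then 1 else 0)" if "y \<in> verts H" for y
      using res_H[OF z] that by (auto simp: resolvent_at_root_def)
    have nz: "w \<noteq> 0" "u \<noteq> 0" "u + z - w \<noteq> 0" using nonzero[OF z] by (auto simp: w_def u_def)
    have hr: "green H z (root H) = 1 / w" and gr: "green G w (root G) = 1 / u"
      using green_H_root[OF z] green_G_root[OF z] by (auto simp: w_def u_def)
    have "resolvent_at_root (orth_product G H) z \<psi>"
      unfolding resolvent_at_root_def
    proof
      obtain B B' where B: "\<And>x. cmod (green G w x) \<le> B" "\<And>y. cmod (green H z y) \<le> B'"
        using res_G[OF z] res_H[OF z] unfolding resolvent_at_root_def w_def by metis
      have B0: "0 \<le> B" "0 \<le> B'" using B order_trans[OF norm_ge_zero] by blast+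
      have "cmod (\<psi> p) \<le> cmod c * B * B' * cmod w" for p
        unfolding \<psi>_def case_prod_beta norm_mult by (intro mult_mono B B0 mult_nonneg_nonneg norm_ge_zero order_refl)
      then show "\<exists>B. \<forall>p. cmod (\<psi> p) \<le> B" by blast
      show "\<forall>p\<in>verts (orth_product G H). z * \<psi> p - (\<Sum>q\<in>neighbours (orth_product G H) p. \<psi> q) = (if p = root (orth_product G H) then 1 else 0)"
      proof safe
        fix x y assume *: "(x, y) \<in> verts (orth_product G H)"
        then have xy: "x \<in> verts G" "y \<in> verts H" "x = root G \<Longrightarrow> y = root H" by auto
        have S: "(\<Sum>q\<in>neighbours (orth_product G H) (x, y). \<psi> q) =
           (if y = root H then c * (\<Sum>x'\<in>neighbours G x. green G w x') else 0)
             + (if x = root G then 0 else c * green G w x * w * (\<Sum>y'\<in>neighbours H y. green H z y'))"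
          using xy nz(1)
          by (subst sum_glue_neighbours[of _ _ _ "verts G - {root G}", OF _ G.bounded_degree_graph_axioms H.bounded_degree_graph_axioms])
             (auto simp: \<psi>_def hr sum_distrib_left mult_ac)
        show "z * \<psi> (x, y) - (\<Sum>q\<in>neighbours (orth_product G H) (x, y). \<psi> q) = (if (x, y) = root (orth_product G H) then 1 else 0)"
        proof (cases "x = root G")
          case True
          then have [simp]: "x = root G" "y = root H" using xy by auto
          have sg: "(\<Sum>x'\<in>neighbours G (root G). green G w x') = w / u - 1"
            using g[of "root G"] gr by (simp add: algebra_simps)
          have "z * \<psi> (x, y) - (\<Sum>q\<in>neighbours (orth_product G H) (x, y). \<psi> q) = c * (z / u - (w / u - 1))"
            unfolding S using nz(1) by (simp add: \<psi>_def gr hr sg algebra_simps)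
          also have "z / u - (w / u - 1) = (u + z - w) / u"
            using nz by (simp add: field_simps)
          also have "c * \<dots> = 1"
            using nz by (simp add: c_def)
          finally show ?thesis by simp
        next
          case False
          have "z * \<psi> (x, y) - (\<Sum>q\<in>neighbours (orth_product G H) (x, y). \<psi> q) =
            c * (green G w x * w * (z * green H z y - (\<Sum>y'\<in>neighbours H y. green H z y'))
            - (if y = root H then \<Sum>x'\<in>neighbours G x. green G w x' else 0))"
            unfolding S using False by (simp add: \<psi>_def algebra_simps)
          also have "\<dots> = 0"
            unfolding h[OF xy(2)] using g[OF xy(1)] False by (auto simp: mult.commute)
          finally show ?thesis using False by simp
        qed
      qed
    qed
    then have "G_transform \<rho> z = \<psi> (root G, root H)"
      using K.G_transform_eq_resolvent[OF \<rho> z] by simp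
    also have "\<dots> = 1 / (u + z - w)"
      using nz by (simp add: \<psi>_def hr gr c_def)
    finally show ?thesis by (simp add: F_transform_def[of \<rho>] w_def u_def)
  qed
  show ?thesis
    by (rule upper_half_plane_identity[where R="real (d + d')" and f="F_transform \<rho>" and z=z and
      g="\<lambda>z. F_transform \<mu> (F_transform \<nu> z) + z - F_transform \<nu> z"])
      (use large holomorphic_F_transform holomorphic_F_F N.holomorphic_F_transform \<open>Im z > 0\<close> in
        \<open>auto intro!: holomorphic_intros\<close>)
qed

lemma monotone_conv_spectral:
  assumes "spectral_distribution (comb_product G H) \<rho>"
  shows "monotone_conv \<mu> \<nu> = \<rho>"
proof -
  interpret K: bounded_degree_graph "comb_product G H" "d + d'"
    by (rule bounded_degree_comb_product) unfold_locales
  show ?thesis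
    by (rule monotone_conv_eqI)
      (use assms K.spectral_distribution_compactly_supported F_transform_comb in \<open>auto simp: K.spectral_distribution_iff\<close>)
qed

lemma orth_conv_spectral:
  assumes "spectral_distribution (orth_product G H) \<rho>"
  shows "orth_conv \<mu> \<nu> = \<rho>"
proof -
  interpret K: bounded_degree_graph "orth_product G H" "d + d'"
    by (rule bounded_degree_orth_product) unfold_locales
  show ?thesis
    by (rule orth_conv_eqI)
      (use assms K.spectral_distribution_compactly_supported F_transform_orth in \<open>auto simp: K.spectral_distribution_iff K_transform_def\<close>)
qed

end

text \<open>The spectral measure of the comb product, which exists by the moment problem, shows that
  the description defining \<open>monotone_conv\<close> denotes a measure at all.\<close>

lemma monotone_conv_is_spectral:
  assumes "bounded_degree_graph G d" "bounded_degree_graph H d'"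
    and "spectral_distribution G \<mu>" "spectral_distribution H \<nu>"
  shows "spectral_distribution (comb_product G H) (monotone_conv \<mu> \<nu>)"
proof -
  interpret two_spectral_graphs G d H d' \<mu> \<nu>
    using assms by (simp add: two_spectral_graphs_def two_spectral_graphs_axioms_def)
  obtain \<rho> where "spectral_distribution (comb_product G H) \<rho>"
    using bounded_degree_graph.spectral_distribution_exists[OF bounded_degree_comb_product[OF assms(1,2)]] by blast
  then show ?thesis using monotone_conv_spectral by simp
qed

lemma orth_conv_is_spectral:
  assumes "bounded_degree_graph G d" "bounded_degree_graph H d'"
    and "spectral_distribution G \<mu>" "spectral_distribution H \<nu>"
  shows "spectral_distribution (orth_product G H) (orth_conv \<mu> \<nu>)"
proof -
  interpret two_spectral_graphs G d H d' \<mu> \<nu>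
    using assms by (simp add: two_spectral_graphs_def two_spectral_graphs_axioms_def)
  obtain \<rho> where "spectral_distribution (orth_product G H) \<rho>"
    using bounded_degree_graph.spectral_distribution_exists[OF bounded_degree_orth_product[OF assms(1,2)]] by blast
  then show ?thesis using orth_conv_spectral by simp
qed

section \<open>Embeddings\<close>

definition rgraph_emb :: "('a \<Rightarrow> 'b) \<Rightarrow> 'a rgraph \<Rightarrow> 'b rgraph \<Rightarrow> bool" where
  "rgraph_emb f H G \<longleftrightarrow> inj_on f (verts H) \<and> f ` verts H \<subseteq> verts G \<and> f (root H) = root G \<and>
     (\<forall>x\<in>verts H. \<forall>y\<in>verts H. {x, y} \<in> edges H \<longleftrightarrow> {f x, f y} \<in> edges G)"

lemma adj_op_pow_Suc: "(adj_op G ^^ Suc k) f x = (\<Sum>y\<in>neighbours G x. (adj_op G ^^ k) f y)"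
  unfolding funpow.simps o_apply by (subst adj_op_def) simp

lemma rgraph_iso_sym:
  assumes "rgraph_iso G H" "root G \<in> verts G"
  shows "rgraph_iso H G"
proof -
  obtain f where f: "bij_betw f (verts G) (verts H)" "f (root G) = root H"
    and e: "\<And>x y. x \<in> verts G \<Longrightarrow> y \<in> verts G \<Longrightarrow> {x, y} \<in> edges G \<longleftrightarrow> {f x, f y} \<in> edges H"
    using assms(1) by (auto simp: rgraph_iso_def)
  define g where "g = inv_into (verts G) f"
  have g: "bij_betw g (verts H) (verts G)" unfolding g_def by (rule bij_betw_inv_into[OF f(1)])
  have fg: "f (g y) = y" if "y \<in> verts H" for y
    using bij_betw_inv_into_right[OF f(1) that] by (simp add: g_def)
  have "g (root H) = root G"
    unfolding g_def using bij_betw_inv_into_left[OF f(1) assms(2)] f(2) by simp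
  moreover have "{x, y} \<in> edges H \<longleftrightarrow> {g x, g y} \<in> edges G" if "x \<in> verts H" "y \<in> verts H" for x y
    using e[of "g x" "g y"] fg that bij_betwE[OF g] by simp
  ultimately show ?thesis using g by (auto simp: rgraph_iso_def)
qed

locale rgraph_embedding =
  H: simple_rooted_graph H + G: bounded_degree_graph G d
  for f :: "'a \<Rightarrow> 'b" and H :: "'a rgraph" and G :: "'b rgraph" and d +
  assumes emb: "rgraph_emb f H G"
begin

lemma f_inj: "x \<in> verts H \<Longrightarrow> y \<in> verts H \<Longrightarrow> f x = f y \<longleftrightarrow> x = y"
  and f_root: "f (root H) = root G"
  and f_edges: "x \<in> verts H \<Longrightarrow> y \<in> verts H \<Longrightarrow> {f x, f y} \<in> edges G \<longleftrightarrow> {x, y} \<in> edges H"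
  using emb by (auto simp: rgraph_emb_def inj_on_eq_iff)

lemma image_neighbours:
  assumes "x \<in> verts H"
  shows "f ` neighbours H x = neighbours G (f x) \<inter> f ` verts H"
  using assms H.edge_verts[of x] by (auto simp: neighbours_def f_edges)

lemma inj_on_neighbours: "inj_on f (neighbours H x)"
  using H.neighboursD(2) f_inj by (auto intro!: inj_onI)

lemma bounded_degree_domain: "bounded_degree_graph H d"
proof (rule bounded_degree_graphI)
  fix x assume x: "x \<in> verts H"
  have sub: "f ` neighbours H x \<subseteq> neighbours G (f x)" using image_neighbours[OF x] by auto
  have "finite (neighbours H x)"
    using finite_subset[OF sub] inj_on_neighbours by (simp add: finite_image_iff)
  moreover have "card (neighbours H x) \<le> card (neighbours G (f x))"
    using card_mono[OF _ sub] card_image[OF inj_on_neighbours, of x] by simp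
  ultimately show "finite (neighbours H x) \<and> card (neighbours H x) \<le> d"
    using G.card_neighbours[of "f x"] by linarith
qed (fact H.simple_rooted_graph_axioms)

text \<open>A walk of length \<open>k\<close> from the root stays within level \<open>k\<close>.\<close>

lemma adj_op_pow_delta_eq:
  fixes lev :: "'b \<Rightarrow> nat"
  assumes lev: "lev (root G) = 0" "\<And>x y. {x, y} \<in> edges G \<Longrightarrow> lev y \<le> Suc (lev x)"
    and range: "\<And>v. v \<in> verts G \<Longrightarrow> lev v \<le> m \<Longrightarrow> v \<in> f ` verts H"
    and "k \<le> Suc m" "x \<in> verts H"
  shows "(adj_op H ^^ k) (delta (root H)) x = (adj_op G ^^ k) (delta (root G)) (f x)"
proof -
  have supp: "(adj_op G ^^ k) (delta (root G)) v = 0" if "lev v > k" for k v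
    using that
  proof (induction k arbitrary: v)
    case 0
    then show ?case using lev(1) by (auto simp: delta_def)
  next
    case (Suc k)
    have "(adj_op G ^^ k) (delta (root G)) y = 0" if "y \<in> neighbours G v" for y
    proof -
      have "lev v \<le> Suc (lev y)" using that lev(2)[of y v] by (simp add: neighbours_def insert_commute)
      then show ?thesis using Suc by auto
    qed
    then show ?case by (simp add: adj_op_pow_Suc del: funpow.simps)
  qed
  show ?thesis
    using assms(4,5)
  proof (induction k arbitrary: x)
    case 0
    have "x = root H \<longleftrightarrow> f x = root G"
      using f_inj[OF 0(2) H.root_in_verts] f_root by simp
    then show ?case by (simp add: delta_def)
  next
    case (Suc k)
    have "(adj_op G ^^ Suc k) (delta (root G)) (f x) = (\<Sum>v\<in>neighbours G (f x). (adj_op G ^^ k) (delta (root G)) v)"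
      by (rule adj_op_pow_Suc)
    \<comment> \<open>A neighbour of \<open>f x\<close> outside the image has level above
      \<open>m\<close>, and \<open>k \<le> m\<close> steps from the root do not reach it.\<close>
    also have "\<dots> = (\<Sum>v\<in>f ` neighbours H x. (adj_op G ^^ k) (delta (root G)) v)"
    proof (rule sum.mono_neutral_right)
      show "\<forall>v\<in>neighbours G (f x) - f ` neighbours H x. (adj_op G ^^ k) (delta (root G)) v = 0"
      proof
        fix v assume v: "v \<in> neighbours G (f x) - f ` neighbours H x"
        then have "v \<notin> f ` verts H" "v \<in> verts G"
          using image_neighbours[OF Suc.prems(2)] G.neighboursD(2) by blast+
        then have "lev v > m" using range[of v] by linarith
        then show "(adj_op G ^^ k) (delta (root G)) v = 0"
          using Suc.prems(1) by (intro supp) simp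
      qed
    qed (use image_neighbours[OF Suc.prems(2)] in auto)
    also have "\<dots> = (\<Sum>y\<in>neighbours H x. (adj_op G ^^ k) (delta (root G)) (f y))"
      by (simp add: sum.reindex[OF inj_on_neighbours])
    also have "\<dots> = (\<Sum>y\<in>neighbours H x. (adj_op H ^^ k) (delta (root H)) y)"
      using Suc.prems by (intro sum.cong refl Suc.IH[symmetric]) (auto dest: H.neighboursD(2))
    finally show ?case by (simp add: adj_op_pow_Suc del: funpow.simps)
  qed
qed

lemma moments_eq:
  fixes lev :: "'b \<Rightarrow> nat"
  assumes "lev (root G) = 0" "\<And>x y. {x, y} \<in> edges G \<Longrightarrow> lev y \<le> Suc (lev x)"
    and "\<And>v. v \<in> verts G \<Longrightarrow> lev v \<le> m \<Longrightarrow> v \<in> f ` verts H"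
    and "k \<le> m" and \<mu>: "spectral_distribution H \<mu>" and \<rho>: "spectral_distribution G \<rho>"
  shows "(LINT t|\<mu>. t ^ k) = (LINT t|\<rho>. t ^ k)"
proof -
  interpret H: bounded_degree_graph H d by (rule bounded_degree_domain)
  show ?thesis
    using adj_op_pow_delta_eq[of lev m k "root H", OF assms(1-3)] assms(4) \<mu> \<rho>
    by (simp add: H.spectral_distribution_iff G.spectral_distribution_iff f_root)
qed

lemma spectral_distribution_iso:
  assumes "f ` verts H = verts G"
  shows "spectral_distribution H \<mu> \<longleftrightarrow> spectral_distribution G \<mu>"
proof -
  interpret H: bounded_degree_graph H d by (rule bounded_degree_domain)
  have "(adj_op H ^^ k) (delta (root H)) (root H) = (adj_op G ^^ k) (delta (root G)) (root G)" for k
    \<comment> \<open>For a surjective embedding the constant level 0 meets all the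
      conditions.\<close>
    using adj_op_pow_delta_eq[of "\<lambda>_. 0" k k "root H"] assms by (simp add: f_root)
  then show ?thesis
    by (simp add: H.spectral_distribution_iff G.spectral_distribution_iff)
qed

end

section \<open>Relabelled graphs and the iterated orthogonal convolution\<close>

lemma relabel_simps [simp]:
  "verts (relabel f G) = f ` verts G" "root (relabel f G) = f (root G)"
  by (simp_all add: relabel_def)

lemma relabel_edges:
  assumes "inj f"
  shows "{f x, f y} \<in> edges (relabel f G) \<longleftrightarrow> {x, y} \<in> edges G"
proof -
  have "{f x, f y} = f ` {x, y}" by simp
  then show ?thesis
    unfolding relabel_def by (simp add: inj_image_mem_iff[OF inj_image_eq_iff[OF assms, THEN iffD1, THEN injI]] del: image_insert)
qed

lemma simple_rooted_relabel:
  assumes "simple_rooted_graph G" "inj f"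
  shows "simple_rooted_graph (relabel f G)"
proof -
  interpret simple_rooted_graph G by fact
  show ?thesis
  proof
    show "edges (relabel f G) \<subseteq> {{x, y} | x y. x \<in> verts (relabel f G) \<and> y \<in> verts (relabel f G) \<and> x \<noteq> y}"
    proof
      fix e assume "e \<in> edges (relabel f G)"
      then obtain e' where e': "e' \<in> edges G" "e = f ` e'" by (auto simp: relabel_def)
      then obtain x y where "e' = {x, y}" "x \<in> verts G" "y \<in> verts G" "x \<noteq> y"
        using edges_subset by blast
      then show "e \<in> {{x, y} | x y. x \<in> verts (relabel f G) \<and> y \<in> verts (relabel f G) \<and> x \<noteq> y}"
        using e' injD[OF assms(2), of x y] by (intro CollectI exI[of _ "f x"] exI[of _ "f y"]) auto
    qed
  qed simp
qed

lemma neighbours_relabel: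
  assumes "simple_rooted_graph G" "inj f"
  shows "neighbours (relabel f G) (f x) = f ` neighbours G x"
proof -
  interpret R: simple_rooted_graph "relabel f G" by (rule simple_rooted_relabel[OF assms])
  show ?thesis
    using R.neighboursD(2)[of _ "f x"] relabel_edges[OF assms(2)]
    by (fastforce simp: neighbours_def)
qed

lemma bounded_degree_relabel:
  assumes "bounded_degree_graph G d" "inj f"
  shows "bounded_degree_graph (relabel f G) d"
proof -
  interpret bounded_degree_graph G d by fact
  show ?thesis
  proof (rule bounded_degree_graphI)
    fix v assume "v \<in> verts (relabel f G)"
    then obtain x where "v = f x" by auto
    then show "finite (neighbours (relabel f G) v) \<and> card (neighbours (relabel f G) v) \<le> d"
      using neighbours_relabel[OF simple_rooted_graph_axioms assms(2), of x] card_neighbours[of x]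
      by (auto intro: card_image_le[THEN order_trans])
  qed (rule simple_rooted_relabel[OF simple_rooted_graph_axioms assms(2)])
qed

lemma spectral_distribution_relabel:
  assumes "bounded_degree_graph G d" "inj f"
  shows "spectral_distribution (relabel f G) \<mu> \<longleftrightarrow> spectral_distribution G \<mu>"
proof -
  interpret bounded_degree_graph G d by fact
  interpret R: bounded_degree_graph "relabel f G" d by (rule bounded_degree_relabel[OF assms])
  interpret rgraph_embedding f G "relabel f G" d
    by unfold_locales (use assms(2) in \<open>auto simp: rgraph_emb_def relabel_edges intro: inj_on_subset\<close>)
  show ?thesis using spectral_distribution_iso by simp
qed

text \<open>The two factors change places in each step, hence the generalisation over both. The
  degree bound obtained here grows with \<open>m\<close>; a uniform one comes later from embedding
  into the free product.\<close>

lemma orth_iter_spectral: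
  assumes "bounded_degree_graph G d" "bounded_degree_graph H d'"
    and "spectral_distribution G \<mu>" "spectral_distribution H \<nu>"
  shows "\<exists>D. bounded_degree_graph (orth_iter m G H) D \<and>
    spectral_distribution (orth_iter m G H) (orth_conv_iter m \<mu> \<nu>)"
  using assms
proof (induction m arbitrary: G H d d' \<mu> \<nu>)
  case 0
  then show ?case by auto
next
  case (Suc m)
  obtain D where D: "bounded_degree_graph (orth_iter m H G) D"
    "spectral_distribution (orth_iter m H G) (orth_conv_iter m \<nu> \<mu>)"
    using Suc.IH[OF Suc.prems(2,1,4,3)] by blast
  have inj: "inj (\<lambda>(x, y). Node x y)" by (auto intro!: injI)
  note bd = bounded_degree_orth_product[OF Suc.prems(1) D(1)]
  have "bounded_degree_graph (orth_iter (Suc m) G H) (d + D)"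
    using bounded_degree_relabel[OF bd inj] by simp
  moreover have "spectral_distribution (orth_iter (Suc m) G H) (orth_conv_iter (Suc m) \<mu> \<nu>)"
    using orth_conv_is_spectral[OF Suc.prems(1) D(1) Suc.prems(3) D(2)]
      spectral_distribution_relabel[OF bd inj] by simp
  ultimately show ?case by blast
qed

section \<open>Words\<close>

text \<open>The summands are exchanged because \<open>orth_limit G2 G1\<close> marks its first
  graph, here \<open>G2\<close>, by \<open>Inl\<close>, whereas words mark letters of
  \<open>G1\<close> by \<open>Inl\<close>.\<close>

primrec leaf_letter :: "('b + 'a) nest \<Rightarrow> 'a + 'b" where
  "leaf_letter (Leaf v) = (case v of Inl b \<Rightarrow> Inr b | Inr a \<Rightarrow> Inl a)"
| "leaf_letter (Node x y) = undefined"

locale free_product_graphs =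
  G1: simple_rooted_graph G1 + G2: simple_rooted_graph G2
  for G1 :: "'a rgraph" and G2 :: "'b rgraph"
begin

abbreviation "W \<equiv> fp_words G1 G2"

text \<open>Letters of type \<open>True\<close> come from \<open>G1\<close>, those of type \<open>False\<close> from \<open>G2\<close>. The roots count
  as letters here; \<open>wd\<close> sends them to the empty word.\<close>

definition lets :: "bool \<Rightarrow> ('a + 'b) set" where
  "lets c = (if c then Inl ` verts G1 else Inr ` verts G2)"

definition rlet :: "bool \<Rightarrow> 'a + 'b" where
  "rlet c = (if c then Inl (root G1) else Inr (root G2))"

definition wd :: "'a + 'b \<Rightarrow> ('a + 'b) list" where
  "wd a = (if rlet (isl a) = a then [] else [a])"

definition ladj :: "'a + 'b \<Rightarrow> 'a + 'b \<Rightarrow> bool" where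
  "ladj a b = (case (a, b) of (Inl x, Inl y) \<Rightarrow> {x, y} \<in> edges G1 | (Inr x, Inr y) \<Rightarrow> {x, y} \<in> edges G2 | _ \<Rightarrow> False)"

definition fadj :: "('a + 'b) list \<Rightarrow> ('a + 'b) list \<Rightarrow> bool" where
  "fadj w w' \<longleftrightarrow> (\<exists>a b u. ladj a b \<and> w = wd a @ u \<and> w' = wd b @ u \<and> u \<in> W \<and> w \<in> W \<and> w' \<in> W)"

lemma isl_rlet [simp]: "isl (rlet c) = c"
  by (simp add: rlet_def)

lemma isl_lets: "a \<in> lets c \<Longrightarrow> isl a = c"
  by (auto simp: lets_def split: if_splits)

lemma rlet_in_lets [simp]: "rlet c \<in> lets c"
  by (simp add: rlet_def lets_def)

lemma wd_rlet [simp]: "wd (rlet c) = []"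
  by (simp add: wd_def)

lemma ladj_sym: "ladj a b \<longleftrightarrow> ladj b a"
  by (auto simp: ladj_def insert_commute split: sum.splits)

lemma ladjD:
  assumes "ladj a b"
  shows "a \<in> lets (isl a)" "b \<in> lets (isl a)" "isl b = isl a" "a \<noteq> b"
  using assms G1.edge_verts G2.edge_verts by (auto simp: ladj_def lets_def split: sum.splits)

lemma wd_eq: "isl a = c \<Longrightarrow> wd a = (if a = rlet c then [] else [a])"
  by (auto simp: wd_def)

lemma wd_inj: "isl a = isl b \<Longrightarrow> wd a = wd b \<longleftrightarrow> a = b"
  using wd_eq[of a "isl b"] wd_eq[of b "isl b"] by (cases "a = rlet (isl b)"; cases "b = rlet (isl b)") simp_all

lemma in_W_iff: "w \<in> W \<longleftrightarrow> (\<forall>a\<in>set w. a \<in> lets (isl a) \<and> rlet (isl a) \<noteq> a) \<and> successively (\<lambda>a b. isl a \<noteq> isl b) w"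
proof -
  have "a \<in> Inl ` (verts G1 - {root G1}) \<union> Inr ` (verts G2 - {root G2}) \<longleftrightarrow>
      a \<in> lets (isl a) \<and> rlet (isl a) \<noteq> a" for a
    by (cases a) (auto simp: lets_def rlet_def)
  then show ?thesis unfolding fp_words_def mem_Collect_eq subset_iff Ball_def by simp
qed

lemma Nil_in_W [simp]: "[] \<in> W"
  by (simp add: in_W_iff)

lemma snoc_in_W:
  "u @ [a] \<in> W \<longleftrightarrow> u \<in> W \<and> a \<in> lets (isl a) \<and> rlet (isl a) \<noteq> a \<and> (u \<noteq> [] \<longrightarrow> isl (last u) \<noteq> isl a)"
  by (auto simp: in_W_iff successively_append_iff)

lemma Cons_in_W:
  "a # u \<in> W \<longleftrightarrow> u \<in> W \<and> a \<in> lets (isl a) \<and> rlet (isl a) \<noteq> a \<and> (u \<noteq> [] \<longrightarrow> isl (hd u) \<noteq> isl a)"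
  by (auto simp: in_W_iff successively_Cons)

lemma append_in_W: "u @ v \<in> W \<Longrightarrow> u \<in> W \<and> v \<in> W"
  by (auto simp: in_W_iff successively_append_iff)

lemma fp_edge_iff: "{w, w'} \<in> edges (free_product G1 G2) \<longleftrightarrow> fadj w w'"
proof
  assume "{w, w'} \<in> edges (free_product G1 G2)"
  then consider v v' u where "{w, w'} = {fp_word1 G1 v @ u, fp_word1 G1 v' @ u}" "{v, v'} \<in> edges G1"
      "u \<in> W" "fp_word1 G1 v @ u \<in> W" "fp_word1 G1 v' @ u \<in> W"
    | v v' u where "{w, w'} = {fp_word2 G2 v @ u, fp_word2 G2 v' @ u}" "{v, v'} \<in> edges G2"
      "u \<in> W" "fp_word2 G2 v @ u \<in> W" "fp_word2 G2 v' @ u \<in> W"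
    unfolding free_product_def by auto
  then have "fadj w w' \<or> fadj w' w"
  proof cases
    case 1
    have "wd (Inl v) = fp_word1 G1 v" "wd (Inl v') = fp_word1 G1 v'" "ladj (Inl v) (Inl v')"
      using 1 by (auto simp: wd_def fp_word1_def rlet_def ladj_def)
    then show ?thesis using 1 unfolding fadj_def doubleton_eq_iff by metis
  next
    case 2
    have "wd (Inr v) = fp_word2 G2 v" "wd (Inr v') = fp_word2 G2 v'" "ladj (Inr v) (Inr v')"
      using 2 by (auto simp: wd_def fp_word2_def rlet_def ladj_def)
    then show ?thesis using 2 unfolding fadj_def doubleton_eq_iff by metis
  qed
  then show "fadj w w'" unfolding fadj_def using ladj_sym by blast
next
  assume "fadj w w'"
  then obtain a b u where *: "ladj a b" "w = wd a @ u" "w' = wd b @ u" "u \<in> W" "w \<in> W" "w' \<in> W"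
    by (auto simp: fadj_def)
  consider x y where "a = Inl x" "b = Inl y" "{x, y} \<in> edges G1" | x y where "a = Inr x" "b = Inr y" "{x, y} \<in> edges G2"
    using *(1) by (auto simp: ladj_def split: sum.splits)
  then show "{w, w'} \<in> edges (free_product G1 G2)"
  proof cases
    case 1
    then have "w = fp_word1 G1 x @ u" "w' = fp_word1 G1 y @ u"
      using * by (auto simp: wd_def fp_word1_def rlet_def)
    then show ?thesis unfolding free_product_def using 1 * by auto
  next
    case 2
    then have "w = fp_word2 G2 x @ u" "w' = fp_word2 G2 y @ u"
      using * by (auto simp: wd_def fp_word2_def rlet_def)
    then show ?thesis unfolding free_product_def using 2 * by auto
  qed
qed

lemma free_product_simps [simp]: "verts (free_product G1 G2) = W" "root (free_product G1 G2) = []"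
  by (simp_all add: free_product_def)

lemma fadj_sym: "fadj w w' \<longleftrightarrow> fadj w' w"
  unfolding fadj_def using ladj_sym by blast

lemma fadj_irrefl: "\<not> fadj w w"
proof
  assume "fadj w w"
  then obtain a b u where "ladj a b" "wd a @ u = wd b @ u" by (auto simp: fadj_def)
  then show False using ladjD(3,4)[of a b] wd_inj[of a b] by simp
qed

lemma simple_rooted_free_product: "simple_rooted_graph (free_product G1 G2)"
proof
  show "edges (free_product G1 G2) \<subseteq> {{x, y} | x y. x \<in> verts (free_product G1 G2) \<and> y \<in> verts (free_product G1 G2) \<and> x \<noteq> y}"
  proof
    fix e assume e: "e \<in> edges (free_product G1 G2)"
    then obtain w w' where "e = {w, w'}" unfolding free_product_def by auto
    moreover from this have "fadj w w'" using e by (simp add: fp_edge_iff)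
    then have "w \<in> W" "w' \<in> W" "w \<noteq> w'" using fadj_irrefl[of w] by (auto simp only: fadj_def)
    ultimately show "e \<in> {{x, y} | x y. x \<in> verts (free_product G1 G2) \<and> y \<in> verts (free_product G1 G2) \<and> x \<noteq> y}"
      by (intro CollectI exI[of _ w] exI[of _ w']) simp
  qed
qed simp

lemma fadj_length: "fadj w w' \<Longrightarrow> length w' \<le> Suc (length w)"
  by (auto simp: fadj_def wd_def)

text \<open>An edge only changes the front of a word, so a last letter survives unless it is the
  changed letter itself, which forces words of length one.\<close>

lemma fadj_snoc:
  assumes "u @ [a] \<in> W" "u' @ [a'] \<in> W"
  shows "fadj (u @ [a]) (u' @ [a']) \<longleftrightarrow> a = a' \<and> fadj u u' \<or> u = [] \<and> u' = [] \<and> ladj a a'"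
proof
  assume "fadj (u @ [a]) (u' @ [a'])"
  then obtain b b' t where *: "ladj b b'" "u @ [a] = wd b @ t" "u' @ [a'] = wd b' @ t" "t \<in> W"
    by (auto simp: fadj_def)
  show "a = a' \<and> fadj u u' \<or> u = [] \<and> u' = [] \<and> ladj a a'"
  proof (cases t rule: rev_cases)
    case Nil
    then have "u = []" "u' = []" "a = b" "a' = b'"
      using * by (auto simp: wd_def split: if_splits)
    then show ?thesis using * by simp
  next
    case (snoc s x)
    then have "u = wd b @ s" "u' = wd b' @ s" "a = x" "a' = x" using * by (auto simp flip: append_assoc)
    moreover have "u \<in> W" "u' \<in> W" "s \<in> W" using assms * snoc append_in_W by blast+
    ultimately show ?thesis using * unfolding fadj_def by blast
  qed
next
  assume "a = a' \<and> fadj u u' \<or> u = [] \<and> u' = [] \<and> ladj a a'"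
  then show "fadj (u @ [a]) (u' @ [a'])"
  proof
    assume "a = a' \<and> fadj u u'"
    then obtain b b' t where *: "a = a'" "ladj b b'" "u = wd b @ t" "u' = wd b' @ t"
      by (auto simp: fadj_def)
    moreover have "t @ [a] \<in> W" using append_in_W[of "wd b" "t @ [a]"] assms * by simp
    ultimately show ?thesis using assms unfolding fadj_def by (metis append_assoc)
  next
    assume *: "u = [] \<and> u' = [] \<and> ladj a a'"
    then have "wd a = [a]" "wd a' = [a']" using assms snoc_in_W[of u a] snoc_in_W[of u' a'] by (auto simp: wd_def)
    then show ?thesis using * assms unfolding fadj_def by (metis Nil_in_W append_Nil append_Nil2)
  qed
qed

lemma fadj_Nil_snoc:
  assumes "u @ [a] \<in> W"
  shows "fadj [] (u @ [a]) \<longleftrightarrow> u = [] \<and> ladj (rlet (isl a)) a"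
proof
  assume "fadj [] (u @ [a])"
  then obtain b b' where *: "ladj b b'" "wd b = []" "u @ [a] = wd b'" by (auto simp: fadj_def)
  then have b: "u = []" "b' = a" "rlet (isl b) = b" by (auto simp: wd_def split: if_splits)
  then show "u = [] \<and> ladj (rlet (isl a)) a" using *(1) ladjD(3)[OF *(1)] by simp
next
  assume *: "u = [] \<and> ladj (rlet (isl a)) a"
  then have "wd a = [a]" using assms snoc_in_W[of u a] by (auto simp: wd_def)
  then show "fadj [] (u @ [a])"
    using * assms unfolding fadj_def by (intro exI[of _ "rlet (isl a)"] exI[of _ a] exI[of _ "[]"]) auto
qed

lemma wd_in_W: "a \<in> lets c \<Longrightarrow> wd a \<in> W"
  using isl_lets[of a c] by (auto simp: wd_def Cons_in_W)

lemma fadj_wd: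
  assumes "a \<in> lets c" "b \<in> lets c"
  shows "fadj (wd a) (wd b) \<longleftrightarrow> ladj a b"
proof -
  have ab: "isl a = c" "isl b = c" using assms isl_lets by auto
  have W: "wd a \<in> W" "wd b \<in> W" using assms wd_in_W by blast+
  show ?thesis
  proof (cases "a = rlet c"; cases "b = rlet c")
    assume "a = rlet c" "b = rlet c"
    then show ?thesis using fadj_irrefl ladjD(4)[of a b] by auto
  next
    assume a: "a = rlet c" and b: "b \<noteq> rlet c"
    then have "wd b = [] @ [b]" using ab by (simp add: wd_def)
    then show ?thesis using fadj_Nil_snoc[of "[]" b] W a ab by simp
  next
    assume a: "a \<noteq> rlet c" and b: "b = rlet c"
    then have "wd a = [] @ [a]" using ab by (simp add: wd_def)
    then show ?thesis using fadj_Nil_snoc[of "[]" a] W b ab fadj_sym ladj_sym by simp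
  next
    assume a: "a \<noteq> rlet c" and b: "b \<noteq> rlet c"
    then have "wd a = [] @ [a]" "wd b = [] @ [b]" using ab by (simp_all add: wd_def)
    then show ?thesis using fadj_snoc[of "[]" a "[]" b] W fadj_irrefl[of "[]"] by auto
  qed
qed

text \<open>The empty word belongs to both sets: it is the root in either case.\<close>

definition words_ending :: "bool \<Rightarrow> ('a + 'b) list set" where
  "words_ending c = {w \<in> W. w \<noteq> [] \<longrightarrow> isl (last w) = c}"

text \<open>Abstracts from the vertex type, so that \<open>G1\<close> itself and the copies of both
  graphs inside the type \<open>nest\<close> are treated alike.\<close>

definition is_factor :: "'x rgraph \<Rightarrow> ('x \<Rightarrow> 'a + 'b) \<Rightarrow> bool \<Rightarrow> bool" where
  "is_factor K ltr c \<longleftrightarrow> simple_rooted_graph K \<and> bij_betw ltr (verts K) (lets c) \<and> ltr (root K) = rlet c \<and>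
     (\<forall>x\<in>verts K. \<forall>y\<in>verts K. {x, y} \<in> edges K \<longleftrightarrow> ladj (ltr x) (ltr y))"

end

text \<open>The common core of comb and orthogonal products: copies of a graph \<open>H\<close>, coded by words that do not
  end in a letter of type \<open>c\<close>, are glued to the vertices of the factor of type \<open>c\<close>.\<close>

locale glued_words = free_product_graphs G1 G2
  for G1 :: "'a rgraph" and G2 :: "'b rgraph" +
  fixes K :: "'x rgraph" and ltr :: "'x \<Rightarrow> 'a + 'b" and c :: bool
    and H :: "'y rgraph" and h :: "'y \<Rightarrow> ('a + 'b) list"
  assumes K: "is_factor K ltr c"
    and h_words: "h ` verts H \<subseteq> words_ending (\<not> c)" and h_inj: "inj_on h (verts H)"
    and h_root: "root H \<in> verts H" "h (root H) = []"
    and h_edges: "\<And>y y'. y \<in> verts H \<Longrightarrow> y' \<in> verts H \<Longrightarrow> {y, y'} \<in> edges H \<longleftrightarrow> fadj (h y) (h y')"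
begin

sublocale K: simple_rooted_graph K using K by (simp add: is_factor_def)

definition glue :: "'x \<times> 'y \<Rightarrow> ('a + 'b) list" where
  "glue = (\<lambda>(x, y). h y @ wd (ltr x))"

lemma l_lets: "x \<in> verts K \<Longrightarrow> ltr x \<in> lets c"
  and l_isl: "x \<in> verts K \<Longrightarrow> isl (ltr x) = c"
  and l_inj: "x \<in> verts K \<Longrightarrow> x' \<in> verts K \<Longrightarrow> ltr x = ltr x' \<longleftrightarrow> x = x'"
  and l_edges: "x \<in> verts K \<Longrightarrow> x' \<in> verts K \<Longrightarrow> ladj (ltr x) (ltr x') \<longleftrightarrow> {x, x'} \<in> edges K"
  and l_root: "ltr (root K) = rlet c"
  using K isl_lets by (auto simp: is_factor_def dest: bij_betwE bij_betw_imp_inj_on inj_on_eq_iff)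

lemma wd_l:
  assumes "x \<in> verts K"
  shows "wd (ltr x) = (if x = root K then [] else [ltr x])"
  using l_inj[OF assms K.root_in_verts] l_isl[OF assms] by (simp add: wd_eq l_root)

lemma h_props:
  assumes "y \<in> verts H"
  shows "h y \<in> W" "h y \<noteq> [] \<Longrightarrow> isl (last (h y)) \<noteq> c" "h y = [] \<longleftrightarrow> y = root H"
proof -
  have "h y \<in> words_ending (\<not> c)" using h_words assms by blast
  then show "h y \<in> W" "h y \<noteq> [] \<Longrightarrow> isl (last (h y)) \<noteq> c" by (auto simp: words_ending_def)
  show "h y = [] \<longleftrightarrow> y = root H" using inj_onD[OF h_inj _ assms h_root(1)] h_root by metis
qed

lemma glue_in_W:
  assumes "x \<in> verts K" "y \<in> verts H"
  shows "glue (x, y) \<in> W"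
  using h_props[OF assms(2)] l_lets[OF assms(1)] l_isl[OF assms(1)] l_inj[OF assms(1) K.root_in_verts] l_root
  by (auto simp: glue_def wd_l[OF assms(1)] snoc_in_W)

lemma glue_inj: "inj_on glue (verts K \<times> verts H)"
proof (rule inj_onI, clarify)
  fix x y x' y' assume *: "x \<in> verts K" "y \<in> verts H" "x' \<in> verts K" "y' \<in> verts H" "glue (x, y) = glue (x', y')"
  have no: "h v \<noteq> t @ [ltr u]" if "u \<in> verts K" "v \<in> verts H" for t u v
    using h_props(2)[OF that(2)] l_isl[OF that(1)] by auto
  have "x = x' \<and> h y = h y'"
    using * l_inj[of x x'] no[of x y'] no[of x' y]
    by (auto simp: glue_def wd_l split: if_splits dest: sym)
  then show "x = x' \<and> y = y'" using inj_onD[OF h_inj] * by blast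
qed

text \<open>These are the edges of the comb product. On the smaller vertex set of the orthogonal
  product the copy over \<open>root K\<close> shrinks to \<open>root H\<close>, so the same formula
  describes its edges.\<close>

lemma glue_adj:
  assumes "x \<in> verts K" "y \<in> verts H" "x' \<in> verts K" "y' \<in> verts H"
  shows "fadj (glue (x, y)) (glue (x', y')) \<longleftrightarrow>
    y = root H \<and> y' = root H \<and> {x, x'} \<in> edges K \<or> x = x' \<and> {y, y'} \<in> edges H"
proof -
  note W = glue_in_W[OF assms(1,2)] glue_in_W[OF assms(3,4)]
  \<comment> \<open>The word on the left ends in a letter of the wrong type or is empty, while the
    one on the right ends in type \<open>c\<close>; adjacency is possible only from the empty word
    to a single letter.\<close>
  have one: "fadj (glue (root K, y)) (glue (x', y')) \<longleftrightarrow> y = root H \<and> y' = root H \<and> {root K, x'} \<in> edges K"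
    if *: "x' \<in> verts K" "y \<in> verts H" "y' \<in> verts H" "x' \<noteq> root K" for x' y y'
  proof (cases "h y" rule: rev_cases)
    case Nil
    then have "fadj (glue (root K, y)) (glue (x', y')) \<longleftrightarrow> fadj [] (h y' @ [ltr x'])"
      using * by (simp add: glue_def wd_l l_root)
    also have "\<dots> \<longleftrightarrow> h y' = [] \<and> ladj (ltr (root K)) (ltr x')"
      using glue_in_W[OF *(1,3)] * by (subst fadj_Nil_snoc) (auto simp: glue_def wd_l l_isl l_root)
    finally show ?thesis using Nil * h_props(3) l_edges by auto
  next
    case (snoc u b)
    have ty: "isl b \<noteq> c" using h_props(2)[OF *(2)] snoc by simp
    have "h y \<noteq> []" using snoc by simp
    then have "y \<noteq> root H" using h_root by auto
    have "fadj (glue (root K, y)) (glue (x', y')) \<longleftrightarrow> fadj (u @ [b]) (h y' @ [ltr x'])"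
      using * snoc by (simp add: glue_def wd_l l_root)
    also have "\<dots> \<longleftrightarrow> b = ltr x' \<and> fadj u (h y') \<or> u = [] \<and> h y' = [] \<and> ladj b (ltr x')"
      using glue_in_W[OF *(1,3)] glue_in_W[OF K.root_in_verts *(2)] * snoc
      by (subst fadj_snoc) (auto simp: glue_def wd_l l_root)
    also have "\<dots> \<longleftrightarrow> False" using ty l_isl[OF *(1)] ladjD(3)[of b "ltr x'"] by auto
    finally show ?thesis using \<open>y \<noteq> root H\<close> by simp
  qed
  show ?thesis
  proof (cases "x = root K"; cases "x' = root K")
    assume "x = root K" "x' = root K"
    then show ?thesis using h_edges[OF assms(2,4)] K.edge_verts(3)[of x x'] by (auto simp: glue_def l_root)
  next
    assume "x = root K" "x' \<noteq> root K"
    then show ?thesis using one[of x' y y'] assms by auto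
  next
    assume "x \<noteq> root K" "x' = root K"
    then show ?thesis using one[of x y' y] assms fadj_sym by (auto simp: insert_commute)
  next
    assume "x \<noteq> root K" "x' \<noteq> root K"
    then have "fadj (glue (x, y)) (glue (x', y')) \<longleftrightarrow> fadj (h y @ [ltr x]) (h y' @ [ltr x'])"
      using assms by (simp add: glue_def wd_l)
    also have "\<dots> \<longleftrightarrow> ltr x = ltr x' \<and> fadj (h y) (h y') \<or> h y = [] \<and> h y' = [] \<and> ladj (ltr x) (ltr x')"
      using W \<open>x \<noteq> root K\<close> \<open>x' \<noteq> root K\<close> assms by (subst fadj_snoc) (auto simp: glue_def wd_l)
    finally show ?thesis using assms l_inj h_edges l_edges h_props(3) by auto
  qed
qed

text \<open>Surjectivity is stated for one word at a time, since a stage of the chain covers short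
  words only, whereas the limit graph covers all of them.\<close>

lemma in_glue_image:
  assumes "w \<in> W" and "\<And>u a. w = u @ [a] \<Longrightarrow> isl a = c \<Longrightarrow> u \<in> h ` verts H"
    and "\<And>u a. w = u @ [a] \<Longrightarrow> isl a \<noteq> c \<Longrightarrow> w \<in> h ` verts H"
  shows "w \<in> glue ` (verts K \<times> verts H)"
proof -
  have from_h: "w \<in> glue ` (verts K \<times> verts H)" if "w \<in> h ` verts H"
  proof -
    from that obtain y where y: "y \<in> verts H" "w = h y" by blast
    show ?thesis by (rule image_eqI[of _ _ "(root K, y)"]) (use y in \<open>simp_all add: glue_def l_root\<close>)
  qed
  show ?thesis
  proof (cases w rule: rev_cases)
    case Nil
    then show ?thesis by (intro from_h image_eqI[of _ _ "root H"]) (simp_all add: h_root)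
  next
    case (snoc u a)
    show ?thesis
    proof (cases "isl a = c")
      case True
      obtain y where y: "y \<in> verts H" "u = h y" using assms(2)[OF snoc True] by blast
      have "a \<in> lets c" "rlet c \<noteq> a" using assms(1) snoc_in_W[of u a] snoc True by simp_all
      moreover have "ltr ` verts K = lets c" using K by (simp add: is_factor_def bij_betw_def)
      ultimately obtain x where x: "x \<in> verts K" "ltr x = a" by (metis imageE)
      moreover have "x \<noteq> root K" using x(2) \<open>rlet c \<noteq> a\<close> l_root by auto
      ultimately have "wd a = [a]" using wd_l[of x] by simp
      then show ?thesis
        by (intro image_eqI[of _ _ "(x, y)"]) (simp_all add: glue_def x y snoc)
    next
      case False
      then show ?thesis using assms(3)[OF snoc] from_h by blast
    qed
  qed
qed

lemma glue_root: "glue (root K, root H) = []"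
  by (simp add: glue_def h_root l_root)

lemma comb_rgraph_emb: "rgraph_emb glue (comb_product K H) (free_product G1 G2)"
  using glue_inj glue_in_W glue_root glue_adj
  by (auto simp: rgraph_emb_def in_glue_edges fp_edge_iff)

lemma comb_rgraph_iso:
  assumes "h ` verts H = words_ending (\<not> c)"
  shows "rgraph_iso (free_product G1 G2) (comb_product K H)"
proof (rule rgraph_iso_sym)
  have "w \<in> glue ` (verts K \<times> verts H)" if "w \<in> W" for w
  proof (rule in_glue_image[OF that])
    fix u a assume "w = u @ [a]" "isl a = c"
    then show "u \<in> h ` verts H"
      unfolding assms words_ending_def using that snoc_in_W[of u a] by auto
  next
    fix u a assume "w = u @ [a]" "isl a \<noteq> c"
    then show "w \<in> h ` verts H"
      unfolding assms words_ending_def using that by auto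
  qed
  then have "glue ` (verts K \<times> verts H) = W" using glue_in_W by blast
  then show "rgraph_iso (comb_product K H) (free_product G1 G2)"
    using comb_rgraph_emb glue_inj unfolding rgraph_iso_def rgraph_emb_def bij_betw_def by auto
qed (simp add: h_root)

end

section \<open>Iterated orthogonal products as sets of words\<close>

context free_product_graphs
begin

definition factor :: "bool \<Rightarrow> ('b + 'a) nest rgraph" where
  "factor c = (if c then relabel (\<lambda>x. Leaf (Inr x)) G1 else relabel (\<lambda>y. Leaf (Inl y)) G2)"

text \<open>The outermost factor \<open>x\<close> contributes the last letter, the one nearest to
  the root, hence the reversed order.\<close>

primrec dec :: "('b + 'a) nest \<Rightarrow> ('a + 'b) list" where
  "dec (Leaf v) = wd (leaf_letter (Leaf v))"
| "dec (Node x y) = dec y @ dec x"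

definition stage :: "bool \<Rightarrow> nat \<Rightarrow> ('b + 'a) nest rgraph" where
  "stage c m = orth_iter m (factor c) (factor (\<not> c))"

lemma inj_leaf:
  "inj (\<lambda>x :: 'a. Leaf (Inr x) :: ('b + 'a) nest)" "inj (\<lambda>y :: 'b. Leaf (Inl y) :: ('b + 'a) nest)"
  by (auto intro!: injI)

lemma inj_Node: "inj (\<lambda>(x :: ('b + 'a) nest, y). Node x y)"
  by (auto intro!: injI)

lemma is_factor_G1: "is_factor G1 Inl True"
  using G1.simple_rooted_graph_axioms
  by (auto simp: is_factor_def lets_def rlet_def ladj_def bij_betw_def)

lemma is_factor_factor: "is_factor (factor c) leaf_letter c"
proof (cases c)
  case True
  have "bij_betw leaf_letter (verts (factor True)) (lets True)"
    by (auto simp: bij_betw_def factor_def lets_def image_image intro!: inj_onI)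
  then show ?thesis
    using True simple_rooted_relabel[OF G1.simple_rooted_graph_axioms inj_leaf(1)] relabel_edges[OF inj_leaf(1)]
    by (auto simp: is_factor_def factor_def rlet_def ladj_def)
next
  case False
  have "bij_betw leaf_letter (verts (factor False)) (lets False)"
    by (auto simp: bij_betw_def factor_def lets_def image_image intro!: inj_onI)
  then show ?thesis
    using False simple_rooted_relabel[OF G2.simple_rooted_graph_axioms inj_leaf(2)] relabel_edges[OF inj_leaf(2)]
    by (auto simp: is_factor_def factor_def rlet_def ladj_def)
qed

lemma factor_simple: "simple_rooted_graph (factor c)"
  using is_factor_factor by (simp add: is_factor_def)

lemma dec_factor: "x \<in> verts (factor c) \<Longrightarrow> dec x = wd (leaf_letter x)"
  by (auto simp: factor_def split: if_splits)

lemma stage_0: "stage c 0 = factor c"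
  by (simp add: stage_def)

lemma stage_Suc: "stage c (Suc m) = relabel (\<lambda>(x, y). Node x y) (orth_product (factor c) (stage (\<not> c) m))"
  by (simp add: stage_def)

definition words_upto :: "bool \<Rightarrow> nat \<Rightarrow> ('a + 'b) list set" where
  "words_upto c m = {w \<in> words_ending c. length w \<le> Suc m}"

text \<open>The stage of the opposite type codes the words not ending in type \<open>c\<close>.
  Gluing it to the nonroot vertices of the factor appends one letter of type \<open>c\<close>, and
  the root contributes only the empty word.\<close>

lemma stage_props:
  "simple_rooted_graph (stage c m) \<and> dec (root (stage c m)) = [] \<and>
   bij_betw dec (verts (stage c m)) (words_upto c m) \<and>
   (\<forall>x\<in>verts (stage c m). \<forall>y\<in>verts (stage c m). {x, y} \<in> edges (stage c m) \<longleftrightarrow> fadj (dec x) (dec y))"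
proof (induction m arbitrary: c)
  case 0
  note F = is_factor_factor[of c, unfolded is_factor_def]
  interpret simple_rooted_graph "factor c" by (rule factor_simple)
  have bij: "bij_betw leaf_letter (verts (factor c)) (lets c)" using F by simp
  have "bij_betw wd (lets c) (words_upto c 0)"
  proof (rule bij_betw_imageI)
    show "inj_on wd (lets c)" using wd_inj isl_lets by (auto intro!: inj_onI)
    show "wd ` lets c = words_upto c 0"
    proof safe
      fix a assume "a \<in> lets c"
      then show "wd a \<in> words_upto c 0"
        using wd_in_W[of a c] isl_lets[of a c] by (auto simp: words_upto_def words_ending_def wd_eq)
    next
      fix w assume w: "w \<in> words_upto c 0"
      show "w \<in> wd ` lets c"
      proof (cases w)
        case Nil
        then show ?thesis using wd_rlet[of c] rlet_in_lets[of c] by (metis image_eqI)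
      next
        case (Cons a u)
        then have "w = [a]" "isl a = c" "a \<in> lets c" "a \<noteq> rlet c"
          using w by (auto simp: words_upto_def words_ending_def Cons_in_W)
        then show ?thesis using wd_eq[of a c] by (metis image_eqI)
      qed
    qed
  qed
  then have "bij_betw (wd \<circ> leaf_letter) (verts (factor c)) (words_upto c 0)"
    using bij by (rule bij_betw_trans[rotated])
  then have "bij_betw dec (verts (factor c)) (words_upto c 0)"
    by (subst bij_betw_cong[of _ dec "wd \<circ> leaf_letter"]) (auto simp: dec_factor)
  moreover have "{x, y} \<in> edges (factor c) \<longleftrightarrow> fadj (dec x) (dec y)"
    if "x \<in> verts (factor c)" "y \<in> verts (factor c)" for x y
    using F that bij_betwE[OF bij] by (simp add: dec_factor[of _ c] fadj_wd[of _ c])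
  moreover have "dec (root (factor c)) = []"
    using F dec_factor[OF root_in_verts] by simp
  ultimately show ?case by (simp add: stage_0 factor_simple)
next
  case (Suc m)
  interpret H: simple_rooted_graph "stage (\<not> c) m" using Suc by blast
  have bij: "bij_betw dec (verts (stage (\<not> c) m)) (words_upto (\<not> c) m)" using Suc by blast
  interpret glued_words G1 G2 "factor c" leaf_letter c "stage (\<not> c) m" dec
  proof
    show "is_factor (factor c) leaf_letter c" by (rule is_factor_factor)
    show "dec ` verts (stage (\<not> c) m) \<subseteq> words_ending (\<not> c)"
      using bij by (auto simp: bij_betw_def words_upto_def)
    show "inj_on dec (verts (stage (\<not> c) m))" using bij by (rule bij_betw_imp_inj_on)
    show "root (stage (\<not> c) m) \<in> verts (stage (\<not> c) m)" by simp
    show "dec (root (stage (\<not> c) m)) = []" using Suc by blast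
    show "{y, y'} \<in> edges (stage (\<not> c) m) \<longleftrightarrow> fadj (dec y) (dec y')"
      if "y \<in> verts (stage (\<not> c) m)" "y' \<in> verts (stage (\<not> c) m)" for y y'
      using Suc that by blast
  qed
  let ?O = "orth_product (factor c) (stage (\<not> c) m)"
  let ?f = "\<lambda>(x, y). Node x y"
  have sub: "verts ?O \<subseteq> verts (factor c) \<times> verts (stage (\<not> c) m)" by auto
  have dec_f: "dec (?f p) = glue p" if "p \<in> verts ?O" for p
    using that by (auto simp: glue_def dec_factor[of _ c])
  have glue_len: "length (glue (x, y)) = length (dec y) + (if x = root (factor c) then 0 else 1)"
    if "x \<in> verts (factor c)" for x y
    using wd_l[OF that] by (simp add: glue_def)
  have img: "glue ` verts ?O = words_upto c (Suc m)"
  proof safe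
    fix x y assume xy: "(x, y) \<in> verts ?O"
    then have v: "x \<in> verts (factor c)" "y \<in> verts (stage (\<not> c) m)" using sub by auto
    have "dec y \<in> words_upto (\<not> c) m" using bij_betwE[OF bij] v by blast
    then have "length (glue (x, y)) \<le> Suc (Suc m)"
      using glue_len[OF v(1)] by (simp add: words_upto_def)
    moreover have "isl (last (glue (x, y))) = c" if "glue (x, y) \<noteq> []"
      using that xy glue_root v by (auto simp: glue_def wd_l l_isl)
    ultimately show "glue (x, y) \<in> words_upto c (Suc m)"
      using glue_in_W[OF v] by (simp add: words_upto_def words_ending_def)
  next
    fix w assume w: "w \<in> words_upto c (Suc m)"
    show "w \<in> glue ` verts ?O"
    proof (cases w rule: rev_cases)
      case Nil
      then show ?thesis using glue_root by (intro image_eqI[of _ _ "(root (factor c), root (stage (\<not> c) m))"]) auto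
    next
      case (snoc u a)
      then have a: "isl a = c" "w \<in> W" using w by (auto simp: words_upto_def words_ending_def)
      then have "u \<in> words_upto (\<not> c) m"
        using w snoc snoc_in_W[of u a] by (auto simp: words_upto_def words_ending_def)
      then have "u \<in> dec ` verts (stage (\<not> c) m)" using bij by (simp add: bij_betw_def)
      then have "w \<in> glue ` (verts (factor c) \<times> verts (stage (\<not> c) m))"
        using a snoc by (intro in_glue_image) auto
      then obtain x y where xy: "x \<in> verts (factor c)" "y \<in> verts (stage (\<not> c) m)" "w = glue (x, y)" by auto
      \<comment> \<open>Over the root of the factor nothing is appended, so the word would end as
        \<open>dec y\<close> does, in the other type.\<close>
      have "x \<noteq> root (factor c)"
      proof
        assume "x = root (factor c)"
        then have "glue (x, y) = dec y" by (simp add: glue_def l_root)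
        with xy(3) snoc have "dec y = u @ [a]" by simp
        then have y: "dec y \<noteq> []" "last (dec y) = a" by simp_all
        show False using h_props(2)[OF xy(2) y(1)] unfolding y(2) a(1) by simp
      qed
      then show ?thesis using xy by auto
    qed
  qed
  have "inj_on glue (verts ?O)" using glue_inj sub by (rule inj_on_subset)
  then have "inj_on (dec \<circ> ?f) (verts ?O)"
    using dec_f by (subst inj_on_cong[of _ _ glue]) simp_all
  then have "inj_on dec (?f ` verts ?O)" by (rule inj_on_imageI)
  moreover have "dec ` ?f ` verts ?O = words_upto c (Suc m)"
    unfolding image_image img[symmetric] by (rule image_cong[OF refl dec_f])
  ultimately have bij': "bij_betw dec (?f ` verts ?O) (words_upto c (Suc m))"
    by (rule bij_betw_imageI)
  have adj: "{p, q} \<in> edges ?O \<longleftrightarrow> fadj (glue p) (glue q)" if "p \<in> verts ?O" "q \<in> verts ?O" for p q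
  proof -
    obtain x y x' y' where pq: "p = (x, y)" "q = (x', y')" by (cases p, cases q)
    have v: "x \<in> verts (factor c)" "y \<in> verts (stage (\<not> c) m)" "x' \<in> verts (factor c)" "y' \<in> verts (stage (\<not> c) m)"
      using that sub pq by auto
    have "\<not> {y, y} \<in> edges (stage (\<not> c) m)" using H.edge_verts(3) by blast
    then show ?thesis using that unfolding pq glue_adj[OF v] by (auto simp: in_glue_edges)
  qed
  show ?case
    unfolding stage_Suc
  proof (intro conjI ballI)
    show "simple_rooted_graph (relabel ?f ?O)"
      by (intro simple_rooted_relabel simple_rooted_orth_product factor_simple inj_Node H.simple_rooted_graph_axioms)
    show "dec (root (relabel ?f ?O)) = []"
      using dec_f[of "root ?O"] glue_root by simp
    show "bij_betw dec (verts (relabel ?f ?O)) (words_upto c (Suc m))" using bij' by simp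
    fix t s assume "t \<in> verts (relabel ?f ?O)" "s \<in> verts (relabel ?f ?O)"
    then obtain p q where "t = ?f p" "s = ?f q" "p \<in> verts ?O" "q \<in> verts ?O"
      unfolding relabel_simps by blast
    then show "{t, s} \<in> edges (relabel ?f ?O) \<longleftrightarrow> fadj (dec t) (dec s)"
      using relabel_edges[OF inj_Node, of p q] adj[of p q] dec_f by simp
  qed
qed

lemma stage_simple: "simple_rooted_graph (stage c m)"
  and dec_root: "dec (root (stage c m)) = []"
  and dec_bij: "bij_betw dec (verts (stage c m)) (words_upto c m)"
  and dec_edges: "x \<in> verts (stage c m) \<Longrightarrow> y \<in> verts (stage c m) \<Longrightarrow>
      {x, y} \<in> edges (stage c m) \<longleftrightarrow> fadj (dec x) (dec y)"
  using stage_props[of c m] by blast+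

lemma stage_root_in: "root (stage c m) \<in> verts (stage c m)"
  using stage_simple by (rule simple_rooted_graph.root_in_verts)

lemma dec_inj: "x \<in> verts (stage c m) \<Longrightarrow> y \<in> verts (stage c m) \<Longrightarrow> dec x = dec y \<Longrightarrow> x = y"
  using inj_onD[OF bij_betw_imp_inj_on[OF dec_bij]] by blast

lemma glued_words_stage: "glued_words G1 G2 G1 Inl True (stage False m) dec"
proof
  show "is_factor G1 Inl True" by (rule is_factor_G1)
  show "dec ` verts (stage False m) \<subseteq> words_ending (\<not> True)"
    using dec_bij[of False m] by (auto simp: bij_betw_def words_upto_def)
qed (use dec_bij[of False m] stage_root_in dec_root dec_edges in \<open>auto simp: bij_betw_def\<close>)

subsection \<open>The inductive limit\<close>

abbreviation "stage_emb c m \<equiv> orth_emb m (factor c) (factor (\<not> c))"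

text \<open>The embedding inserts a root at the innermost place of the nested pair, and roots decode
  to the empty word.\<close>

lemma stage_emb_props:
  "t \<in> verts (stage c m) \<Longrightarrow> stage_emb c m t \<in> verts (stage c (Suc m)) \<and> dec (stage_emb c m t) = dec t"
proof (induction m arbitrary: c t)
  case 0
  have "dec (root (factor (\<not> c))) = []" using dec_root[of "\<not> c" 0] by (simp add: stage_0)
  moreover have "root (factor (\<not> c)) \<in> verts (factor (\<not> c))" using stage_root_in[of "\<not> c" 0] by (simp add: stage_0)
  ultimately show ?case using 0 by (auto simp: stage_0 stage_Suc)
next
  case (Suc m)
  then obtain x y where t: "t = Node x y" "(x, y) \<in> verts (orth_product (factor c) (stage (\<not> c) m))"
    by (auto simp: stage_Suc)
  then have y: "y \<in> verts (stage (\<not> c) m)" using stage_root_in by auto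
  have IH: "stage_emb (\<not> c) m y \<in> verts (stage (\<not> c) (Suc m))" "dec (stage_emb (\<not> c) m y) = dec y"
    using Suc.IH[OF y] by auto
  \<comment> \<open>Preservation of the root needs no computation: both vertices decode to the empty
    word, and \<open>dec\<close> is injective on a stage.\<close>
  have root: "stage_emb (\<not> c) m y = root (stage (\<not> c) (Suc m))" if "y = root (stage (\<not> c) m)"
    using IH dec_root[of "\<not> c"] that by (intro dec_inj[of _ "\<not> c" "Suc m"]) (auto simp: stage_root_in)
  have "(x, stage_emb (\<not> c) m y) \<in> verts (orth_product (factor c) (stage (\<not> c) (Suc m)))"
  proof (cases "x = root (factor c)")
    case True
    then have "y = root (stage (\<not> c) m)" using t(2) by simp
    then show ?thesis using True root by simp
  next
    case False
    then have "x \<in> verts (factor c)" using t(2) by simp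
    then show ?thesis
      unfolding orth_product_simps using False IH(1) by blast
  qed
  then have "Node x (stage_emb (\<not> c) m y) \<in> verts (stage c (Suc (Suc m)))"
    unfolding stage_Suc[of c "Suc m"] relabel_simps
    by (intro image_eqI[of _ _ "(x, stage_emb (\<not> c) m y)"]) simp_all
  then show ?case using t IH by simp
qed

lemma stage_chain_map:
  "t \<in> verts (stage c n) \<Longrightarrow> chain_map (stage_emb c) n k t \<in> verts (stage c (n + k)) \<and>
    dec (chain_map (stage_emb c) n k t) = dec t"
  by (induction k) (use stage_emb_props in auto)

definition word_class :: "bool \<Rightarrow> ('a + 'b) list \<Rightarrow> (nat \<times> ('b + 'a) nest) set" where
  "word_class c w = {(m, t). t \<in> verts (stage c m) \<and> dec t = w}"

text \<open>Two vertices of stages \<open>n\<close> and \<open>m\<close> meet in stage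
  \<open>n + m\<close> if their words agree, because \<open>dec\<close> is injective there; the
  converse holds because the chain maps preserve words.\<close>

lemma limit_class_eq:
  assumes "t \<in> verts (stage c n)"
  shows "limit_class (stage c) (stage_emb c) n t = word_class c (dec t)"
proof -
  have "(\<exists>k l. n + k = m + l \<and> chain_map (stage_emb c) n k t = chain_map (stage_emb c) m l s) \<longleftrightarrow> dec s = dec t"
    if s: "s \<in> verts (stage c m)" for m s
  proof
    assume "\<exists>k l. n + k = m + l \<and> chain_map (stage_emb c) n k t = chain_map (stage_emb c) m l s"
    then show "dec s = dec t" using stage_chain_map[OF assms] stage_chain_map[OF s] by metis
  next
    assume eq: "dec s = dec t"
    have "chain_map (stage_emb c) n m t = chain_map (stage_emb c) m n s"
      using stage_chain_map[OF assms, of m] stage_chain_map[OF s, of n] eq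
      by (intro dec_inj[of _ c "n + m"]) (auto simp: add.commute)
    then show "\<exists>k l. n + k = m + l \<and> chain_map (stage_emb c) n k t = chain_map (stage_emb c) m l s"
      by (intro exI[of _ m] exI[of _ n]) simp
  qed
  then show ?thesis
    using assms by (auto simp: limit_class_def limit_rel_def word_class_def)
qed

lemma words_ending_cover:
  assumes "w \<in> words_ending c" "length w \<le> Suc m"
  obtains t where "t \<in> verts (stage c m)" "dec t = w"
proof -
  have "w \<in> dec ` verts (stage c m)"
    using dec_bij[of c m] assms by (auto simp: bij_betw_def words_upto_def)
  then show ?thesis using that by auto
qed

lemma dec_in_words_ending: "t \<in> verts (stage c m) \<Longrightarrow> dec t \<in> words_ending c"
  using bij_betwE[OF dec_bij[of c m]] by (auto simp: words_upto_def)

definition limit_graph :: "bool \<Rightarrow> (nat \<times> ('b + 'a) nest) set rgraph" where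
  "limit_graph c = inductive_limit (stage c) (stage_emb c)"

lemma limit_graph_verts: "verts (limit_graph c) = word_class c ` words_ending c"
proof -
  have "verts (limit_graph c) = {word_class c (dec t) | n t. t \<in> verts (stage c n)}"
    unfolding limit_graph_def inductive_limit_def rgraph.simps
    by (intro Collect_cong ex_cong1) (auto simp: limit_class_eq)
  also have "\<dots> = word_class c ` words_ending c"
  proof (intro set_eqI iffI)
    fix X assume "X \<in> {word_class c (dec t) | n t. t \<in> verts (stage c n)}"
    then show "X \<in> word_class c ` words_ending c" using dec_in_words_ending by auto
  next
    fix X assume "X \<in> word_class c ` words_ending c"
    then obtain w where w: "X = word_class c w" "w \<in> words_ending c" by blast
    obtain t where "t \<in> verts (stage c (length w))" "dec t = w"
      using words_ending_cover[OF w(2), of "length w"] by auto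
    then show "X \<in> {word_class c (dec t) | n t. t \<in> verts (stage c n)}" using w(1) by blast
  qed
  finally show ?thesis .
qed

lemma limit_graph_root: "root (limit_graph c) = word_class c []"
  by (simp add: limit_graph_def inductive_limit_def limit_class_eq stage_root_in dec_root)

lemma word_class_inj: "inj_on (word_class c) (words_ending c)"
proof (rule inj_onI)
  fix w w' assume w: "w \<in> words_ending c" and eq: "word_class c w = word_class c w'"
  obtain t where "t \<in> verts (stage c (length w))" "dec t = w"
    using words_ending_cover[OF w, of "length w"] by auto
  then have "(length w, t) \<in> word_class c w" by (simp add: word_class_def)
  then show "w = w'" unfolding eq by (simp add: word_class_def \<open>dec t = w\<close>)
qed

lemma limit_graph_edges:
  assumes w: "w \<in> words_ending c" "w' \<in> words_ending c"
  shows "{word_class c w, word_class c w'} \<in> edges (limit_graph c) \<longleftrightarrow> fadj w w'"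
proof
  assume "{word_class c w, word_class c w'} \<in> edges (limit_graph c)"
  then obtain n t s where e: "{t, s} \<in> edges (stage c n)"
    and eq: "{word_class c w, word_class c w'} =
      {limit_class (stage c) (stage_emb c) n t, limit_class (stage c) (stage_emb c) n s}"
    by (auto simp: limit_graph_def inductive_limit_def)
  have v: "t \<in> verts (stage c n)" "s \<in> verts (stage c n)"
    using simple_rooted_graph.edge_verts[OF stage_simple e] by auto
  have "{word_class c w, word_class c w'} = {word_class c (dec t), word_class c (dec s)}"
    using eq v by (simp add: limit_class_eq)
  then have "w = dec t \<and> w' = dec s \<or> w = dec s \<and> w' = dec t"
    using inj_onD[OF word_class_inj] w dec_in_words_ending[OF v(1)] dec_in_words_ending[OF v(2)]
    unfolding doubleton_eq_iff by metis
  then show "fadj w w'" using e v dec_edges fadj_sym by auto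
next
  assume adj: "fadj w w'"
  \<comment> \<open>A stage large enough to contain both words.\<close>
  define m where "m = length w + length w'"
  obtain t where t: "t \<in> verts (stage c m)" "dec t = w"
    using words_ending_cover[OF w(1), of m] by (auto simp: m_def)
  obtain s where s: "s \<in> verts (stage c m)" "dec s = w'"
    using words_ending_cover[OF w(2), of m] by (auto simp: m_def)
  note ts = t s
  then have "{t, s} \<in> edges (stage c m)" using adj dec_edges by auto
  moreover have "word_class c w = limit_class (stage c) (stage_emb c) m t"
    "word_class c w' = limit_class (stage c) (stage_emb c) m s"
    using ts by (auto simp: limit_class_eq)
  ultimately show "{word_class c w, word_class c w'} \<in> edges (limit_graph c)"
    unfolding limit_graph_def inductive_limit_def by auto
qed

lemma orth_limit_eq: "orth_limit G2 G1 = limit_graph False"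
  unfolding orth_limit_def limit_graph_def Let_def by (simp add: stage_def[abs_def] factor_def)

theorem free_product_iso: "rgraph_iso (free_product G1 G2) (comb_product G1 (orth_limit G2 G1))"
proof -
  define h where "h = inv_into (words_ending False) (word_class False)"
  have bij: "bij_betw (word_class False) (words_ending False) (verts (limit_graph False))"
    using word_class_inj by (simp add: bij_betw_def limit_graph_verts)
  have h: "bij_betw h (verts (limit_graph False)) (words_ending False)"
    unfolding h_def by (rule bij_betw_inv_into[OF bij])
  have wh: "word_class False (h y) = y" if "y \<in> verts (limit_graph False)" for y
    using bij_betw_inv_into_right[OF bij that] by (simp add: h_def)
  have nil: "[] \<in> words_ending False" by (simp add: words_ending_def)
  interpret glued_words G1 G2 G1 Inl True "limit_graph False" h
  proof
    show "is_factor G1 Inl True" by (rule is_factor_G1)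
    show "h ` verts (limit_graph False) \<subseteq> words_ending (\<not> True)" using h by (simp add: bij_betw_def)
    show "inj_on h (verts (limit_graph False))" using h by (rule bij_betw_imp_inj_on)
    show "root (limit_graph False) \<in> verts (limit_graph False)"
      using nil by (simp add: limit_graph_root limit_graph_verts)
    show "h (root (limit_graph False)) = []"
      unfolding h_def limit_graph_root by (rule inv_into_f_f[OF word_class_inj nil])
    show "{y, y'} \<in> edges (limit_graph False) \<longleftrightarrow> fadj (h y) (h y')"
      if "y \<in> verts (limit_graph False)" "y' \<in> verts (limit_graph False)" for y y'
      using limit_graph_edges[of "h y" False "h y'"] bij_betwE[OF h] that wh by simp
  qed
  show ?thesis
    unfolding orth_limit_eq by (rule comb_rgraph_iso) (use h in \<open>simp add: bij_betw_def\<close>)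
qed

text \<open>Word length is the level function in the comparison of walks; this provides the part of
  the free product that walks of bounded length can see.\<close>

lemma comb_stage_range:
  assumes "w \<in> W" "length w \<le> Suc m"
  shows "w \<in> glued_words.glue G1 G2 Inl dec ` verts (comb_product G1 (stage False m))"
proof -
  interpret glued_words G1 G2 G1 Inl True "stage False m" dec by (rule glued_words_stage)
  have "w \<in> glue ` (verts G1 \<times> verts (stage False m))"
  proof (rule in_glue_image[OF assms(1)])
    fix u a assume u: "w = u @ [a]" "isl a = True"
    then have "u \<in> words_ending False" "length u \<le> Suc m"
      using assms snoc_in_W[of u a] by (auto simp: words_ending_def)
    then show "u \<in> dec ` verts (stage False m)" using words_ending_cover by blast
  next
    fix u a assume "w = u @ [a]" "isl a \<noteq> True"
    then have "w \<in> words_ending False" using assms by (auto simp: words_ending_def)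
    then show "w \<in> dec ` verts (stage False m)" using words_ending_cover assms(2) by blast
  qed
  then show ?thesis by simp
qed

end

section \<open>Freeness\<close>

lemma poly_word_value_diff:
  "poly_word_value (\<lambda>w. \<phi> w - \<phi>' w) w ips = poly_word_value \<phi> w ips - poly_word_value \<phi>' w ips"
  by (induction ips arbitrary: w) (simp_all add: sum_subtractf right_diff_distrib)

lemma poly_word_value_eq_0:
  assumes "\<And>v. length v < N \<Longrightarrow> \<phi> v = 0" and "length w + (\<Sum>ip\<leftarrow>ips. degree (snd ip)) < N"
  shows "poly_word_value \<phi> w ips = 0"
  using assms(2) by (induction ips arbitrary: w) (simp_all add: assms(1))

text \<open>If the functional vanishes on shorter words, only the product of the leading monomials
  contributes. Meant for a difference of two functionals in an induction on word length.\<close>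

lemma poly_word_value_monic:
  assumes "\<And>v. length v < N \<Longrightarrow> \<phi> v = 0" and "length w + (\<Sum>ip\<leftarrow>ips. degree (snd ip)) \<le> N"
    and "\<forall>ip\<in>set ips. lead_coeff (snd ip) = 1"
  shows "poly_word_value \<phi> w ips = \<phi> (w @ concat (map (\<lambda>ip. replicate (degree (snd ip)) (fst ip)) ips))"
  using assms(2,3)
proof (induction ips arbitrary: w)
  case (Cons ip ips)
  let ?n = "degree (snd ip)"
  have "poly_word_value \<phi> (w @ replicate k (fst ip)) ips = 0" if "k < ?n" for k
    by (rule poly_word_value_eq_0[where N = N, OF assms(1)]) (use that Cons.prems(1) in simp_all)
  then have "poly_word_value \<phi> w (ip # ips) = poly_word_value \<phi> (w @ replicate ?n (fst ip)) ips"
    using Cons.prems(2) by (simp flip: lessThan_Suc_atMost)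
  also have "\<dots> = \<phi> ((w @ replicate ?n (fst ip)) @ concat (map (\<lambda>ip. replicate (degree (snd ip)) (fst ip)) ips))"
    by (rule Cons.IH) (use Cons.prems in simp_all)
  finally show ?case by simp
qed simp

lemma word_blocks:
  fixes w :: "bool list"
  assumes "w \<noteq> []"
  shows "\<exists>bs. bs \<noteq> [] \<and> fst (hd bs) = hd w \<and> successively (\<lambda>a b. fst a \<noteq> fst b) bs \<and>
    (\<forall>b\<in>set bs. snd b > 0) \<and> w = concat (map (\<lambda>b. replicate (snd b) (fst b)) bs)"
  using assms
proof (induction w)
  case (Cons a w)
  show ?case
  proof (cases "w = []")
    case True
    then show ?thesis by (intro exI[of _ "[(a, 1)]"]) simp
  next
    case False
    then obtain bs where bs: "bs \<noteq> []" "fst (hd bs) = hd w" "successively (\<lambda>a b. fst a \<noteq> fst b) bs"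
      "\<forall>b\<in>set bs. snd b > 0" "w = concat (map (\<lambda>b. replicate (snd b) (fst b)) bs)"
      using Cons.IH by blast
    then obtain k cs where cs: "bs = (hd w, k) # cs" by (cases bs) auto
    show ?thesis
    proof (cases "hd w = a")
      case True
      then show ?thesis using bs unfolding cs
        by (intro exI[of _ "(a, Suc k) # cs"]) (auto simp: successively_Cons)
    next
      case False
      then show ?thesis using bs unfolding cs
        by (intro exI[of _ "(a, 1) # (hd w, k) # cs"]) (auto simp: successively_Cons)
    qed
  qed
qed simp

text \<open>The alternating product of the centred powers \<open>X\<^bsub>i\<^esub> ^ k - \<phi> (X\<^bsub>i\<^esub> ^ k)\<close> expresses the value of a word
  through values of shorter words.\<close>

lemma free_functional_unique:
  assumes free: "free_functional \<phi>" "free_functional \<phi>'"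
    and marg: "\<And>c k. \<phi> (replicate k c) = \<phi>' (replicate k c)"
  shows "\<phi> = \<phi>'"
proof
  fix w show "\<phi> w = \<phi>' w"
  proof (induction w rule: length_induct)
    case (1 w)
    show ?case
    proof (cases "w = []")
      case True
      then show ?thesis using free by (simp add: free_functional_def)
    next
      case False
      from word_blocks[OF this] obtain bs where bs: "bs \<noteq> []" "successively (\<lambda>a b. fst a \<noteq> fst b) bs"
        "\<forall>b\<in>set bs. snd b > 0" "w = concat (map (\<lambda>b. replicate (snd b) (fst b)) bs)" by blast
      \<comment> \<open>Centred by construction with respect to \<open>\<phi>\<close>, and monic
        because each block has positive length.\<close>
      define q :: "bool \<times> nat \<Rightarrow> bool \<times> real poly" where
        "q = (\<lambda>b. (fst b, monom 1 (snd b) - [:\<phi> (replicate (snd b) (fst b)):]))"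
      define ips where "ips = map q bs"
      have deg: "degree (snd (q b)) = snd b" and lead: "lead_coeff (snd (q b)) = 1" if "snd b > 0" for b
      proof -
        show d: "degree (snd (q b)) = snd b"
          unfolding q_def diff_conv_add_uminus
          using that by (simp add: degree_add_eq_left degree_monom_eq)
        show "lead_coeff (snd (q b)) = 1"
          unfolding d using that by (simp add: q_def coeff_pCons split: nat.split)
      qed
      have centred: "poly_word_value \<psi> [] [q b] = 0"
        if pos: "snd b > 0" and "\<psi> [] = 1" and "\<psi> (replicate (snd b) (fst b)) = \<phi> (replicate (snd b) (fst b))" for \<psi> b
      proof -
        obtain n where n: "snd b = Suc n" using gr0_implies_Suc[OF pos] ..
        have "poly_word_value \<psi> [] [q b] = (\<Sum>k\<le>snd b. coeff (snd (q b)) k * \<psi> (replicate k (fst b)))"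
          using deg[OF that(1)] by (simp add: q_def)
        also have "\<dots> = (\<Sum>k\<le>snd b. (if k = snd b then \<psi> (replicate k (fst b)) else 0) -
            (if k = 0 then \<phi> (replicate (snd b) (fst b)) * \<psi> (replicate k (fst b)) else 0))"
          by (intro sum.cong refl) (auto simp: q_def coeff_pCons n split: nat.split)
        also have "\<dots> = 0"
          using that by (simp add: sum_subtractf)
        finally show ?thesis .
      qed
      have alt: "successively (\<lambda>a b. fst a \<noteq> fst b) ips"
        using bs(2) by (simp add: ips_def successively_map q_def)
      have zero: "poly_word_value \<psi> [] ips = 0"
        if "free_functional \<psi>" "\<And>k c. \<psi> (replicate k c) = \<phi> (replicate k c)" for \<psi>
      proof -
        have one: "\<psi> [] = 1"
          and free_\<psi>: "\<And>ips. ips \<noteq> [] \<Longrightarrow> successively (\<lambda>a b. fst a \<noteq> fst b) ips \<Longrightarrow>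
            \<forall>ip\<in>set ips. poly_word_value \<psi> [] [ip] = 0 \<Longrightarrow> poly_word_value \<psi> [] ips = 0"
          using that(1) unfolding free_functional_def by blast+
        have "poly_word_value \<psi> [] [ip] = 0" if "ip \<in> set ips" for ip
        proof -
          obtain b where b: "ip = q b" "b \<in> set bs" using \<open>ip \<in> set ips\<close> by (auto simp: ips_def)
          then have "snd b > 0" using bs(3) by blast
          then show ?thesis unfolding b(1) using one \<open>\<And>k c. \<psi> (replicate k c) = \<phi> (replicate k c)\<close> by (rule centred)
        qed
        then show ?thesis using alt bs(1) by (intro free_\<psi>) (simp_all add: ips_def)
      qed
      \<comment> \<open>\<open>D\<close> is not unital, but the expansion into monomials only needs
        linearity; by the induction hypothesis \<open>D\<close> vanishes on shorter words.\<close>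
      define D where "D = (\<lambda>v. \<phi> v - \<phi>' v)"
      have conc: "concat (map (\<lambda>ip. replicate (degree (snd ip)) (fst ip)) ips) = w"
        unfolding bs(4) ips_def using bs(3) deg
        by (auto simp: q_def intro!: arg_cong[of _ _ concat])
      have len: "(\<Sum>ip\<leftarrow>ips. degree (snd ip)) = length w"
        unfolding conc[symmetric] by (simp add: length_concat o_def)
      have "poly_word_value D [] ips = D ([] @ concat (map (\<lambda>ip. replicate (degree (snd ip)) (fst ip)) ips))"
      proof (rule poly_word_value_monic[where N = "length w"])
        show "D v = 0" if "length v < length w" for v using 1 that by (simp add: D_def)
        show "length [] + (\<Sum>ip\<leftarrow>ips. degree (snd ip)) \<le> length w" using len by simp
        show "\<forall>ip\<in>set ips. lead_coeff (snd ip) = 1" using lead bs(3) by (auto simp: ips_def)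
      qed
      moreover have "poly_word_value D [] ips = 0"
        unfolding D_def poly_word_value_diff using zero[OF free(1)] zero[OF free(2)] marg by simp
      ultimately show ?thesis by (simp add: conc D_def)
    qed
  qed
qed

section \<open>The two edge operators of the free product\<close>

context free_product_graphs
begin

text \<open>Every word is uniquely \<open>wd a @ u\<close> with \<open>a\<close> a letter of type
  \<open>c\<close>, possibly the root, and \<open>u\<close> not starting in type \<open>c\<close>.
  The words with a common \<open>u\<close> form one copy of the factor of type
  \<open>c\<close>.\<close>

definition head_letter :: "bool \<Rightarrow> ('a + 'b) list \<Rightarrow> 'a + 'b" where
  "head_letter c w = (if w \<noteq> [] \<and> isl (hd w) = c then hd w else rlet c)"

definition tail_word :: "bool \<Rightarrow> ('a + 'b) list \<Rightarrow> ('a + 'b) list" where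
  "tail_word c w = (if w \<noteq> [] \<and> isl (hd w) = c then tl w else w)"

text \<open>The adjacency operator along the edges of type \<open>c\<close>: it acts on each copy of
  that factor as the factor's own adjacency operator.\<close>

definition letter_op :: "bool \<Rightarrow> (('a + 'b) list \<Rightarrow> real) \<Rightarrow> ('a + 'b) list \<Rightarrow> real" where
  "letter_op c f w = (\<Sum>b | ladj (head_letter c w) b. f (wd b @ tail_word c w))"

definition not_starting :: "bool \<Rightarrow> ('a + 'b) list set" where
  "not_starting c = {u \<in> W. u \<noteq> [] \<longrightarrow> isl (hd u) \<noteq> c}"

lemma head_letter_in_lets: "w \<in> W \<Longrightarrow> head_letter c w \<in> lets c"
  by (cases w) (auto simp: head_letter_def Cons_in_W)

lemma tail_word_not_starting: "w \<in> W \<Longrightarrow> tail_word c w \<in> not_starting c"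
  by (cases w) (auto simp: tail_word_def not_starting_def Cons_in_W)

lemma isl_head_letter [simp]: "isl (head_letter c w) = c"
  by (simp add: head_letter_def)

lemma head_tail_word:
  assumes "w \<in> W"
  shows "w = wd (head_letter c w) @ tail_word c w"
proof (cases "w \<noteq> [] \<and> isl (hd w) = c")
  case True
  then obtain a u where w: "w = a # u" "isl a = c" by (cases w) auto
  then have "a \<noteq> rlet c" using assms by (auto simp: Cons_in_W)
  then show ?thesis using w by (simp add: head_letter_def tail_word_def wd_eq)
next
  case False
  then have "head_letter c w = rlet c" "tail_word c w = w"
    by (auto simp: head_letter_def tail_word_def)
  then show ?thesis by simp
qed

lemma wd_append_in_W:
  assumes "a \<in> lets c" "u \<in> not_starting c"
  shows "wd a @ u \<in> W"
  using assms isl_lets[OF assms(1)] by (auto simp: wd_eq not_starting_def Cons_in_W)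

lemma head_letter_append:
  assumes "a \<in> lets c" "u \<in> not_starting c"
  shows "head_letter c (wd a @ u) = a" "tail_word c (wd a @ u) = u"
  using assms isl_lets[OF assms(1)] by (auto simp: wd_eq not_starting_def head_letter_def tail_word_def)

lemma neighbours_free_product:
  assumes w: "w \<in> W"
  shows "neighbours (free_product G1 G2) w = (\<Union>c. (\<lambda>b. wd b @ tail_word c w) ` {b. ladj (head_letter c w) b})"
proof -
  have "fadj w w' \<longleftrightarrow> (\<exists>c b. ladj (head_letter c w) b \<and> w' = wd b @ tail_word c w)" for w'
  proof
    assume "fadj w w'"
    then obtain a b t where *: "ladj a b" "w = wd a @ t" "w' = wd b @ t" "t \<in> W" "w' \<in> W"
      by (auto simp: fadj_def)
    define c where "c = isl a"
    have ab: "a \<in> lets c" "b \<in> lets c" "isl b = c" "a \<noteq> b" using ladjD[OF *(1)] by (auto simp: c_def)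
    \<comment> \<open>At least one of \<open>a\<close> and \<open>b\<close> is not the root and
      stands in front of \<open>t\<close> in a reduced word.\<close>
    have "t \<in> not_starting c"
    proof (cases "a = rlet c")
      case True
      then have "wd b = [b]" using ab wd_eq[OF ab(3)] by simp
      then show ?thesis using * ab by (auto simp: not_starting_def Cons_in_W)
    next
      case False
      then have "wd a = [a]" using wd_eq[of a c] by (simp add: c_def)
      then show ?thesis using * w c_def by (auto simp: not_starting_def Cons_in_W)
    qed
    then have "head_letter c w = a" "tail_word c w = t" unfolding *(2) using ab head_letter_append by auto
    then show "\<exists>c b. ladj (head_letter c w) b \<and> w' = wd b @ tail_word c w"
      by (intro exI[of _ c] exI[of _ b]) (simp add: *(1,3))
  next
    assume "\<exists>c b. ladj (head_letter c w) b \<and> w' = wd b @ tail_word c w"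
    then obtain c b where *: "ladj (head_letter c w) b" "w' = wd b @ tail_word c w" by blast
    have "b \<in> lets c" using ladjD(2)[OF *(1)] by simp
    then have "w' \<in> W" using *(2) wd_append_in_W tail_word_not_starting[OF w] by simp
    moreover have "tail_word c w \<in> W" using tail_word_not_starting[OF w] by (simp add: not_starting_def)
    ultimately show "fadj w w'"
      unfolding fadj_def using * head_tail_word[OF w, of c] w by blast
  qed
  then show ?thesis by (auto simp: neighbours_def fp_edge_iff)
qed

lemma inj_on_letters: "inj_on (\<lambda>b. wd b @ t) {b. ladj a b}"
  using ladjD(3) wd_inj by (auto intro!: inj_onI)

text \<open>Edges of the type of the first letter do not lengthen a nonempty word, those of the
  other type do. From the empty word both lengthen, but by letters of different types.\<close>

lemma letter_neighbours_disjoint: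
  assumes w: "w \<in> W"
  shows "(\<lambda>b. wd b @ tail_word True w) ` {b. ladj (head_letter True w) b} \<inter>
    (\<lambda>b. wd b @ tail_word False w) ` {b. ladj (head_letter False w) b} = {}"
proof -
  have aux: "wd b @ tail_word c w \<noteq> wd b' @ tail_word (\<not> c) w"
    if w': "w \<noteq> [] \<longrightarrow> isl (hd w) = c" and b: "ladj (head_letter c w) b" "ladj (head_letter (\<not> c) w) b'" for c b b'
  proof
    assume eq: "wd b @ tail_word c w = wd b' @ tail_word (\<not> c) w"
    have "head_letter (\<not> c) w = rlet (\<not> c)" "tail_word (\<not> c) w = w"
      using w' by (auto simp: head_letter_def tail_word_def)
    then have b': "isl b' = (\<not> c)" "b' \<noteq> rlet (\<not> c)" using ladjD(3,4)[OF b(2)] by auto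
    then have r: "wd b' @ tail_word (\<not> c) w = b' # w"
      using wd_eq[of b' "\<not> c"] \<open>tail_word (\<not> c) w = w\<close> by simp
    have b'': "isl b = c" using ladjD(3)[OF b(1)] by simp
    show False
    proof (cases w)
      case Nil
      then show False using eq r b' b'' wd_eq[of b c] by (auto simp: tail_word_def split: if_splits)
    next
      case (Cons a u)
      then have "length (wd b @ tail_word c w) \<le> length w"
        using w' wd_eq[OF b''] by (simp add: tail_word_def)
      then show False unfolding eq r by simp
    qed
  qed
  show ?thesis
  proof (cases "w \<noteq> [] \<longrightarrow> isl (hd w) = True")
    case True
    then show ?thesis using aux[of True] by auto
  next
    case False
    then have "w \<noteq> [] \<longrightarrow> isl (hd w) = False" by simp
    then show ?thesis using aux[of False] by (auto dest: sym)
  qed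
qed

end

locale bounded_free_product =
  free_product_graphs G1 G2 + G1: bounded_degree_graph G1 d1 + G2: bounded_degree_graph G2 d2
  for G1 :: "'a rgraph" and G2 :: "'b rgraph" and d1 d2
begin

definition fdeg :: "bool \<Rightarrow> nat" where
  "fdeg c = (if c then d1 else d2)"

lemma bounded_factor: "bounded_degree_graph (factor c) (fdeg c)"
  using bounded_degree_relabel[OF G1.bounded_degree_graph_axioms inj_leaf(1)]
    bounded_degree_relabel[OF G2.bounded_degree_graph_axioms inj_leaf(2)]
  by (auto simp: factor_def fdeg_def)

sublocale F: bounded_degree_graph "factor c" "fdeg c" for c
  by (rule bounded_factor)

lemma letter_neighbours:
  assumes "x \<in> verts (factor c)"
  shows "{b. ladj (leaf_letter x) b} = leaf_letter ` neighbours (factor c) x"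
proof -
  have F: "leaf_letter ` verts (factor c) = lets c"
    "\<And>y. y \<in> verts (factor c) \<Longrightarrow> {x, y} \<in> edges (factor c) \<longleftrightarrow> ladj (leaf_letter x) (leaf_letter y)"
    using is_factor_factor[of c] assms by (auto simp: is_factor_def bij_betw_def)
  have "leaf_letter x \<in> lets c" using F(1) assms by blast
  then have x: "isl (leaf_letter x) = c" by (rule isl_lets)
  show ?thesis
  proof (intro set_eqI iffI)
    fix b assume "b \<in> {b. ladj (leaf_letter x) b}"
    then have b: "ladj (leaf_letter x) b" by simp
    then have "b \<in> lets c" using ladjD(2) x by blast
    then obtain y where "y \<in> verts (factor c)" "b = leaf_letter y" unfolding F(1)[symmetric] by blast
    then show "b \<in> leaf_letter ` neighbours (factor c) x" using b F(2)[of y] by (auto simp: neighbours_def)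
  next
    fix b assume "b \<in> leaf_letter ` neighbours (factor c) x"
    then obtain y where "b = leaf_letter y" "y \<in> neighbours (factor c) x" by blast
    then show "b \<in> {b. ladj (leaf_letter x) b}"
      using F(2)[of y] F.neighboursD(2)[of y c x] by (simp add: neighbours_def)
  qed
qed

lemma leaf_letter_inj: "inj_on leaf_letter (neighbours (factor c) x)"
proof (rule inj_on_subset)
  show "inj_on leaf_letter (verts (factor c))" using is_factor_factor[of c] by (auto simp: is_factor_def bij_betw_def)
  show "neighbours (factor c) x \<subseteq> verts (factor c)" using F.neighboursD(2) by blast
qed

lemma letter_vertex:
  assumes "a \<in> lets c"
  obtains x where "x \<in> verts (factor c)" "leaf_letter x = a"
proof -
  have "a \<in> leaf_letter ` verts (factor c)"
    using is_factor_factor[of c] assms by (simp add: is_factor_def bij_betw_def)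
  then show ?thesis using that by auto
qed

lemma finite_letter_neighbours:
  assumes "a \<in> lets c"
  shows "finite {b. ladj a b}" "card {b. ladj a b} \<le> fdeg c"
proof -
  obtain x where "x \<in> verts (factor c)" "leaf_letter x = a" using letter_vertex[OF assms] .
  then show "finite {b. ladj a b}" "card {b. ladj a b} \<le> fdeg c"
    using letter_neighbours[of x c] F.card_neighbours[of c x] by (auto simp: card_image[OF leaf_letter_inj])
qed

lemma bounded_free_product: "bounded_degree_graph (free_product G1 G2) (d1 + d2)"
proof (rule bounded_degree_graphI[OF simple_rooted_free_product])
  fix w assume "w \<in> verts (free_product G1 G2)"
  then have w: "w \<in> W" by simp
  let ?N = "\<lambda>c. (\<lambda>b. wd b @ tail_word c w) ` {b. ladj (head_letter c w) b}"
  have N: "finite (?N c)" "card (?N c) \<le> fdeg c" for c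
    using finite_letter_neighbours[OF head_letter_in_lets[OF w, of c]] by (auto simp: card_image[OF inj_on_letters])
  have "neighbours (free_product G1 G2) w = ?N True \<union> ?N False"
    unfolding neighbours_free_product[OF w] UNIV_bool by auto
  then show "finite (neighbours (free_product G1 G2) w) \<and> card (neighbours (free_product G1 G2) w) \<le> d1 + d2"
    using N[of True] N[of False] card_Un_le[of "?N True" "?N False"] by (simp add: fdeg_def)
qed

sublocale P: bounded_degree_graph "free_product G1 G2" "d1 + d2"
  by (rule bounded_free_product)

lemma adj_op_free_product:
  assumes w: "w \<in> W"
  shows "adj_op (free_product G1 G2) f w = letter_op True f w + letter_op False f w"
proof -
  let ?N = "\<lambda>c. (\<lambda>b. wd b @ tail_word c w) ` {b. ladj (head_letter c w) b}"
  have "finite (?N c)" for c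
    using finite_letter_neighbours[OF head_letter_in_lets[OF w, of c]] by simp
  moreover have "neighbours (free_product G1 G2) w = ?N True \<union> ?N False"
    unfolding neighbours_free_product[OF w] UNIV_bool by auto
  moreover have "sum f (?N c) = letter_op c f w" for c
    unfolding letter_op_def by (subst sum.reindex[OF inj_on_letters]) simp
  ultimately show ?thesis
    unfolding adj_op_def by (simp only: sum.union_disjoint[OF _ _ letter_neighbours_disjoint[OF w]])
qed

lemma adj_op_pow_free_product:
  assumes "w \<in> W"
  shows "(adj_op (free_product G1 G2) ^^ n) f w = (\<Sum>s | length s = n. foldr letter_op s f w)"
  using assms
proof (induction n arbitrary: w)
  case (Suc n)
  have fin: "finite {s :: bool list. length s = n}" using finite_lists_length_eq[of "UNIV :: bool set" n] by simp
  have Suc_eq: "{s :: bool list. length s = Suc n} = (\<lambda>s. True # s) ` {s. length s = n} \<union> (\<lambda>s. False # s) ` {s. length s = n}"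
    by (auto simp: length_Suc_conv image_iff)
  have "(adj_op (free_product G1 G2) ^^ Suc n) f w =
      (\<Sum>y\<in>neighbours (free_product G1 G2) w. \<Sum>s | length s = n. foldr letter_op s f y)"
    unfolding adj_op_pow_Suc using P.neighboursD(2)[of _ w] by (intro sum.cong refl Suc.IH) simp
  also have "\<dots> = (\<Sum>s | length s = n. adj_op (free_product G1 G2) (foldr letter_op s f) w)"
    unfolding adj_op_def by (rule sum.swap)
  also have "\<dots> = (\<Sum>s | length s = n. foldr letter_op (True # s) f w) + (\<Sum>s | length s = n. foldr letter_op (False # s) f w)"
    by (simp add: adj_op_free_product[OF Suc.prems] sum.distrib)
  also have "\<dots> = (\<Sum>s | length s = Suc n. foldr letter_op s f w)"
    unfolding Suc_eq using fin
    by (subst sum.union_disjoint) (auto simp: sum.reindex)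
  finally show ?case .
qed simp

lemma letter_op_append:
  assumes "x \<in> verts (factor c)" "u \<in> not_starting c"
  shows "letter_op c f (wd (leaf_letter x) @ u) = (\<Sum>y\<in>neighbours (factor c) x. f (wd (leaf_letter y) @ u))"
proof -
  have "leaf_letter x \<in> lets c"
    using is_factor_factor[of c] assms(1) by (auto simp: is_factor_def bij_betw_def)
  then show ?thesis
    unfolding letter_op_def head_letter_append[OF _ assms(2)] letter_neighbours[OF assms(1)]
    by (simp add: sum.reindex[OF leaf_letter_inj] head_letter_append[OF _ assms(2)] letter_neighbours[OF assms(1)])
qed

lemma leaf_letter_root: "leaf_letter (root (factor c)) = rlet c"
  using is_factor_factor[of c] by (simp add: is_factor_def)

lemma leaf_letter_lets: "x \<in> verts (factor c) \<Longrightarrow> leaf_letter x \<in> lets c"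
  using is_factor_factor[of c] by (auto simp: is_factor_def bij_betw_def)

lemma leaf_letter_eq_root:
  assumes "x \<in> verts (factor c)"
  shows "leaf_letter x = rlet c \<longleftrightarrow> x = root (factor c)"
  using is_factor_factor[of c] inj_on_eq_iff[of leaf_letter "verts (factor c)" x "root (factor c)"] assms leaf_letter_root[of c]
  by (simp add: is_factor_def bij_betw_def)

text \<open>On the copy of the factor over \<open>u\<close>, such an \<open>f\<close> is
  \<open>f u\<close> times the delta function at the root, so the powers act as in the factor
  alone.\<close>

lemma letter_op_pow:
  assumes f: "\<And>w. w \<in> W \<Longrightarrow> w \<noteq> [] \<Longrightarrow> isl (hd w) = c \<Longrightarrow> f w = 0"
    and "x \<in> verts (factor c)" and u: "u \<in> not_starting c"
  shows "(letter_op c ^^ k) f (wd (leaf_letter x) @ u) = (adj_op (factor c) ^^ k) (delta (root (factor c))) x * f u"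
  using assms(2)
proof (induction k arbitrary: x)
  case 0
  show ?case
  proof (cases "x = root (factor c)")
    case True
    then show ?thesis by (simp add: leaf_letter_root delta_def)
  next
    case False
    have l: "isl (leaf_letter x) = c" using leaf_letter_lets[OF 0] by (rule isl_lets)
    then have "wd (leaf_letter x) = [leaf_letter x]" using leaf_letter_eq_root[OF 0] False wd_eq[OF l] by simp
    then show ?thesis
      using f[of "leaf_letter x # u"] wd_append_in_W[OF leaf_letter_lets[OF 0] u] False l by (simp add: delta_def)
  qed
next
  case (Suc k)
  have "(letter_op c ^^ Suc k) f (wd (leaf_letter x) @ u) =
      (\<Sum>y\<in>neighbours (factor c) x. (letter_op c ^^ k) f (wd (leaf_letter y) @ u))"
    by (simp add: letter_op_append[OF Suc.prems u])
  also have "\<dots> = (\<Sum>y\<in>neighbours (factor c) x. (adj_op (factor c) ^^ k) (delta (root (factor c))) y * f u)"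
    using F.neighboursD(2)[of _ c x] by (intro sum.cong refl Suc.IH)
  also have "\<dots> = (adj_op (factor c) ^^ Suc k) (delta (root (factor c))) x * f u"
    unfolding adj_op_pow_Suc by (rule sum_distrib_right[symmetric])
  finally show ?case .
qed

text \<open>The vacuum state: the diagonal coefficient at the empty word of a product of the two
  edge operators.\<close>

definition fp_functional :: "bool list \<Rightarrow> real" where
  "fp_functional s = foldr letter_op s (delta []) []"

text \<open>The result of applying the product of polynomials to the vacuum vector, rightmost factor
  first, so that supports can be followed through the factors.\<close>

primrec poly_vector :: "(bool \<times> real poly) list \<Rightarrow> ('a + 'b) list \<Rightarrow> real" where
  "poly_vector [] = delta []"
| "poly_vector (ip # ips) = (\<lambda>v. \<Sum>k\<le>degree (snd ip). coeff (snd ip) k * (letter_op (fst ip) ^^ k) (poly_vector ips) v)"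

lemma foldr_letter_op_sum:
  "foldr letter_op s (\<lambda>v. \<Sum>k\<in>A. q k * g k v) = (\<lambda>v. \<Sum>k\<in>A. q k * foldr letter_op s (g k) v)"
proof (induction s)
  case (Cons c s)
  have "letter_op c (\<lambda>v. \<Sum>k\<in>A. q k * h k v) w = (\<Sum>k\<in>A. q k * letter_op c (h k) w)" for h w
    unfolding letter_op_def sum_distrib_left by (rule sum.swap)
  then show ?case by (simp add: Cons.IH)
qed simp

lemma foldr_letter_op_replicate: "foldr letter_op (s @ replicate k c) f = foldr letter_op s ((letter_op c ^^ k) f)"
proof -
  have "foldr letter_op (replicate k c) f = (letter_op c ^^ k) f" by (induction k) simp_all
  then show ?thesis by simp
qed

lemma poly_word_value_fp_functional:
  "poly_word_value fp_functional s ips = foldr letter_op s (poly_vector ips) []"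
proof (induction ips arbitrary: s)
  case (Cons ip ips)
  show ?case
    by (simp only: poly_word_value.simps Cons.IH foldr_letter_op_replicate poly_vector.simps foldr_letter_op_sum)
qed (simp add: fp_functional_def)

lemma fp_functional_replicate:
  "fp_functional (replicate k c) = (adj_op (factor c) ^^ k) (delta (root (factor c))) (root (factor c))"
proof -
  have "fp_functional (replicate k c) = (letter_op c ^^ k) (delta []) (wd (leaf_letter (root (factor c))) @ [])"
    using foldr_letter_op_replicate[of "[]" k c "delta []"] by (simp add: fp_functional_def leaf_letter_root)
  also have "\<dots> = (adj_op (factor c) ^^ k) (delta (root (factor c))) (root (factor c)) * delta [] ([] :: ('a + 'b) list)"
    by (rule letter_op_pow) (auto simp: delta_def not_starting_def)
  finally show ?thesis by (simp add: delta_def)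
qed

lemma poly_vector_support:
  assumes "successively (\<lambda>a b. fst a \<noteq> fst b) ips" "\<forall>ip\<in>set ips. poly_word_value fp_functional [] [ip] = 0"
    and "w \<in> W" "poly_vector ips w \<noteq> 0"
  shows "if ips = [] then w = [] else w \<noteq> [] \<and> isl (hd w) = fst (hd ips)"
  using assms
proof (induction ips arbitrary: w)
  case Nil
  then show ?case by (auto simp: delta_def split: if_splits)
next
  case (Cons ip ips)
  obtain c p where ip: "ip = (c, p)" by force
  \<comment> \<open>The remaining product lives on words starting in the type of its first factor,
    which differs from \<open>c\<close>, or on the empty word.\<close>
  have f: "poly_vector ips v = 0" if v: "v \<in> W" "v \<noteq> []" "isl (hd v) = c" for v
  proof (rule ccontr)
    assume "poly_vector ips v \<noteq> 0"
    then have "if ips = [] then v = [] else v \<noteq> [] \<and> isl (hd v) = fst (hd ips)"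
      using Cons.prems(1,2) v by (intro Cons.IH) (auto simp: successively_Cons)
    then have "ips \<noteq> []" "fst (hd ips) = c" using v by (auto split: if_splits)
    then show False using Cons.prems(1) by (simp add: successively_Cons ip)
  qed
  show ?case
  proof (rule ccontr)
    assume "\<not> ?thesis"
    then have w: "w \<in> not_starting c" using Cons.prems(3) by (auto simp: not_starting_def ip)
    \<comment> \<open>Such a \<open>w\<close> is the root of its copy of the factor of type
      \<open>c\<close>, so each power contributes its moment at the root, and the moments combine to
      the value of the centred polynomial.\<close>
    have "poly_vector (ip # ips) w = (\<Sum>k\<le>degree p. coeff p k * (letter_op c ^^ k) (poly_vector ips) (wd (leaf_letter (root (factor c))) @ w))"
      by (simp add: ip leaf_letter_root)
    also have "\<dots> = (\<Sum>k\<le>degree p. coeff p k * (fp_functional (replicate k c) * poly_vector ips w))"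
      unfolding fp_functional_replicate by (intro sum.cong refl arg_cong2[of _ _ _ _ "(*)"] letter_op_pow f w) simp_all
    also have "\<dots> = poly_word_value fp_functional [] [ip] * poly_vector ips w"
      by (simp add: ip sum_distrib_right mult.assoc)
    also have "\<dots> = 0" using Cons.prems(2) by simp
    finally show False using Cons.prems(4) by simp
  qed
qed

lemma free_fp_functional: "free_functional fp_functional"
  unfolding free_functional_def
proof (intro conjI allI impI)
  show "fp_functional [] = 1" by (simp add: fp_functional_def delta_def)
  fix ips assume *: "ips \<noteq> [] \<and> successively (\<lambda>a b. fst a \<noteq> fst b) ips \<and> (\<forall>ip\<in>set ips. poly_word_value fp_functional [] [ip] = 0)"
  have "poly_vector ips [] = 0"
    using poly_vector_support[of ips "[]"] * by auto
  then show "poly_word_value fp_functional [] ips = 0"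
    by (simp add: poly_word_value_fp_functional)
qed

lemma spectral_factor:
  "spectral_distribution (factor True) \<mu> \<longleftrightarrow> spectral_distribution G1 \<mu>"
  "spectral_distribution (factor False) \<nu> \<longleftrightarrow> spectral_distribution G2 \<nu>"
  by (simp_all add: factor_def spectral_distribution_relabel[OF G1.bounded_degree_graph_axioms inj_leaf(1)]
      spectral_distribution_relabel[OF G2.bounded_degree_graph_axioms inj_leaf(2)])

text \<open>The vacuum state witnesses that \<open>\<rho>\<close> qualifies. Any other candidate
  comes with a free functional of the same marginals, which is the same functional, and so has the
  same moments.\<close>

theorem free_conv_eq:
  assumes \<mu>: "spectral_distribution G1 \<mu>" and \<nu>: "spectral_distribution G2 \<nu>"
    and \<rho>: "spectral_distribution (free_product G1 G2) \<rho>"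
  shows "free_conv \<mu> \<nu> = \<rho>"
  unfolding free_conv_def
proof (rule the_equality)
  have marg: "fp_functional (replicate k True) = (LINT t|\<mu>. t ^ k)" "fp_functional (replicate k False) = (LINT t|\<nu>. t ^ k)" for k
    using \<mu> \<nu> by (simp_all add: fp_functional_replicate F.spectral_distribution_iff flip: spectral_factor)
  have mom: "(LINT t|\<rho>. t ^ n) = (\<Sum>w | length w = n. fp_functional w)" for n
    using \<rho> by (simp add: P.spectral_distribution_iff adj_op_pow_free_product fp_functional_def)
  show *: "real_distribution \<rho> \<and> compactly_supported \<rho> \<and> (\<exists>\<phi>. free_functional \<phi> \<and>
      (\<forall>k. \<phi> (replicate k True) = (LINT t|\<mu>. t ^ k)) \<and> (\<forall>k. \<phi> (replicate k False) = (LINT t|\<nu>. t ^ k)) \<and>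
      (\<forall>n. (LINT t|\<rho>. t ^ n) = (\<Sum>w | length w = n. \<phi> w)))"
    using \<rho> P.spectral_distribution_compactly_supported[OF \<rho>] free_fp_functional marg mom
    by (auto simp: P.spectral_distribution_iff)
  fix \<rho>' assume "real_distribution \<rho>' \<and> compactly_supported \<rho>' \<and> (\<exists>\<phi>. free_functional \<phi> \<and>
      (\<forall>k. \<phi> (replicate k True) = (LINT t|\<mu>. t ^ k)) \<and> (\<forall>k. \<phi> (replicate k False) = (LINT t|\<nu>. t ^ k)) \<and>
      (\<forall>n. (LINT t|\<rho>'. t ^ n) = (\<Sum>w | length w = n. \<phi> w)))"
  then obtain \<phi> where \<rho>': "real_distribution \<rho>'" "compactly_supported \<rho>'" and \<phi>: "free_functional \<phi>"
    "\<And>k. \<phi> (replicate k True) = (LINT t|\<mu>. t ^ k)" "\<And>k. \<phi> (replicate k False) = (LINT t|\<nu>. t ^ k)"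
    "\<And>n. (LINT t|\<rho>'. t ^ n) = (\<Sum>w | length w = n. \<phi> w)" by blast
  have "\<phi> (replicate k c) = fp_functional (replicate k c)" for c k
    using \<phi>(2,3) marg by (cases c) simp_all
  then have "\<phi> = fp_functional"
    using free_functional_unique[OF \<phi>(1) free_fp_functional] by blast
  then show "\<rho>' = \<rho>"
    using \<rho>' * \<phi>(4) mom by (intro compactly_supported_eqI) auto
qed

theorem weak_limit:
  assumes \<mu>: "spectral_distribution G1 \<mu>" and \<nu>: "spectral_distribution G2 \<nu>"
    and \<rho>: "spectral_distribution (free_product G1 G2) \<rho>"
  shows "weak_conv_m (\<lambda>m. monotone_conv \<mu> (orth_conv_iter m \<nu> \<mu>)) \<rho>"
proof -
  let ?M = "\<lambda>m. monotone_conv \<mu> (orth_conv_iter m \<nu> \<mu>)"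
  let ?K = "\<lambda>m. comb_product G1 (stage False m)"
  have emb: "rgraph_embedding (glued_words.glue G1 G2 Inl dec) (?K m) (free_product G1 G2) (d1 + d2)" for m
  proof -
    interpret glued_words G1 G2 G1 Inl True "stage False m" dec by (rule glued_words_stage)
    have "simple_rooted_graph (?K m)"
      by (intro simple_rooted_comb_product stage_simple G1.simple_rooted_graph_axioms)
    then show ?thesis
      using comb_rgraph_emb bounded_free_product
      by (simp add: rgraph_embedding_def rgraph_embedding_axioms_def)
  qed
  have spec: "spectral_distribution (?K m) (?M m)" for m
  proof -
    obtain D where "bounded_degree_graph (stage False m) D" "spectral_distribution (stage False m) (orth_conv_iter m \<nu> \<mu>)"
      using orth_iter_spectral[OF bounded_factor[of False] bounded_factor[of True], of \<nu> \<mu> m] \<mu> \<nu>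
      by (auto simp: stage_def spectral_factor)
    then show ?thesis
      using monotone_conv_is_spectral[OF G1.bounded_degree_graph_axioms _ \<mu>] by blast
  qed
  \<comment> \<open>The bound \<open>d1 + d2\<close> does not depend on \<open>m\<close>, as the
    common support bound in the moment criterion requires.\<close>
  note bd = rgraph_embedding.bounded_degree_domain[OF emb]
  show ?thesis
  proof (rule weak_conv_if_moments_tendsto)
    show "real_distribution (?M m)" for m
      using spec bounded_degree_graph.spectral_distribution_iff[OF bd] by blast
    show "real_distribution \<rho>" using \<rho> by (simp add: P.spectral_distribution_iff)
    show "AE t in ?M m. \<bar>t\<bar> \<le> real (d1 + d2)" for m
      by (rule bounded_degree_graph.spectral_distribution_AE[OF bd spec])
    show "AE t in \<rho>. \<bar>t\<bar> \<le> real (d1 + d2)"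
      by (rule P.spectral_distribution_AE[OF \<rho>])
    show "(\<lambda>m. LINT t|?M m. t ^ k) \<longlonglongrightarrow> (LINT t|\<rho>. t ^ k)" for k
    proof (rule tendsto_eventually, rule eventually_sequentiallyI)
      fix m assume "k \<le> m"
      then show "(LINT t|?M m. t ^ k) = (LINT t|\<rho>. t ^ k)"
        \<comment> \<open>The level of a word is its length; stage \<open>m\<close> covers length
          \<open>m + 1\<close>, one more than required.\<close>
        by (rule rgraph_embedding.moments_eq[OF emb, of length m, OF _ _ _ _ spec \<rho>, rotated 3])
          (use comb_stage_range fadj_length in \<open>auto simp: fp_edge_iff\<close>)
    qed
  qed
qed

end

theorem theorem8p6:
  fixes G1 :: "'a rgraph" and G2 :: "'b rgraph" and \<mu> \<nu> :: "real measure"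
  assumes "rooted_graph G1" and "rooted_graph G2"
    and "spectral_distribution G1 \<mu>" and "spectral_distribution G2 \<nu>"
  shows "rgraph_iso (free_product G1 G2) (comb_product G1 (orth_limit G2 G1)) \<and>
    (uniformly_locally_finite G1 \<and> uniformly_locally_finite G2 \<longrightarrow>
       (\<forall>\<rho>. spectral_distribution (free_product G1 G2) \<rho> \<longleftrightarrow> \<rho> = free_conv \<mu> \<nu>) \<and>
       weak_conv_m (\<lambda>m. monotone_conv \<mu> (orth_conv_iter m \<nu> \<mu>)) (free_conv \<mu> \<nu>))"
proof (intro conjI impI)
  interpret free_product_graphs G1 G2
    using assms(1,2) by (simp add: free_product_graphs_def rooted_graph_imp_simple)
  show "rgraph_iso (free_product G1 G2) (comb_product G1 (orth_limit G2 G1))"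
    by (rule free_product_iso)
next
  assume ulf: "uniformly_locally_finite G1 \<and> uniformly_locally_finite G2"
  obtain d1 where d1: "bounded_degree_graph G1 d1"
    using rooted_graph_imp_bounded[OF assms(1)] ulf by blast
  obtain d2 where d2: "bounded_degree_graph G2 d2"
    using rooted_graph_imp_bounded[OF assms(2)] ulf by blast
  interpret bounded_free_product G1 G2 d1 d2
    using d1 d2 by (simp add: bounded_free_product_def free_product_graphs_def bounded_degree_graph_def)
  obtain \<rho> where \<rho>: "spectral_distribution (free_product G1 G2) \<rho>"
    using P.spectral_distribution_exists by blast
  \<comment> \<open>Stated for every spectral distribution, so that together with existence it
    yields the equivalence.\<close>
  have eq: "free_conv \<mu> \<nu> = \<rho>'" if "spectral_distribution (free_product G1 G2) \<rho>'" for \<rho>'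
    using free_conv_eq[OF assms(3,4) that] .
  show "\<forall>\<rho>. spectral_distribution (free_product G1 G2) \<rho> \<longleftrightarrow> \<rho> = free_conv \<mu> \<nu>"
    using eq \<rho> by metis
  show "weak_conv_m (\<lambda>m. monotone_conv \<mu> (orth_conv_iter m \<nu> \<mu>)) (free_conv \<mu> \<nu>)"
    using weak_limit[OF assms(3,4) \<rho>] eq[OF \<rho>] by simp
qed

end
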